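(* Let $s\in(0,1]$ and $p\in[1,+\infty]$ be such that $sp>N$. Let $\Omega\subset\mathbb{R}^N$ be an open and bounded domain with Lipschitz boundary. Let $\widetilde s\in[0,1]$ and $\widetilde p\in[1,+\infty]$, and exclude the trivial cases $(\widetilde s,\widetilde p)=(s,p)$ and $\widetilde s=s=1$ with $1\le\widetilde p\le p$. If $\widetilde s$ and $\widetilde p$ do not satisfy $$\text{either}\quad\begin{cases}0\le\widetilde s\le\dfrac{sp-N}{p},\\ 1\le\widetilde p\le+\infty,\end{cases}\qquad\text{or}\qquad\begin{cases}\dfrac{sp-N}{p}<\widetilde s<s,\\ 1\le\widetilde p\le\dfrac{Np}{N-(s-\widetilde s)p},\end{cases}$$ then the space $W^{s,p}(\Omega)$ is not continuously embedded in $W^{\widetilde s,\widetilde p}(\Omega)$.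
   Context: $N\ge1$ is an integer and functions are real-valued and measurable. For $s\in[0,1]$ and $p\in[1,+\infty)$ define $[u]_{W^{0,p}(\Omega)}:=\|u\|_{L^p(\Omega)}$, $[u]_{W^{1,p}(\Omega)}:=\|\nabla u\|_{L^p(\Omega)}$ (weak gradient) and, for $s\in(0,1)$, $$[u]_{W^{s,p}(\Omega)}:=\left(c_{N,s,p}\iint_{\Omega\times\Omega}\frac{|u(x)-u(y)|^p}{|x-y|^{N+sp}}\,dx\,dy\right)^{1/p},\qquad c_{N,s,p}:=\frac{s\,2^{2s-1}\,\Gamma\left(\frac{ps+p+N-2}{2}\right)}{\pi^{N/2}\,\Gamma(1-s)}.$$ Set $W^{s,p}(\Omega):=\{u\in L^p(\Omega):[u]_{W^{s,p}(\Omega)}<+\infty\}$, with norm $\|u\|_{W^{0,p}(\Omega)}:=\|u\|_{L^p(\Omega)}$ if $s=0$ and $\|u\|_{W^{s,p}(\Omega)}:=\big([u]^p_{W^{s,p}(\Omega)}+\|u\|^p_{L^p(\Omega)}\big)^{1/p}$ if $s\in(0,1]$. For $p=+\infty$: $W^{0,\infty}(\Omega):=L^\infty(\Omega)$ and, for $s\in(0,1]$, $W^{s,\infty}(\Omega):=C^{0,s}(\Omega)$ with norm $\|u\|_{L^\infty(\Omega)}+\sup_{x\neq y\in\Omega}\frac{|u(x)-u(y)|}{|x-y|^s}$ (functions being identified up to a.e. equality). Convention: $\frac{sp-N}{p}$ means $s-\frac Np$ with $\frac N\infty=0$ (so if $p=+\infty$ it equals $s$, the condition $sp>N$ holds, and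 the second alternative is empty). *)

theory Defs
  imports "HOL-Probability.Essential_Supremum"
begin

text \<open>Real powers of extended nonnegative numbers; the value at \<open>\<infinity>\<close> is right only for \<open>a > 0\<close>, the only case used.\<close>

definition ennpowr :: "ennreal \<Rightarrow> real \<Rightarrow> ennreal" where
  "ennpowr x a = (if x = \<infinity> then \<infinity> else ennreal (enn2real x powr a))"

definition Lp_norm :: "ereal \<Rightarrow> 'a::euclidean_space set \<Rightarrow> ('a \<Rightarrow> 'b::real_normed_vector) \<Rightarrow> ennreal" where
  "Lp_norm p \<Omega> f =
     (if p = \<infinity> then esssup (lebesgue_on \<Omega>) (\<lambda>x. ennreal (norm (f x)))
      else ennpowr (\<integral>\<^sup>+x. ennreal (norm (f x) powr real_of_ereal p) \<partial>lebesgue_on \<Omega>)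
             (1 / real_of_ereal p))"

primrec Ck :: "nat \<Rightarrow> ('a::euclidean_space \<Rightarrow> real) \<Rightarrow> bool" where
  "Ck 0 \<phi> \<longleftrightarrow> continuous_on UNIV \<phi>"
| "Ck (Suc k) \<phi> \<longleftrightarrow> (\<forall>x. \<phi> differentiable (at x)) \<and>
     (\<forall>i\<in>Basis. Ck k (\<lambda>x. frechet_derivative \<phi> (at x) i))"

definition test_function :: "'a::euclidean_space set \<Rightarrow> ('a \<Rightarrow> real) \<Rightarrow> bool" where
  "test_function \<Omega> \<phi> \<longleftrightarrow> (\<forall>k. Ck k \<phi>) \<and>
     compact (closure {x. \<phi> x \<noteq> 0}) \<and> closure {x. \<phi> x \<noteq> 0} \<subseteq> \<Omega>"

definition locally_integrable :: "'a::euclidean_space set \<Rightarrow> ('a \<Rightarrow> 'b::euclidean_space) \<Rightarrow> bool" where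
  "locally_integrable \<Omega> f \<longleftrightarrow> (\<forall>K. compact K \<and> K \<subseteq> \<Omega> \<longrightarrow> integrable (lebesgue_on K) f)"

definition weak_gradient :: "'a::euclidean_space set \<Rightarrow> ('a \<Rightarrow> real) \<Rightarrow> ('a \<Rightarrow> 'a) \<Rightarrow> bool" where
  "weak_gradient \<Omega> u g \<longleftrightarrow> locally_integrable \<Omega> u \<and> locally_integrable \<Omega> g \<and>
     (\<forall>\<phi>. test_function \<Omega> \<phi> \<longrightarrow> (\<forall>i\<in>Basis.
        (LINT x|lebesgue_on \<Omega>. u x * frechet_derivative \<phi> (at x) i) =
        - (LINT x|lebesgue_on \<Omega>. (g x \<bullet> i) * \<phi> x)))"

definition gagliardo_const :: "nat \<Rightarrow> real \<Rightarrow> real \<Rightarrow> real" where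
  "gagliardo_const N s p =
     s * 2 powr (2 * s - 1) * Gamma ((p * s + p + real N - 2) / 2) /
     (pi powr (real N / 2) * Gamma (1 - s))"

definition gagliardo_seminorm ::
    "real \<Rightarrow> real \<Rightarrow> 'a::euclidean_space set \<Rightarrow> ('a \<Rightarrow> real) \<Rightarrow> ennreal" where
  "gagliardo_seminorm s p \<Omega> u =
     ennpowr (ennreal (gagliardo_const DIM('a) s p) *
       (\<integral>\<^sup>+z. ennreal (\<bar>u (fst z) - u (snd z)\<bar> powr p /
                  norm (fst z - snd z) powr (real DIM('a) + s * p))
          \<partial>lebesgue_on (\<Omega> \<times> \<Omega>))) (1 / p)"

definition hoelder_seminorm :: "real \<Rightarrow> 'a::euclidean_space set \<Rightarrow> ('a \<Rightarrow> real) \<Rightarrow> ennreal" where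
  "hoelder_seminorm s \<Omega> v =
     (SUP (x, y) \<in> {(x, y). x \<in> \<Omega> \<and> y \<in> \<Omega> \<and> x \<noteq> y}. ennreal (\<bar>v x - v y\<bar> / norm (x - y) powr s))"

text \<open>
  Extended-valued seminorms of (representatives of) a.e. classes; the value is \<open>\<infinity>\<close> outside the
  space. For \<open>s = 1\<close> the infimum is over all weak gradients of \<open>u\<close>: these agree a.e., so it is
  the common value of the norm, and it is \<open>\<infinity>\<close> if there is none. For \<open>p = \<infinity>\<close>, \<open>s > 0\<close> the
  infimum is over the representatives of \<open>u\<close>: on an open set at most one of them (up to its
  values outside \<open>\<Omega>\<close>) is continuous, and the seminorm is \<open>\<infinity>\<close> on all others.
\<close>

definition sobolev_seminorm ::
    "real \<Rightarrow> ereal \<Rightarrow> 'a::euclidean_space set \<Rightarrow> ('a \<Rightarrow> real) \<Rightarrow> ennreal" where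
  "sobolev_seminorm s p \<Omega> u =
     (if s = 0 then Lp_norm p \<Omega> u
      else if p = \<infinity> then
        (INF v \<in> {v. AE x in lebesgue_on \<Omega>. v x = u x}. hoelder_seminorm s \<Omega> v)
      else if s = 1 then (INF g \<in> {g. weak_gradient \<Omega> u g}. Lp_norm p \<Omega> g)
      else gagliardo_seminorm s (real_of_ereal p) \<Omega> u)"

definition sobolev_space ::
    "real \<Rightarrow> ereal \<Rightarrow> 'a::euclidean_space set \<Rightarrow> ('a \<Rightarrow> real) set" where
  "sobolev_space s p \<Omega> = {u \<in> borel_measurable (lebesgue_on \<Omega>).
     Lp_norm p \<Omega> u < \<infinity> \<and> sobolev_seminorm s p \<Omega> u < \<infinity>}"

definition sobolev_norm ::
    "real \<Rightarrow> ereal \<Rightarrow> 'a::euclidean_space set \<Rightarrow> ('a \<Rightarrow> real) \<Rightarrow> ennreal" where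
  "sobolev_norm s p \<Omega> u =
     (if s = 0 then Lp_norm p \<Omega> u
      else if p = \<infinity> then Lp_norm p \<Omega> u + sobolev_seminorm s p \<Omega> u
      else ennpowr (ennpowr (sobolev_seminorm s p \<Omega> u) (real_of_ereal p) +
                    ennpowr (Lp_norm p \<Omega> u) (real_of_ereal p)) (1 / real_of_ereal p))"

definition continuously_embedded ::
    "real \<Rightarrow> ereal \<Rightarrow> real \<Rightarrow> ereal \<Rightarrow> 'a::euclidean_space set \<Rightarrow> bool" where
  "continuously_embedded s p s' p' \<Omega> \<longleftrightarrow>
     sobolev_space s p \<Omega> \<subseteq> sobolev_space s' p' \<Omega> \<and>
     (\<exists>C::real. \<forall>u \<in> sobolev_space s p \<Omega>.
        sobolev_norm s' p' \<Omega> u \<le> ennreal C * sobolev_norm s p \<Omega> u)"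

text \<open>
  Near each boundary point, in a rotated orthonormal frame whose last axis is \<open>e\<close>, the set is
  the strict epigraph of a Lipschitz function of the remaining \<open>N - 1\<close> coordinates; these
  coordinates of \<open>y\<close> are encoded as its projection onto the hyperplane orthogonal to \<open>e\<close>.
\<close>

definition lipschitz_boundary :: "'a::euclidean_space set \<Rightarrow> bool" where
  "lipschitz_boundary \<Omega> \<longleftrightarrow>
     (\<forall>x0 \<in> frontier \<Omega>. \<exists>r>0. \<exists>e. norm e = 1 \<and>
        (\<exists>\<gamma> L. L-lipschitz_on {z. z \<bullet> e = 0} \<gamma> \<and>
           \<Omega> \<inter> ball x0 r = {y \<in> ball x0 r. \<gamma> (y - (y \<bullet> e) *\<^sub>R e) < y \<bullet> e}))"

end

theory Submission
  imports Defs "HOL-Analysis.Ball_Volume"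
begin

text \<open>
  Let \<open>N\<close> be the dimension. Outside the admissible range there are two obstructions.

  Concentration: if \<open>s' \<le> s\<close> and \<open>s' - N / p' > s - N / p\<close>, take a \<open>C\<^sup>1\<close> profile supported in a ball of
  radius \<open>1 / l\<close> and of height \<open>l powr - s\<close>. It is \<open>s\<close>-Hoelder uniformly in \<open>l\<close>, so its \<open>W\<^sup>s\<^sup>,\<^sup>p\<close>
  norm is at most \<open>l powr - (N / p)\<close> up to a power of \<open>ln l\<close>, which is harmless because the inequality
  between the exponents is strict; its norm in the target space is at least
  \<open>l powr (s' - s - N / p')\<close>, up to a constant.

  Oscillation: if \<open>s' > s\<close>, or \<open>s' = s < 1\<close> and \<open>p' < p\<close>, take the lacunary sums of
  \<open>M powr (- j s) * sin (M ^ j * (x \<bullet> e) + \<theta>)\<close> over \<open>j \<le> n\<close>. They are uniformly \<open>s\<close>-Hoelder, so each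
  scale contributes at most a constant to the Gagliardo integral and the \<open>W\<^sup>s\<^sup>,\<^sup>p\<close> norm is of order at
  most \<open>n powr (1 / p)\<close>. Conversely, at distance about \<open>M powr - j\<close> the \<open>j\<close>-th term dominates
  everywhere, so scale \<open>j\<close> contributes at least \<open>M powr (j * (s' - s) * p')\<close> to the Gagliardo integral of
  the target space: its norm is at least of order \<open>n powr (1 / p')\<close> if \<open>s' = s\<close>, and
  \<open>M powr (n * (s' - s))\<close> if \<open>s' > s\<close>.
\<close>

section \<open>Norms\<close>

text \<open>A Hoelder bound of order \<open>s\<close> alone lets the Gagliardo integral diverge
  logarithmically at the diagonal. A Lipschitz bound below the scale \<open>2 ^ - L\<close> cuts
  this off at the price of a factor \<open>1 + L\<close>. That factor is the logarithm for the peaks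
  with \<open>l = 2 ^ L\<close> and, up to a constant, the number of terms for the lacunary sums, so
  one upper bound serves both families; this is why all scales are powers of 2.

  Two obstacles shape the lower bounds. The seminorms for \<open>s' = 1\<close> and for
  \<open>p' = \<infinity>\<close> are infima over objects known only almost everywhere; they are
  reached through integrals against test functions and through open sets of pairs of points. For the
  lacunary sums, a fixed phase can make the dominant term stationary at a given pair. Of the phases
  0 and \<open>pi / 2\<close> one always works, but which one depends on the pair, so both integrals
  are added and the larger keeps at least half.

  Because \<open>s * p > N\<close>, the value \<open>s' = 0\<close> belongs to the first
  alternative, and every target space that remains measures a positive order of
  differentiability.\<close>

lemma ennpowr_ennreal: "0 \<le> x \<Longrightarrow> ennpowr (ennreal x) a = ennreal (x powr a)"
  by (simp add: ennpowr_def)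

lemma ennpowr_mono:
  assumes "x \<le> y" "0 \<le> a"
  shows "ennpowr x a \<le> ennpowr y a"
proof (cases "y = \<infinity>")
  case False
  then have "x \<noteq> \<infinity>" using assms(1) by (auto simp: top_unique)
  then show ?thesis using False assms
    by (auto simp: ennpowr_def less_top intro!: ennreal_leI powr_mono2 enn2real_mono)
qed (simp add: ennpowr_def)

lemma ennpowr_ennpowr:
  assumes "0 < a" "0 < b"
  shows "ennpowr (ennpowr x a) b = ennpowr x (a * b)"
  using assms by (auto simp: ennpowr_def powr_powr)

lemma ennpowr_1: "ennpowr x 1 = x"
  by (auto simp: ennpowr_def less_top)

lemma ennpowr_eq_top_iff: "ennpowr x a = \<infinity> \<longleftrightarrow> x = \<infinity>"
  by (auto simp: ennpowr_def)

lemma ennpowr_Lp_norm: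
  assumes "1 \<le> p"
  shows "ennpowr (Lp_norm (ereal p) \<Omega> f) p = (\<integral>\<^sup>+x. ennreal (norm (f x) powr p) \<partial>lebesgue_on \<Omega>)"
  using assms by (simp add: Lp_norm_def ennpowr_ennpowr ennpowr_1)

lemma ennpowr_gagliardo_seminorm:
  fixes \<Omega> :: "'a::euclidean_space set"
  assumes "1 \<le> p"
  shows "ennpowr (gagliardo_seminorm s p \<Omega> u) p = ennreal (gagliardo_const DIM('a) s p) *
       (\<integral>\<^sup>+z. ennreal (\<bar>u (fst z) - u (snd z)\<bar> powr p /
                  norm (fst z - snd z) powr (real DIM('a) + s * p))
          \<partial>lebesgue_on (\<Omega> \<times> \<Omega>))"
  using assms by (simp add: gagliardo_seminorm_def ennpowr_ennpowr ennpowr_1)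

lemma gagliardo_const_pos:
  assumes "0 < s" "s < 1" "1 \<le> p" "1 \<le> N"
  shows "0 < gagliardo_const N s p"
proof -
  have "0 < p * s + p + real N - 2"
    using assms mult_pos_pos[of p s] by linarith
  then show ?thesis
    using assms by (auto simp: gagliardo_const_def intro!: divide_pos_pos mult_pos_pos Gamma_real_pos)
qed

lemma sobolev_seminorm_le_norm:
  assumes "0 < s" "1 \<le> p"
  shows "sobolev_seminorm s p \<Omega> u \<le> sobolev_norm s p \<Omega> u"
proof (cases p)
  case (real r)
  then have r: "1 \<le> r" using assms by (simp add: one_ereal_def)
  have "sobolev_seminorm s p \<Omega> u = ennpowr (ennpowr (sobolev_seminorm s p \<Omega> u) r) (1 / r)"
    using r by (simp add: ennpowr_ennpowr ennpowr_1)
  also have "\<dots> \<le> sobolev_norm s p \<Omega> u"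
    using assms r real by (auto simp: sobolev_norm_def intro!: ennpowr_mono)
  finally show ?thesis .
qed (use assms in \<open>auto simp: sobolev_norm_def\<close>)

lemma sobolev_norm_le:
  assumes "0 < s" "1 \<le> p" "0 \<le> a" "0 \<le> b"
    and "u \<in> borel_measurable (lebesgue_on \<Omega>)"
    and a: "ennpowr (sobolev_seminorm s (ereal p) \<Omega> u) p \<le> ennreal a"
    and b: "(\<integral>\<^sup>+x. ennreal (\<bar>u x\<bar> powr p) \<partial>lebesgue_on \<Omega>) \<le> ennreal b"
  shows "u \<in> sobolev_space s (ereal p) \<Omega>"
    and "sobolev_norm s (ereal p) \<Omega> u \<le> ennreal ((a + b) powr (1 / p))"
proof -
  have b': "ennpowr (Lp_norm (ereal p) \<Omega> u) p \<le> ennreal b"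
    using b ennpowr_Lp_norm[of p \<Omega> u] assms(2) by simp
  have "Lp_norm (ereal p) \<Omega> u \<noteq> \<infinity>" "sobolev_seminorm s (ereal p) \<Omega> u \<noteq> \<infinity>"
    using a b' ennpowr_eq_top_iff[of _ p] by (metis ennreal_less_top infinity_ennreal_def leD)+
  then show "u \<in> sobolev_space s (ereal p) \<Omega>"
    using assms by (simp add: sobolev_space_def less_top)
  have "sobolev_norm s (ereal p) \<Omega> u \<le> ennpowr (ennreal (a + b)) (1 / p)"
    using assms a b' by (auto simp: sobolev_norm_def intro!: ennpowr_mono add_mono simp: ennreal_plus)
  then show "sobolev_norm s (ereal p) \<Omega> u \<le> ennreal ((a + b) powr (1 / p))"
    using assms by (simp add: ennpowr_ennreal del: ennreal_plus)
qed

lemma le_ennpowr_inverse: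
  assumes "0 < a" "0 \<le> x" "ennreal x \<le> ennpowr y a"
  shows "ennreal (x powr (1 / a)) \<le> y"
proof -
  have "ennreal (x powr (1 / a)) = ennpowr (ennreal x) (1 / a)"
    using assms by (simp add: ennpowr_ennreal del: ennreal_plus)
  also have "\<dots> \<le> ennpowr (ennpowr y a) (1 / a)"
    using assms by (intro ennpowr_mono) auto
  also have "\<dots> = y" using assms by (simp add: ennpowr_ennpowr ennpowr_1)
  finally show ?thesis .
qed

text \<open>The norm inequality is what gets contradicted, not the inclusion of the spaces. The real
  bounds \<open>a\<close> and \<open>b\<close> move the comparison from extended to real
  numbers.\<close>

lemma not_continuously_embeddedI:
  assumes "\<And>C. \<exists>u a b. u \<in> sobolev_space s p \<Omega> \<and> sobolev_norm s p \<Omega> u \<le> ennreal a \<and>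
     ennreal b \<le> sobolev_norm s' p' \<Omega> u \<and> 0 \<le> a \<and> C * a < b"
  shows "\<not> continuously_embedded s p s' p' \<Omega>"
proof
  assume "continuously_embedded s p s' p' \<Omega>"
  then obtain C where C: "\<And>u. u \<in> sobolev_space s p \<Omega> \<Longrightarrow>
      sobolev_norm s' p' \<Omega> u \<le> ennreal C * sobolev_norm s p \<Omega> u"
    unfolding continuously_embedded_def by blast
  \<comment> \<open>\<open>ennreal\<close> truncates a negative constant to 0, so the family is
    tested against \<open>max C 0\<close>.\<close>
  obtain u a b where u: "u \<in> sobolev_space s p \<Omega>" "sobolev_norm s p \<Omega> u \<le> ennreal a"
     "ennreal b \<le> sobolev_norm s' p' \<Omega> u" "0 \<le> a" "max C 0 * a < b"
    using assms by blast
  have "ennreal b \<le> ennreal C * sobolev_norm s p \<Omega> u" using u(1,3) C by (meson order_trans)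
  also have "\<dots> \<le> ennreal (max C 0) * ennreal a" by (intro mult_mono u ennreal_leI) auto
  also have "\<dots> = ennreal (max C 0 * a)" using u(4) by (simp add: ennreal_mult)
  finally have "b \<le> max C 0 * a" using u(4) by (simp add: ennreal_le_iff)
  then show False using u(5) by simp
qed

section \<open>Test functions\<close>

lemma Ck_SucI:
  assumes "\<And>x. (\<phi> has_derivative D x) (at x)" "\<And>i. i \<in> Basis \<Longrightarrow> Ck k (\<lambda>x. D x i)"
  shows "Ck (Suc k) \<phi>"
proof -
  have "frechet_derivative \<phi> (at x) = D x" for x
    using frechet_derivative_at[OF assms(1)] by metis
  then show ?thesis using assms by (auto simp: differentiable_def)
qed

lemma Ck_SucD:
  assumes "Ck (Suc k) \<phi>"
  shows "(\<phi> has_derivative frechet_derivative \<phi> (at x)) (at x)"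
    and "i \<in> Basis \<Longrightarrow> Ck k (\<lambda>x. frechet_derivative \<phi> (at x) i)"
  using assms by (auto simp: frechet_derivative_works)

lemma Ck_Suc_imp: "Ck (Suc k) \<phi> \<Longrightarrow> Ck k \<phi>"
proof (induction k arbitrary: \<phi>)
  case 0
  then show ?case
    by (auto simp: continuous_on_eq_continuous_at differentiable_imp_continuous_within)
next
  case (Suc k)
  show ?case
    by (rule Ck_SucI[OF Ck_SucD(1)[OF Suc.prems]]) (intro Suc.IH Ck_SucD(2)[OF Suc.prems])
qed

lemma Ck_const: "Ck k (\<lambda>x. c)"
proof (induction k arbitrary: c)
  case (Suc k)
  then show ?case by (intro Ck_SucI[where D="\<lambda>_ _. 0"]) auto
qed auto

lemma Ck_add: "Ck k f \<Longrightarrow> Ck k g \<Longrightarrow> Ck k (\<lambda>x. f x + g x)"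
proof (induction k arbitrary: f g)
  case (Suc k)
  then show ?case
    using Ck_SucD(1)[OF Suc.prems(1)] Ck_SucD(1)[OF Suc.prems(2)]
    by (intro Ck_SucI[OF has_derivative_add] Suc.IH Ck_SucD(2)) auto
qed (auto intro: continuous_intros)

lemma Ck_mult: "Ck k f \<Longrightarrow> Ck k g \<Longrightarrow> Ck k (\<lambda>x. f x * g x)"
proof (induction k arbitrary: f g)
  case (Suc k)
  show ?case
    by (rule Ck_SucI[OF has_derivative_mult[OF Ck_SucD(1)[OF Suc.prems(1)] Ck_SucD(1)[OF Suc.prems(2)]]])
      (intro Ck_add Suc.IH Suc.prems[THEN Ck_Suc_imp] Ck_SucD(2)[OF Suc.prems(1)] Ck_SucD(2)[OF Suc.prems(2)])
qed (auto intro: continuous_intros)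

lemma Ck_inner: "Ck k (\<lambda>x. (x - z) \<bullet> b)"
proof (cases k)
  case (Suc j)
  show ?thesis unfolding Suc
    by (rule Ck_SucI[where D="\<lambda>x h. h \<bullet> b"]) (auto intro!: derivative_eq_intros Ck_const)
qed (auto intro!: continuous_intros)

text \<open>Amplitude and phase are free because each partial derivative lies in the same family:
  the phase moves by \<open>pi / 2\<close> and the amplitude picks up \<open>m\<close> times a
  coordinate of \<open>b\<close>. So the induction closes without a separate cosine.\<close>

lemma Ck_sin: "Ck k (\<lambda>x. a * sin (m * (x \<bullet> b) + t))"
proof (induction k arbitrary: a t)
  case (Suc k)
  show ?case
  proof (rule Ck_SucI)
    show "((\<lambda>x. a * sin (m * (x \<bullet> b) + t)) has_derivative
       (\<lambda>h. (a * m * (h \<bullet> b)) * sin (m * (x \<bullet> b) + (t + pi / 2)))) (at x)" for x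
      by (auto intro!: derivative_eq_intros simp: sin_add cos_add algebra_simps)
  qed (rule Suc)
qed (auto intro!: continuous_intros)

text \<open>The negative powers of \<open>t\<close> are built in because differentiating
  \<open>exp (- (1 / t))\<close> produces them: the family, with all \<open>n\<close>, is closed
  under differentiation up to linear combinations.\<close>

definition flat :: "nat \<Rightarrow> real \<Rightarrow> real" where
  "flat n t = (if t \<le> 0 then 0 else exp (- (1 / t)) / t ^ n)"

lemma power_le_fact_exp:
  fixes x :: real
  assumes "0 \<le> x"
  shows "x ^ n \<le> fact n * exp x"
proof -
  obtain t where t: "exp x = (\<Sum>m<Suc n. (x ^ m) / fact m) + (exp t / fact (Suc n)) * x ^ Suc n"
    using Maclaurin_exp_le by blast
  have "x ^ n / fact n \<le> (\<Sum>m<Suc n. (x ^ m) / fact m)"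
    using assms by (intro member_le_sum[where f="\<lambda>m. x ^ m / fact m"]) auto
  also have "\<dots> \<le> exp x" using t assms by simp
  finally show ?thesis by (simp add: field_simps)
qed

text \<open>This is \<open>power_le_fact_exp\<close> at \<open>1 / t\<close> with exponent
  \<open>n + 2\<close>. The two spare powers leave the square of \<open>t\<close>, which makes the
  difference quotient at 0 tend to 0.\<close>

lemma flat_le: "\<bar>flat n t\<bar> \<le> fact (n + 2) * t\<^sup>2"
proof (cases "t \<le> 0")
  case False
  then have t: "0 < t" by simp
  have "(1 / t) ^ (n + 2) \<le> fact (n + 2) * exp (1 / t)"
    using t by (intro power_le_fact_exp) auto
  then have "exp (- (1 / t)) \<le> fact (n + 2) * t ^ (n + 2)"
    using t by (simp add: exp_minus field_simps)
  then have "exp (- (1 / t)) / t ^ n \<le> fact (n + 2) * t ^ (n + 2) / t ^ n"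
    using t by (intro divide_right_mono) auto
  also have "\<dots> = fact (n + 2) * t\<^sup>2" using t by (simp add: power_add power2_eq_square)
  finally show ?thesis using t by (simp add: flat_def)
qed (simp add: flat_def)

lemma DERIV_flat: "(flat n has_real_derivative flat (n + 2) t - real n * flat (n + 1) t) (at t)"
proof (cases t "0::real" rule: linorder_cases)
  case less
  have "((\<lambda>_. 0::real) has_real_derivative 0) (at t)" by simp
  then have "(flat n has_real_derivative 0) (at t)"
    by (rule has_field_derivative_transform_within_open[where S="{..<0}"])
      (use less in \<open>auto simp: flat_def\<close>)
  then show ?thesis using less by (simp add: flat_def)
next
  case equal
  have "((\<lambda>h. flat n h / h) \<longlongrightarrow> 0) (at 0)"
  proof (rule tendsto_0_le[where K="fact (n + 2)" and f="\<lambda>h::real. h"])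
    have "\<bar>flat n h\<bar> / \<bar>h\<bar> \<le> fact (n + 2) * \<bar>h\<bar>" if "h \<noteq> 0" for h
      using flat_le[of n h] that by (simp add: divide_le_eq power2_eq_square abs_mult_self_eq mult.assoc)
    then show "\<forall>\<^sub>F h in at 0. norm (flat n h / h) \<le> norm h * fact (n + 2)"
      by (auto simp: eventually_at_filter mult.commute)
  qed simp
  then show ?thesis using equal by (simp add: DERIV_def flat_def)
next
  case greater
  have "((\<lambda>t. t ^ n) has_real_derivative real n * t ^ n / t) (at t)"
    by (rule DERIV_cong[OF DERIV_pow]) (use greater in \<open>cases n; simp\<close>)
  moreover have "((\<lambda>t. exp (- (1 / t))) has_real_derivative exp (- (1 / t)) / t\<^sup>2) (at t)"
    using greater by (auto intro!: derivative_eq_intros simp: power2_eq_square)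
  ultimately have "((\<lambda>t. exp (- (1 / t)) / t ^ n) has_real_derivative
      (exp (- (1 / t)) / t\<^sup>2 * t ^ n - exp (- (1 / t)) * (real n * t ^ n / t)) / (t ^ n * t ^ n)) (at t)"
    using greater by (intro DERIV_divide) auto
  moreover have "(exp (- (1 / t)) / t\<^sup>2 * t ^ n - exp (- (1 / t)) * (real n * t ^ n / t)) / (t ^ n * t ^ n)
      = flat (n + 2) t - real n * flat (n + 1) t"
    using greater by (simp add: flat_def field_simps power2_eq_square)
  ultimately have "((\<lambda>t. exp (- (1 / t)) / t ^ n) has_real_derivative flat (n + 2) t - real n * flat (n + 1) t) (at t)"
    by simp
  then show ?thesis
    by (rule has_field_derivative_transform_within_open[where S="{0<..}"])
      (use greater in \<open>auto simp: flat_def\<close>)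
qed

text \<open>\<open>a\<close> and \<open>n\<close> are free because the chain rule returns two
  members of the same family times a multiple of an inner product.\<close>

lemma Ck_flat_ball:
  "Ck k (\<lambda>x. a * flat n (1 - ((x - z) \<bullet> (x - z)) / r\<^sup>2))"
proof (induction k arbitrary: n a)
  case 0
  have "continuous_on UNIV (flat n)"
    using DERIV_flat by (meson DERIV_isCont continuous_at_imp_continuous_on)
  moreover have "continuous_on UNIV (\<lambda>x. 1 - ((x - z) \<bullet> (x - z)) * inverse (r\<^sup>2))"
    by (intro continuous_on_diff continuous_on_mult continuous_on_inner continuous_on_const continuous_on_id)
  ultimately have "continuous_on UNIV (\<lambda>x. flat n (1 - ((x - z) \<bullet> (x - z)) * inverse (r\<^sup>2)))"
    by (rule continuous_on_compose2) auto
  then show ?case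
    unfolding Ck.simps divide_inverse by (intro continuous_on_mult continuous_on_const)
next
  case (Suc k)
  let ?T = "\<lambda>x. 1 - ((x - z) \<bullet> (x - z)) / r\<^sup>2"
  show ?case
  proof (rule Ck_SucI)
    \<comment> \<open>The coefficients \<open>1\<close> and \<open>- real n\<close> are written in
      front so that both summands match the induction hypothesis literally.\<close>
    show "((\<lambda>x. a * flat n (?T x)) has_derivative
      (\<lambda>h. (1 * flat (n + 2) (?T x) + (- real n) * flat (n + 1) (?T x)) * ((- 2 * a / r\<^sup>2) * ((x - z) \<bullet> h)))) (at x)" for x
    proof -
      have "(?T has_derivative (\<lambda>h. - 2 / r\<^sup>2 * ((x - z) \<bullet> h))) (at x)"
        by (cases "r = 0") (auto intro!: derivative_eq_intros simp: inner_commute field_simps)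
      from DERIV_compose_FDERIV[OF DERIV_flat this, of n]
      have "((\<lambda>x. flat n (?T x)) has_derivative
        (\<lambda>h. (- 2 / r\<^sup>2 * ((x - z) \<bullet> h)) * (flat (n + 2) (?T x) - real n * flat (n + 1) (?T x)))) (at x)"
        by simp
      from has_derivative_mult_right[OF this, of a] show ?thesis
        by (rule has_derivative_eq_rhs) (auto simp: algebra_simps)
    qed
    fix i :: 'a
    show "Ck k (\<lambda>x. (1 * flat (n + 2) (?T x) + (- real n) * flat (n + 1) (?T x)) * ((- 2 * a / r\<^sup>2) * ((x - z) \<bullet> i)))"
      by (rule Ck_mult[OF Ck_add[OF Suc Suc] Ck_mult[OF Ck_const Ck_inner]])
  qed
qed

text \<open>The usual mollifier profile without normalization, rescaled to the ball of radius
  \<open>r\<close> about \<open>z\<close>.\<close>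

definition bump :: "'a::euclidean_space \<Rightarrow> real \<Rightarrow> 'a \<Rightarrow> real" where
  "bump z r x = flat 0 (1 - ((x - z) \<bullet> (x - z)) / r\<^sup>2)"

lemma bump_bounds: "0 \<le> bump z r x" "bump z r x \<le> 1"
  by (auto simp: bump_def flat_def)

lemma bump_eq_0: "0 < r \<Longrightarrow> x \<notin> ball z r \<Longrightarrow> bump z r x = 0"
proof -
  assume "0 < r" "x \<notin> ball z r"
  then have "r\<^sup>2 \<le> (norm (x - z))\<^sup>2" by (intro power_mono) (auto simp: dist_norm norm_minus_commute)
  with \<open>0 < r\<close> show ?thesis by (simp add: bump_def flat_def power2_norm_eq_inner)
qed

text \<open>On the half ball the argument of \<open>flat 0\<close> is at least \<open>1 / 2\<close>,
  and \<open>exp (- (1 / t))\<close> increases with \<open>t\<close>.\<close>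

lemma bump_ge:
  assumes "0 < r" "x \<in> ball z (r / 2)"
  shows "exp (- 2) \<le> bump z r x"
proof -
  have "(norm (x - z))\<^sup>2 \<le> (r / 2)\<^sup>2"
    using assms by (intro power_mono) (auto simp: dist_norm norm_minus_commute)
  then have "(x - z) \<bullet> (x - z) \<le> r\<^sup>2 / 4"
    unfolding power2_norm_eq_inner power_divide by simp
  then have "(x - z) \<bullet> (x - z) \<le> r\<^sup>2 / 2"
    using zero_le_power2[of r] by linarith
  then have t: "1 / 2 \<le> 1 - ((x - z) \<bullet> (x - z)) / r\<^sup>2"
    using assms(1) by (simp add: divide_le_eq)
  have "1 / (1 - ((x - z) \<bullet> (x - z)) / r\<^sup>2) \<le> 2"
    using t by (subst divide_le_eq) (simp add: field_simps)
  moreover have "\<not> 1 - ((x - z) \<bullet> (x - z)) / r\<^sup>2 \<le> 0" using t by linarith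
  ultimately show ?thesis unfolding bump_def flat_def by simp
qed

lemma Ck_bump: "Ck k (bump z r)"
  using Ck_flat_ball[of k 1 0 z r] by (simp add: bump_def[abs_def])

lemma test_function_bump_mult:
  assumes "0 < r" "cball z r \<subseteq> \<Omega>" "\<And>k. Ck k f"
  shows "test_function \<Omega> (\<lambda>x. bump z r x * f x)"
proof -
  have "closure {x. bump z r x * f x \<noteq> 0} \<subseteq> cball z r"
  proof (rule closure_minimal)
    show "{x. bump z r x * f x \<noteq> 0} \<subseteq> cball z r"
      using bump_eq_0[OF assms(1), of _ z] by (force simp: not_less)
  qed auto
  then show ?thesis unfolding test_function_def
    using assms by (auto intro!: Ck_mult Ck_bump simp: compact_eq_bounded_closed intro: bounded_subset[OF bounded_cball])
qed

section \<open>Weak gradients of continuously differentiable functions\<close>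

lemma nn_integral_lebesgue_on:
  fixes f :: "'a::euclidean_space \<Rightarrow> ennreal"
  assumes "S \<in> sets borel"
  shows "(\<integral>\<^sup>+x. f x \<partial>lebesgue_on S) = (\<integral>\<^sup>+x. f x * indicator S x \<partial>lborel)"
  using assms by (simp add: nn_integral_restrict_space nn_integral_completion)

lemma integral_lebesgue_on:
  fixes f :: "'a::euclidean_space \<Rightarrow> real"
  assumes "S \<in> sets borel" "f \<in> borel_measurable borel"
  shows "integral\<^sup>L (lebesgue_on S) f = (\<integral>x. indicator S x * f x \<partial>lborel)"
  using assms by (simp add: integral_restrict_space integral_completion)

lemma integrable_compact_support:
  fixes f :: "'a::euclidean_space \<Rightarrow> real"
  assumes "continuous_on UNIV f" "\<And>x. norm x > R \<Longrightarrow> f x = 0"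
  shows "integrable lborel f"
proof -
  have "integrable lborel (\<lambda>x. indicator (cball 0 R) x *\<^sub>R f x)"
    using assms(1) by (intro borel_integrable_compact continuous_on_subset[OF assms(1)]) auto
  moreover have "(\<lambda>x. indicator (cball 0 R) x *\<^sub>R f x) = f"
    using assms(2) by (auto split: split_indicator)
  ultimately show ?thesis by simp
qed

text \<open>Difference quotients have integral 0 by translation invariance. They converge pointwise
  to the derivative, and the mean value theorem dominates them by a constant on a fixed
  ball.\<close>

lemma integral_directional_derivative_eq_0:
  fixes f :: "'a::euclidean_space \<Rightarrow> real"
  assumes der: "\<And>x. (f has_derivative f' x) (at x)"
    and cont: "continuous_on UNIV (\<lambda>x. f' x i)"
    and R: "\<And>x. norm x > R \<Longrightarrow> f x = 0" and i: "norm i = 1"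
  shows "(\<integral>x. f' x i \<partial>lborel) = 0"
proof -
  define h where "h n = 1 / real (Suc n)" for n
  have h: "0 < h n" "h n \<le> 1" for n by (auto simp: h_def)
  define q where "q n x = (f (h n *\<^sub>R i + x) - f x) / h n" for n x
  have contf: "continuous_on UNIV f"
    using der by (meson continuous_at_imp_continuous_on has_derivative_continuous)
  then have int_f: "integrable lborel f" by (rule integrable_compact_support) (rule R)
  have D: "((\<lambda>t. f (x + t *\<^sub>R i)) has_real_derivative f' (x + t *\<^sub>R i) i) (at t)" for x t
  proof -
    have "((\<lambda>t. x + t *\<^sub>R i) has_derivative (\<lambda>t. t *\<^sub>R i)) (at t)"
      by (auto intro!: derivative_eq_intros)
    from has_derivative_compose[OF this der]
    show ?thesis
      by (rule has_derivative_imp_has_field_derivative)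
        (simp add: linear_scale[OF has_derivative_linear[OF der]] mult.commute)
  qed
  have q_int: "(\<integral>x. q n x \<partial>lborel) = 0" for n
  proof -
    have "integrable lborel (\<lambda>x. f (h n *\<^sub>R i + x))"
      using integrable_distr_eq[of "(+) (h n *\<^sub>R i)" lborel borel f] lborel_distr_plus[of "h n *\<^sub>R i"] int_f
      by simp
    moreover have "(\<integral>x. f (h n *\<^sub>R i + x) \<partial>lborel) = (\<integral>x. f x \<partial>lborel)"
      using integral_distr[of "(+) (h n *\<^sub>R i)" lborel borel f] lborel_distr_plus[of "h n *\<^sub>R i"] int_f by simp
    ultimately show ?thesis using int_f unfolding q_def by simp
  qed
  obtain M where M: "\<And>x. norm x \<le> R + 2 \<Longrightarrow> \<bar>f' x i\<bar> \<le> M"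
  proof -
    have "compact ((\<lambda>x. f' x i) ` cball 0 (R + 2))"
      by (intro compact_continuous_image continuous_on_subset[OF cont]) auto
    then obtain M where "\<forall>x \<in> (\<lambda>x. f' x i) ` cball 0 (R + 2). norm x \<le> M"
      using compact_imp_bounded bounded_iff by blast
    then show ?thesis by (intro that[of M]) auto
  qed
  have q_bound: "norm (q n x) \<le> M * indicator (cball 0 (R + 1)) x" for n x
  proof (cases "norm x \<le> R + 1")
    case True
    obtain t where t: "0 < t" "t < h n" "f (x + h n *\<^sub>R i) - f (x + 0 *\<^sub>R i) = (h n - 0) * f' (x + t *\<^sub>R i) i"
      using MVT2[of 0 "h n" "\<lambda>t. f (x + t *\<^sub>R i)" "\<lambda>t. f' (x + t *\<^sub>R i) i"] h D by blast
    \<comment> \<open>The step length is at most 1, so from \<open>norm x \<le> R + 1\<close> the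
      intermediate point stays in the ball where \<open>M\<close> bounds the derivative.\<close>
    have "norm (x + t *\<^sub>R i) \<le> R + 2"
      using norm_triangle_ineq[of x "t *\<^sub>R i"] True t h[of n] i by simp
    then show ?thesis using True M t h[of n] by (simp add: q_def add.commute)
  next
    case False
    have "norm x \<le> norm (h n *\<^sub>R i + x) + h n"
      using norm_triangle_ineq4[of "h n *\<^sub>R i + x" "h n *\<^sub>R i"] i h[of n] by simp
    then have "f (h n *\<^sub>R i + x) = 0" "f x = 0" using False h[of n] by (auto intro!: R)
    then show ?thesis using False by (simp add: q_def)
  qed
  have lim: "(\<lambda>n. q n x) \<longlonglongrightarrow> f' x i" for x
  proof -
    have "((\<lambda>t. (f (x + t *\<^sub>R i) - f x) / t) \<longlongrightarrow> f' x i) (at 0)"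
      using D[of x 0] by (simp add: DERIV_def)
    moreover have "filterlim h (at 0) sequentially"
      unfolding filterlim_at h_def using LIMSEQ_inverse_real_of_nat by (auto simp: inverse_eq_divide)
    ultimately show ?thesis
      unfolding q_def by (subst add.commute) (rule filterlim_compose)
  qed
  have "(\<lambda>n. \<integral>x. q n x \<partial>lborel) \<longlonglongrightarrow> (\<integral>x. f' x i \<partial>lborel)"
  proof (rule integral_dominated_convergence)
    show "(\<lambda>x. f' x i) \<in> borel_measurable lborel"
      using cont by (simp add: borel_measurable_continuous_onI)
    show "q n \<in> borel_measurable lborel" for n
    proof -
      have "continuous_on UNIV (q n)"
        unfolding q_def
        by (intro continuous_on_divide continuous_on_diff continuous_on_compose2[OF contf] contf
          continuous_on_add continuous_on_const continuous_on_id) (use h[of n] in auto)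
      then show ?thesis by (simp add: borel_measurable_continuous_onI)
    qed
    show "integrable lborel (\<lambda>x. M * indicator (cball (0::'a) (R + 1)) x)"
      by (intro integrable_mult_right integrable_real_indicator) (use emeasure_bounded_finite[OF bounded_cball[of "0::'a" "R + 1"]] in auto)
  qed (use lim q_bound in auto)
  then have "(\<lambda>n. 0) \<longlonglongrightarrow> (\<integral>x. f' x i \<partial>lborel)" by (simp only: q_int)
  then show ?thesis by (simp add: LIMSEQ_const_iff)
qed

lemma test_function_facts:
  assumes "test_function \<Omega> \<psi>"
  shows "(\<psi> has_derivative frechet_derivative \<psi> (at x)) (at x)"
    and "i \<in> Basis \<Longrightarrow> continuous_on UNIV (\<lambda>x. frechet_derivative \<psi> (at x) i)"
    and "continuous_on UNIV \<psi>"
    and "\<exists>R. \<forall>x. norm x > R \<longrightarrow> \<psi> x = 0"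
    and "x \<notin> \<Omega> \<Longrightarrow> \<psi> x = 0"
    and "x \<notin> \<Omega> \<Longrightarrow> frechet_derivative \<psi> (at x) i = 0"
proof -
  have Ck: "Ck k \<psi>" for k using assms by (simp add: test_function_def)
  let ?K = "closure {x. \<psi> x \<noteq> 0}"
  have K: "compact ?K" "?K \<subseteq> \<Omega>" using assms by (auto simp: test_function_def)
  have off: "\<psi> x = 0" if "x \<notin> ?K" for x
    using that closure_subset[of "{x. \<psi> x \<noteq> 0}"] by blast
  show d: "(\<psi> has_derivative frechet_derivative \<psi> (at x)) (at x)" for x
    using Ck_SucD(1)[OF Ck] .
  show "i \<in> Basis \<Longrightarrow> continuous_on UNIV (\<lambda>x. frechet_derivative \<psi> (at x) i)"
    using Ck_SucD(2)[OF Ck[of "Suc 0"]] by simp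
  show "continuous_on UNIV \<psi>" using Ck[of 0] by simp
  obtain R where "\<forall>x\<in>?K. norm x \<le> R" using compact_imp_bounded[OF K(1)] bounded_iff by blast
  then show "\<exists>R. \<forall>x. norm x > R \<longrightarrow> \<psi> x = 0" using off by (metis not_le)
  show "\<psi> x = 0" if "x \<notin> \<Omega>" using that K off by blast
  \<comment> \<open>The complement of the closed support is an open neighbourhood of
    \<open>x\<close> on which \<open>\<psi>\<close> is constantly 0.\<close>
  show "frechet_derivative \<psi> (at x) i = 0" if "x \<notin> \<Omega>"
  proof -
    have "x \<in> - ?K" using that K by blast
    have "(\<psi> has_derivative (\<lambda>_. 0)) (at x)"
    proof (rule has_derivative_transform_within_open[OF has_derivative_const[of 0] _ \<open>x \<in> - ?K\<close>])
      show "open (- ?K)" by (rule open_Compl[OF closed_closure])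
      show "0 = \<psi> y" if "y \<in> - ?K" for y using off[of y] that by (metis ComplD)
    qed
    then have "frechet_derivative \<psi> (at x) = (\<lambda>_. 0)" by (rule frechet_derivative_at[symmetric])
    then show ?thesis by simp
  qed
qed

text \<open>The directional derivative of \<open>u * \<psi>\<close> has integral 0 over the whole
  space. Both products vanish off \<open>\<Omega>\<close>, so the integrals over
  \<open>\<Omega>\<close> are integrals over the whole space and no boundary term appears.\<close>

lemma integration_by_parts:
  fixes u :: "'a::euclidean_space \<Rightarrow> real"
  assumes \<Omega>: "open \<Omega>" and der: "\<And>x. (u has_derivative (\<lambda>h. G x \<bullet> h)) (at x)"
    and G: "continuous_on UNIV G" and \<psi>: "test_function \<Omega> \<psi>" and i: "i \<in> Basis"
  shows "(LINT x|lebesgue_on \<Omega>. u x * frechet_derivative \<psi> (at x) i) =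
    - (LINT x|lebesgue_on \<Omega>. (G x \<bullet> i) * \<psi> x)"
proof -
  note T = test_function_facts[OF \<psi>]
  have u: "continuous_on UNIV u"
    using der by (meson continuous_at_imp_continuous_on has_derivative_continuous)
  obtain R where R: "\<And>x. norm x > R \<Longrightarrow> \<psi> x = 0" using T(4) by blast
  obtain D where D: "D = (\<lambda>x. frechet_derivative \<psi> (at x) i)" by blast
  have DR: "D x = 0" if "norm x > R" for x
  proof -
    have "x \<in> - cball 0 R" using that by simp
    have "(\<psi> has_derivative (\<lambda>_. 0)) (at x)"
      by (rule has_derivative_transform_within_open[OF has_derivative_const[of 0] _ \<open>x \<in> - cball 0 R\<close>])
        (use R in auto)
    then have "frechet_derivative \<psi> (at x) = (\<lambda>_. 0)" by (rule frechet_derivative_at[symmetric])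
    then show ?thesis by (simp add: D)
  qed
  have contD: "continuous_on UNIV D" using T(2)[OF i] by (simp add: D)
  have contGi: "continuous_on UNIV (\<lambda>x. G x \<bullet> i)" using G by (intro continuous_intros)
  have c1: "continuous_on UNIV (\<lambda>x. u x * D x)" by (intro continuous_on_mult u contD)
  have c2: "continuous_on UNIV (\<lambda>x. (G x \<bullet> i) * \<psi> x)" by (intro continuous_on_mult contGi T(3))
  have int: "integrable lborel (\<lambda>x. u x * D x)" "integrable lborel (\<lambda>x. (G x \<bullet> i) * \<psi> x)"
    using c1 c2 R DR by (auto intro: integrable_compact_support[where R=R])
  have "(\<integral>x. u x * D x + (G x \<bullet> i) * \<psi> x \<partial>lborel) = 0"
    unfolding D
  proof (rule integral_directional_derivative_eq_0[where f="\<lambda>x. u x * \<psi> x" and R=R and i=i])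
    show "((\<lambda>x. u x * \<psi> x) has_derivative (\<lambda>h. u x * frechet_derivative \<psi> (at x) h + (G x \<bullet> h) * \<psi> x)) (at x)" for x
      by (rule has_derivative_mult[OF der T(1)])
    show "continuous_on UNIV (\<lambda>x. u x * frechet_derivative \<psi> (at x) i + (G x \<bullet> i) * \<psi> x)"
      using c1 c2 unfolding D by (rule continuous_on_add)
  qed (use R i in auto)
  then have "(\<integral>x. u x * D x \<partial>lborel) = - (\<integral>x. (G x \<bullet> i) * \<psi> x \<partial>lborel)"
    using int by simp
  moreover have "(\<lambda>x. indicator \<Omega> x * (u x * D x)) = (\<lambda>x. u x * D x)"
    using T(6) by (intro ext) (auto simp: D indicator_def)
  moreover have "(\<lambda>x. indicator \<Omega> x * ((G x \<bullet> i) * \<psi> x)) = (\<lambda>x. (G x \<bullet> i) * \<psi> x)"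
    using T(5) by (intro ext) (auto simp: indicator_def)
  ultimately show ?thesis
    using c1 c2 \<Omega> unfolding D
    by (simp add: integral_lebesgue_on borel_measurable_continuous_onI)
qed

lemma locally_integrable_continuous:
  fixes f :: "'a::euclidean_space \<Rightarrow> 'b::euclidean_space"
  assumes "continuous_on UNIV f"
  shows "locally_integrable \<Omega> f"
  unfolding locally_integrable_def
proof (intro allI impI)
  fix K :: "'a set" assume K: "compact K \<and> K \<subseteq> \<Omega>"
  then have "integrable lborel (\<lambda>x. indicator K x *\<^sub>R f x)"
    by (intro borel_integrable_compact continuous_on_subset[OF assms]) auto
  moreover have "(\<lambda>x. indicator K x *\<^sub>R f x) \<in> borel_measurable borel"
    using calculation borel_measurable_integrable by fastforce
  ultimately show "integrable (lebesgue_on K) f"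
    using K by (subst integrable_restrict_space) (auto simp: integrable_completion borel_compact)
qed

lemma weak_gradient_C1:
  fixes u :: "'a::euclidean_space \<Rightarrow> real"
  assumes \<Omega>: "open \<Omega>" and der: "\<And>x. (u has_derivative (\<lambda>h. G x \<bullet> h)) (at x)"
    and G: "continuous_on UNIV G"
  shows "weak_gradient \<Omega> u G"
proof -
  have "continuous_on UNIV u"
    using der by (meson continuous_at_imp_continuous_on has_derivative_continuous)
  then show ?thesis unfolding weak_gradient_def
    using integration_by_parts[OF assms] G by (auto intro: locally_integrable_continuous)
qed

section \<open>Upper bounds for the norms\<close>

text \<open>The terms bound, up to a common factor, the integrals over the dyadic shells of outer
  radius \<open>D / 2 ^ m\<close>: the minimum with 1 is trivial for \<open>m < L\<close>, and for
  later shells \<open>(2 ^ L * D / 2 ^ m) powr a\<close> is geometric.\<close>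

lemma kernel_shell_sum:
  fixes a D :: real
  assumes "0 < a" "0 < D"
  shows "(\<lambda>m. if m < L then 1 else D powr a * (2 powr - a) ^ (m - L)) sums
    (real L + D powr a / (1 - 2 powr - a))"
proof -
  let ?t = "\<lambda>m. if m < L then 1 else D powr a * (2 powr - a) ^ (m - L)"
  have "2 powr - a < 2 powr 0" using assms by (intro powr_less_mono) auto
  then have "(\<lambda>m. D powr a * (2 powr - a) ^ m) sums (D powr a * (1 / (1 - 2 powr - a)))"
    by (intro sums_mult geometric_sums) auto
  then have "(\<lambda>m. ?t (m + L)) sums (D powr a / (1 - 2 powr - a))" by simp
  then have "?t sums (D powr a / (1 - 2 powr - a) + (\<Sum>m<L. ?t m))"
    by (subst (asm) sums_iff_shift)
  then show ?thesis by (simp add: add.commute)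
qed

text \<open>
  With \<open>a = (1 - s) p\<close> this is the inner integral of the Gagliardo seminorm of a function which is
  \<open>s\<close>-Hoelder at all scales and Lipschitz at scales below \<open>2 ^ - L\<close>. Each of the dyadic shells
  between \<open>2 ^ - L\<close> and the diameter contributes a bounded amount, the others form a
  convergent geometric series.
\<close>

lemma kernel_integral_le:
  fixes a D :: real
  assumes a: "0 < a" and D: "0 < D"
  shows "\<exists>K\<ge>0. \<forall>L. (\<integral>\<^sup>+h. ennreal (min 1 ((2 ^ L * norm h) powr a) * norm h powr - real DIM('a))
      * indicator (cball 0 D) (h::'a::euclidean_space) \<partial>lborel) \<le> ennreal (K * (1 + real L))"
proof -
  let ?N = "DIM('a)" and ?q = "2 powr - a :: real"
  let ?w = "unit_ball_vol (real ?N)"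
  let ?B = "D powr a / (1 - ?q)"
  have "?q < 2 powr 0" using a by (intro powr_less_mono) auto
  then have B: "0 \<le> ?B" by simp
  have w: "0 \<le> ?w" by simp
  define r where "r m = D / 2 ^ m" for m :: nat
  have r: "0 < r m" for m using D by (simp add: r_def)
  let ?t = "\<lambda>L m. if m < L then 1 else D powr a * ?q ^ (m - L)"
  let ?F = "\<lambda>L h. min 1 ((2 ^ L * norm h) powr a) * norm (h::'a) powr - real ?N"
  have "(\<integral>\<^sup>+h. ennreal (?F L h) * indicator (cball 0 D) h \<partial>lborel)
      \<le> ennreal ((?w * 2 ^ ?N * (1 + ?B)) * (1 + real L))" for L
  proof -
    \<comment> \<open>Bound on the shell between \<open>r (Suc m)\<close> and \<open>r m\<close>:
      the increasing factor is taken at the outer radius, the decreasing kernel at the inner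
      one.\<close>
    define c where "c m = min 1 ((2 ^ L * r m) powr a) * r (Suc m) powr - real ?N" for m
    have c: "0 \<le> c m" for m by (simp add: c_def)
    have pt: "ennreal (?F L h) * indicator (cball 0 D) h \<le> (\<Sum>m. ennreal (c m) * indicator (cball 0 (r m)) h)" for h
    \<comment> \<open>At \<open>h = 0\<close> the integrand is 0 because
      \<open>0 powr x = 0\<close>; every other point of the ball lies in some shell.\<close>
    proof (cases "h = 0 \<or> h \<notin> cball 0 D")
      case False
      then have h: "0 < norm h" "norm h \<le> D" by auto
      have "(\<lambda>m. D * (1 / 2) ^ m) \<longlonglongrightarrow> D * 0"
        by (intro tendsto_mult LIMSEQ_power_zero tendsto_const) auto
      then have "r \<longlonglongrightarrow> 0" by (simp add: r_def[abs_def] power_one_over field_simps)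
      then have "\<exists>n. r n < norm h"
        using h(1) by (metis (mono_tags, lifting) eventually_sequentially order_refl order_tendstoD(2))
      then obtain n where n: "r n < norm h" "\<And>m. m < n \<Longrightarrow> \<not> r m < norm h"
        using exists_least_iff[of "\<lambda>n. r n < norm h"] by blast
      have "n \<noteq> 0" using n(1) h(2) by (intro notI) (simp add: r_def)
      then obtain m where m: "n = Suc m" using not0_implies_Suc by blast
      have hm: "r (Suc m) < norm h" "norm h \<le> r m" using n m by (auto simp: not_less)
      have "?F L h \<le> c m"
        unfolding c_def
      proof (rule mult_mono)
        show "min 1 ((2 ^ L * norm h) powr a) \<le> min 1 ((2 ^ L * r m) powr a)"
          using hm(2) a by (intro min.mono powr_mono2 mult_left_mono) auto
        show "norm h powr - real ?N \<le> r (Suc m) powr - real ?N"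
          using hm(1) r[of "Suc m"] by (intro powr_mono2') auto
      qed auto
      then have "ennreal (?F L h) * indicator (cball 0 D) h \<le> ennreal (c m) * indicator (cball 0 (r m)) h"
        using h hm by (simp add: ennreal_leI)
      also have "\<dots> \<le> (\<Sum>m. ennreal (c m) * indicator (cball 0 (r m)) h)"
      proof -
        have "g m \<le> (\<Sum>k. g k)" for g :: "nat \<Rightarrow> ennreal"
          using sum_le_suminf[of g "{m}"] by simp
        then show ?thesis .
      qed
      finally show ?thesis .
    qed auto
    \<comment> \<open>Replacing a shell by its full ball costs only a constant: inner and outer
      radius differ by the factor 2, whence \<open>2 ^ DIM('a)\<close>.\<close>
    have cb: "c m * (?w * r m ^ ?N) \<le> ?w * 2 ^ ?N * ?t L m" for m
    proof -
      have "r (Suc m) powr - real ?N * r m ^ ?N = 2 ^ ?N"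
      proof -
        have "r m = 2 * r (Suc m)" by (simp add: r_def)
        then show ?thesis using r[of "Suc m"] by (simp add: powr_minus powr_realpow power_mult_distrib)
      qed
      moreover have "c m * (?w * r m ^ ?N)
          = ?w * (r (Suc m) powr - real ?N * r m ^ ?N) * min 1 ((2 ^ L * r m) powr a)"
        unfolding c_def by (simp only: mult_ac)
      moreover have "min 1 ((2 ^ L * r m) powr a) \<le> ?t L m"
      proof (cases "m < L")
        case False
        then have "(2::real) ^ L * r m = D * (1 / 2) ^ (m - L)"
          by (simp add: r_def power_diff power_one_over field_simps)
        then have "(2 ^ L * r m) powr a = D powr a * ((1 / 2) ^ (m - L)) powr a"
          using D by (simp add: powr_mult)
        also have "((1 / 2) ^ (m - L)) powr a = ?q ^ (m - L)"
          by (simp add: powr_realpow[symmetric] powr_powr powr_minus_divide powr_divide power_one_over mult.commute)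
        finally show ?thesis using False by simp
      qed auto
      ultimately show ?thesis using w by (simp only:) (intro mult_left_mono, auto)
    qed
    have "(\<integral>\<^sup>+h. ennreal (?F L h) * indicator (cball 0 D) h \<partial>lborel)
      \<le> (\<integral>\<^sup>+h. (\<Sum>m. ennreal (c m) * indicator (cball 0 (r m)) (h::'a)) \<partial>lborel)"
      by (rule nn_integral_mono) (rule pt)
    also have "\<dots> = (\<Sum>m. \<integral>\<^sup>+h. ennreal (c m) * indicator (cball 0 (r m)) (h::'a) \<partial>lborel)"
      by (intro nn_integral_suminf borel_measurable_times_ennreal borel_measurable_indicator) auto
    also have "\<dots> = (\<Sum>m. ennreal (c m * (?w * r m ^ ?N)))"
    proof -
      have "(\<integral>\<^sup>+h. ennreal (c m) * indicator (cball 0 (r m)) (h::'a) \<partial>lborel) = ennreal (c m) * ennreal (?w * r m ^ ?N)" for m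
        using r[of m] by (subst nn_integral_cmult_indicator) (simp_all add: emeasure_cball)
      moreover have "ennreal (c m) * ennreal (?w * r m ^ ?N) = ennreal (c m * (?w * r m ^ ?N))" for m
        using c[of m] r[of m] w by (intro ennreal_mult[symmetric]) auto
      ultimately show ?thesis by simp
    qed
    also have "\<dots> \<le> (\<Sum>m. ennreal (?w * 2 ^ ?N * ?t L m))"
      by (intro suminf_le ennreal_leI cb) auto
    also have "\<dots> = ennreal (?w * 2 ^ ?N * (real L + ?B))"
      by (intro suminf_ennreal_eq sums_mult kernel_shell_sum a D) auto
    also have "\<dots> \<le> ennreal ((?w * 2 ^ ?N * (1 + ?B)) * (1 + real L))"
    proof -
      have "real L + b \<le> (1 + b) * (1 + real L)" if "0 \<le> b" for b
        using that by (simp add: algebra_simps)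
      from this[OF B] have "?w * 2 ^ ?N * (real L + ?B) \<le> ?w * 2 ^ ?N * ((1 + ?B) * (1 + real L))"
        by (rule mult_left_mono) (use w in auto)
      then show ?thesis by (intro ennreal_leI) (simp only: mult.assoc)
    qed
    finally show ?thesis .
  qed
  then show ?thesis using B w by (intro exI[of _ "?w * 2 ^ ?N * (1 + ?B)"]) auto
qed

section \<open>The Gagliardo integral bounded by the kernel and the measure of the support\<close>

lemma nn_integral_lborel_translate:
  fixes f :: "'a::euclidean_space \<Rightarrow> ennreal"
  assumes "f \<in> borel_measurable borel"
  shows "(\<integral>\<^sup>+x. f (x - c) \<partial>lborel) = (\<integral>\<^sup>+x. f x \<partial>lborel)"
  using nn_integral_distr[of "(+) (- c)" lborel borel f] lborel_distr_plus[of "- c"] assms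
  by (simp add: add.commute)

lemma nn_integral_lborel_pair:
  fixes f :: "'a::euclidean_space \<times> 'a \<Rightarrow> ennreal"
  assumes "f \<in> borel_measurable borel"
  shows "(\<integral>\<^sup>+z. f z \<partial>lborel) = (\<integral>\<^sup>+x. \<integral>\<^sup>+y. f (x, y) \<partial>lborel \<partial>lborel)"
proof -
  have "f \<in> borel_measurable (lborel \<Otimes>\<^sub>M lborel)" using assms by (simp add: lborel_prod)
  from lborel.nn_integral_fst[OF this] show ?thesis by (simp add: lborel_prod)
qed

text \<open>Tonelli and translation invariance; evenness of \<open>\<Phi>\<close> handles
  integration in the second variable. The sum of indicators covers all pairs with at least one point
  in \<open>S\<close>, the only ones seen by a function vanishing off \<open>S\<close>.\<close>

lemma nn_integral_convolution_indicator:
  fixes \<Phi> :: "'a::euclidean_space \<Rightarrow> ennreal"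
  assumes \<Phi> [measurable]: "\<Phi> \<in> borel_measurable borel" and even: "\<And>h. \<Phi> (- h) = \<Phi> h"
    and S [measurable]: "S \<in> sets borel"
  shows "(\<integral>\<^sup>+z. \<Phi> (fst z - snd z) * (indicator S (fst z) + indicator S (snd z)) \<partial>lborel)
    = 2 * (\<integral>\<^sup>+h. \<Phi> h \<partial>lborel) * emeasure lborel S"
proof -
  have [measurable]: "(\<lambda>z. \<Phi> (fst z - snd z)) \<in> borel_measurable (borel :: ('a \<times> 'a) measure)"
    by (intro measurable_compose[OF _ \<Phi>] borel_measurable_continuous_onI continuous_intros)
  have [measurable]: "(\<lambda>z. indicator S (fst z) :: ennreal) \<in> borel_measurable (borel :: ('a \<times> 'a) measure)"
    "(\<lambda>z. indicator S (snd z) :: ennreal) \<in> borel_measurable (borel :: ('a \<times> 'a) measure)"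
    by (intro measurable_compose[OF _ borel_measurable_indicator[OF S]] borel_measurable_continuous_onI continuous_intros)+
  have c: "(\<integral>\<^sup>+x. \<Phi> (x - y) \<partial>lborel) = (\<integral>\<^sup>+h. \<Phi> h \<partial>lborel)" for y
    by (rule nn_integral_lborel_translate) (rule \<Phi>)
  have c': "(\<integral>\<^sup>+y. \<Phi> (x - y) \<partial>lborel) = (\<integral>\<^sup>+h. \<Phi> h \<partial>lborel)" for x
    using c[of x] even by (metis (no_types, lifting) minus_diff_eq nn_integral_cong)
  have m1: "(\<lambda>y. \<Phi> (x - y)) \<in> borel_measurable borel" for x
    by (intro measurable_compose[OF _ \<Phi>] borel_measurable_continuous_onI continuous_intros)
  have m2: "(\<lambda>x. \<Phi> (x - y)) \<in> borel_measurable borel" for y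
    by (intro measurable_compose[OF _ \<Phi>] borel_measurable_continuous_onI continuous_intros)
  have 1: "(\<integral>\<^sup>+z. \<Phi> (fst z - snd z) * indicator S (fst z) \<partial>lborel) = (\<integral>\<^sup>+h. \<Phi> h \<partial>lborel) * emeasure lborel S"
    using m1 by (subst nn_integral_lborel_pair) (simp_all add: nn_integral_multc c' nn_integral_cmult)
  have "(\<integral>\<^sup>+z. \<Phi> (fst z - snd z) * indicator S (snd z) \<partial>lborel)
      = (\<integral>\<^sup>+x. \<integral>\<^sup>+y. \<Phi> (x - y) * indicator S y \<partial>lborel \<partial>lborel)"
    by (subst nn_integral_lborel_pair) simp_all
  also have "\<dots> = (\<integral>\<^sup>+y. \<integral>\<^sup>+x. \<Phi> (x - y) * indicator S y \<partial>lborel \<partial>lborel)"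
  proof (rule lborel_pair.Fubini'[symmetric])
    have "(\<lambda>z. \<Phi> (fst z - snd z) * indicator S (snd z)) \<in> borel_measurable (lborel \<Otimes>\<^sub>M lborel)"
      unfolding lborel_prod by simp
    then show "(\<lambda>(x, y). \<Phi> (x - y) * indicator S y) \<in> borel_measurable (lborel \<Otimes>\<^sub>M lborel)"
      by (simp add: case_prod_beta)
  qed
  also have "\<dots> = (\<integral>\<^sup>+h. \<Phi> h \<partial>lborel) * emeasure lborel S"
    using m2 by (simp add: nn_integral_multc c nn_integral_cmult)
  finally have 2: "(\<integral>\<^sup>+z. \<Phi> (fst z - snd z) * indicator S (snd z) \<partial>lborel) = (\<integral>\<^sup>+h. \<Phi> h \<partial>lborel) * emeasure lborel S" .
  have "(\<integral>\<^sup>+z. \<Phi> (fst z - snd z) * (indicator S (fst z) + indicator S (snd z)) \<partial>lborel)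
    = (\<integral>\<^sup>+z. \<Phi> (fst z - snd z) * indicator S (fst z) \<partial>lborel)
    + (\<integral>\<^sup>+z. \<Phi> (fst z - snd z) * indicator S (snd z) \<partial>lborel)"
    by (simp add: distrib_left nn_integral_add)
  then show ?thesis unfolding 1 2 by (simp add: mult_2 distrib_right)
qed

text \<open>The Hoelder bound on \<open>d\<close> gives the entry 1 of the minimum, the Lipschitz
  bound gives the power of \<open>l * h\<close>.\<close>

lemma gagliardo_quotient_le:
  fixes d h A l s p N :: real
  assumes "0 < s" "s < 1" "1 \<le> p" "0 \<le> A" "0 < l" "0 \<le> d" "0 < h"
    and d: "d \<le> A * h powr s" "d \<le> A * l powr (1 - s) * h"
  shows "d powr p / h powr (N + s * p) \<le> A powr p * (min 1 ((l * h) powr ((1 - s) * p)) * h powr - N)"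
proof -
  have "d powr p \<le> (A * h powr s) powr p" using assms by (intro powr_mono2) auto
  also have "\<dots> = A powr p * h powr (s * p)" using assms by (simp add: powr_mult powr_powr)
  finally have 1: "d powr p / h powr (N + s * p) \<le> A powr p * h powr (s * p) / h powr (N + s * p)"
    by (intro divide_right_mono) auto
  have "h powr (s * p) / h powr (N + s * p) = h powr - N"
    using assms by (simp add: powr_diff[symmetric])
  then have 1: "d powr p / h powr (N + s * p) \<le> A powr p * h powr - N"
    using 1 by (simp only: times_divide_eq_right[symmetric])
  have "d powr p \<le> (A * l powr (1 - s) * h) powr p" using assms by (intro powr_mono2) auto
  also have "\<dots> = A powr p * (l powr ((1 - s) * p) * h powr p)"
    using assms by (simp add: powr_mult powr_powr)
  finally have 2: "d powr p / h powr (N + s * p) \<le> A powr p * (l powr ((1 - s) * p) * h powr p) / h powr (N + s * p)"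
    by (intro divide_right_mono) auto
  have "h powr p / h powr (N + s * p) = h powr ((1 - s) * p) * h powr - N"
    using assms by (simp add: powr_diff[symmetric] powr_add[symmetric] algebra_simps)
  then have 2: "d powr p / h powr (N + s * p) \<le> A powr p * ((l * h) powr ((1 - s) * p) * h powr - N)"
    using 2 assms by (simp only: times_divide_eq_right[symmetric] mult.assoc powr_mult less_imp_le)
  show ?thesis using 1 2 by (simp add: min_def)
qed

text \<open>\<open>K\<close> is chosen before \<open>u\<close>, \<open>A\<close>, \<open>L\<close>
  and \<open>S\<close>, so it is uniform along a family. The measure of \<open>S\<close> carries the
  concentration of the peaks; for the lacunary sums \<open>S\<close> is all of
  \<open>\<Omega>\<close>.\<close>

lemma gagliardo_integral_le:
  fixes \<Omega> :: "'a::euclidean_space set"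
  assumes s: "0 < s" "s < 1" and p: "1 \<le> p" and \<Omega>: "open \<Omega>" "bounded \<Omega>"
  shows "\<exists>K\<ge>0. \<forall>u A L S. continuous_on UNIV u \<longrightarrow> 0 \<le> A \<longrightarrow>
     (\<forall>x y. \<bar>u x - u y\<bar> \<le> A * norm (x - y) powr s) \<longrightarrow>
     (\<forall>x y. \<bar>u x - u y\<bar> \<le> A * (2 ^ L) powr (1 - s) * norm (x - y)) \<longrightarrow>
     S \<in> sets borel \<longrightarrow> (\<forall>x\<in>\<Omega> - S. u x = 0) \<longrightarrow>
     (\<integral>\<^sup>+z. ennreal (\<bar>u (fst z) - u (snd z)\<bar> powr p /
                  norm (fst z - snd z) powr (real DIM('a) + s * p)) \<partial>lebesgue_on (\<Omega> \<times> \<Omega>))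
     \<le> ennreal (K * A powr p * (1 + real L)) * emeasure lborel S"
proof -
  obtain D where D: "0 < D" "\<And>x y. x \<in> \<Omega> \<Longrightarrow> y \<in> \<Omega> \<Longrightarrow> norm (x - y) \<le> D"
  proof -
    obtain B where B: "0 < B" "\<And>x. x \<in> \<Omega> \<Longrightarrow> norm x \<le> B" using \<Omega>(2) bounded_pos by metis
    have "norm (x - y) \<le> 2 * B" if "x \<in> \<Omega>" "y \<in> \<Omega>" for x y
      using norm_triangle_ineq4[of x y] B(2)[OF that(1)] B(2)[OF that(2)] by linarith
    then show ?thesis using B by (intro that[of "2 * B"]) auto
  qed
  let ?F = "\<lambda>L h. min 1 ((2 ^ L * norm h) powr ((1 - s) * p)) * norm (h::'a) powr - real DIM('a)"
  obtain K where K: "0 \<le> K" "\<And>L. (\<integral>\<^sup>+h. ennreal (?F L h) * indicator (cball 0 D) h \<partial>lborel) \<le> ennreal (K * (1 + real L))"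
    using kernel_integral_le[of "(1 - s) * p" D] s p D(1) by auto
  show ?thesis
  proof (intro exI[of _ "2 * K"] conjI allI impI)
    fix u :: "'a \<Rightarrow> real" and A :: real and L :: nat and S
    assume u: "continuous_on UNIV u" and A: "0 \<le> A"
      and H: "\<forall>x y. \<bar>u x - u y\<bar> \<le> A * norm (x - y) powr s"
      and Lip: "\<forall>x y. \<bar>u x - u y\<bar> \<le> A * (2 ^ L) powr (1 - s) * norm (x - y)"
      and S: "S \<in> sets borel" and off: "\<forall>x\<in>\<Omega> - S. u x = 0"
    let ?Q = "\<lambda>z. \<bar>u (fst z) - u (snd z)\<bar> powr p / norm (fst z - snd z) powr (real DIM('a) + s * p)"
    let ?\<Phi> = "\<lambda>h. ennreal (A powr p) * (ennreal (?F L h) * indicator (cball 0 D) h)"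
    have F [measurable]: "(\<lambda>h. ennreal (?F L h)) \<in> borel_measurable borel" by measurable
    have i [measurable]: "(\<lambda>h. indicator (cball 0 D) h :: ennreal) \<in> borel_measurable (borel :: 'a measure)"
      by (rule borel_measurable_indicator) auto
    have "(\<integral>\<^sup>+z. ennreal (?Q z) \<partial>lebesgue_on (\<Omega> \<times> \<Omega>)) = (\<integral>\<^sup>+z. ennreal (?Q z) * indicator (\<Omega> \<times> \<Omega>) z \<partial>lborel)"
      using \<Omega> by (intro nn_integral_lebesgue_on) (simp add: open_Times)
    also have "\<dots> \<le> (\<integral>\<^sup>+z. ?\<Phi> (fst z - snd z) * (indicator S (fst z) + indicator S (snd z)) \<partial>lborel)"
    proof (rule nn_integral_mono)
      fix z :: "'a \<times> 'a"
      obtain x y where z: "z = (x, y)" by fastforce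
      show "ennreal (?Q z) * indicator (\<Omega> \<times> \<Omega>) z \<le> ?\<Phi> (fst z - snd z) * (indicator S (fst z) + indicator S (snd z))"
      proof (cases "x \<in> \<Omega> \<and> y \<in> \<Omega> \<and> x \<noteq> y \<and> (x \<in> S \<or> y \<in> S)")
        case True
        have "?Q (x, y) \<le> A powr p * ?F L (x - y)"
          using gagliardo_quotient_le[of s p A "2 ^ L" "\<bar>u x - u y\<bar>" "norm (x - y)" "real DIM('a)"]
            s p A H Lip True by auto
        then have "ennreal (?Q (x, y)) \<le> ?\<Phi> (x - y) * 1"
          using D(2)[of x y] True by (simp add: ennreal_mult'[symmetric] ennreal_leI)
        \<comment> \<open>One of the points lies in \<open>S\<close> here; pairs with both points
          off \<open>S\<close> have quotient 0.\<close>
        also have "\<dots> \<le> ?\<Phi> (x - y) * (indicator S x + indicator S y)"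
          using True by (intro mult_left_mono) (auto simp: indicator_def)
        finally show ?thesis using True by (simp add: z)
      next
        case False
        then consider "x \<notin> \<Omega> \<or> y \<notin> \<Omega>" | "x = y" | "x \<in> \<Omega> - S" "y \<in> \<Omega> - S" by blast
        then have "?Q z = 0 \<or> z \<notin> \<Omega> \<times> \<Omega>"
          by cases (use off p in \<open>auto simp: z\<close>)
        then show ?thesis by auto
      qed
    qed
    also have "\<dots> = 2 * (\<integral>\<^sup>+h. ?\<Phi> h \<partial>lborel) * emeasure lborel S"
    proof (rule nn_integral_convolution_indicator)
      show "?\<Phi> (- h) = ?\<Phi> h" for h by (simp add: indicator_def)
    qed (use S in simp_all)
    also have "(\<integral>\<^sup>+h. ?\<Phi> h \<partial>lborel) = ennreal (A powr p) * (\<integral>\<^sup>+h. ennreal (?F L h) * indicator (cball 0 D) h \<partial>lborel)"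
      by (rule nn_integral_cmult) simp
    also have "2 * (ennreal (A powr p) * (\<integral>\<^sup>+h. ennreal (?F L h) * indicator (cball 0 D) h \<partial>lborel)) * emeasure lborel S
       \<le> 2 * (ennreal (A powr p) * ennreal (K * (1 + real L))) * emeasure lborel S"
      by (intro mult_left_mono mult_right_mono K(2)) auto
    also have "2 * (ennreal (A powr p) * ennreal (K * (1 + real L))) = ennreal (2 * K * A powr p * (1 + real L))"
      using K(1) A by (simp add: ennreal_mult'[symmetric] ennreal_numeral[symmetric] mult_ac del: ennreal_numeral)
    finally show "(\<integral>\<^sup>+z. ennreal (?Q z) \<partial>lebesgue_on (\<Omega> \<times> \<Omega>)) \<le> ennreal (2 * K * A powr p * (1 + real L)) * emeasure lborel S" .
  qed (use K in auto)
qed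

lemma Lp_integral_le:
  fixes f :: "'a::euclidean_space \<Rightarrow> 'b::real_normed_vector"
  assumes "open \<Omega>" "S \<in> sets borel" "0 \<le> p" "\<And>x. norm (f x) \<le> A" "\<And>x. x \<in> \<Omega> - S \<Longrightarrow> f x = 0"
  shows "(\<integral>\<^sup>+x. ennreal (norm (f x) powr p) \<partial>lebesgue_on \<Omega>) \<le> ennreal (A powr p) * emeasure lborel S"
proof -
  have "(\<integral>\<^sup>+x. ennreal (norm (f x) powr p) \<partial>lebesgue_on \<Omega>) = (\<integral>\<^sup>+x. ennreal (norm (f x) powr p) * indicator \<Omega> x \<partial>lborel)"
    using assms by (intro nn_integral_lebesgue_on) auto
  also have "\<dots> \<le> (\<integral>\<^sup>+x. ennreal (A powr p) * indicator S x \<partial>lborel)"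
  proof (rule nn_integral_mono)
    fix x
    have "norm (f x) powr p \<le> A powr p" using assms by (intro powr_mono2) auto
    then show "ennreal (norm (f x) powr p) * indicator \<Omega> x \<le> ennreal (A powr p) * indicator S x"
      using assms(5)[of x] by (auto simp: indicator_def ennreal_leI)
  qed
  also have "\<dots> = ennreal (A powr p) * emeasure lborel S"
    using assms by (intro nn_integral_cmult_indicator) auto
  finally show ?thesis .
qed

lemma continuous_borel_measurable_lebesgue_on:
  fixes u :: "'a::euclidean_space \<Rightarrow> real"
  shows "continuous_on UNIV u \<Longrightarrow> u \<in> borel_measurable (lebesgue_on \<Omega>)"
  by (intro measurable_restrict_space1 measurable_completion) (simp add: borel_measurable_continuous_onI)

lemma lipschitz_if_gradient_bounded:
  fixes u :: "'a::euclidean_space \<Rightarrow> real"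
  assumes "\<And>x. (u has_derivative (\<lambda>h. G x \<bullet> h)) (at x)" "\<And>x. norm (G x) \<le> B"
  shows "\<bar>u x - u y\<bar> \<le> B * norm (x - y)"
proof -
  have "norm (u x - u y) \<le> B * norm (x - y)"
  proof (rule differentiable_bound[where S=UNIV and f'="\<lambda>x h. G x \<bullet> h"])
    fix x
    show "onorm (\<lambda>h. G x \<bullet> h) \<le> B"
    proof (rule onorm_le)
      fix h
      have "norm (G x \<bullet> h) \<le> norm (G x) * norm h" using Cauchy_Schwarz_ineq2[of "G x"] by simp
      also have "\<dots> \<le> B * norm h" using assms(2) by (intro mult_right_mono) auto
      finally show "norm (G x \<bullet> h) \<le> B * norm h" .
    qed
  qed (use assms(1) in auto)
  then show ?thesis by simp
qed

text \<open>One estimate for the fractional and the gradient case. At \<open>s = 1\<close> the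
  gradient condition reads \<open>norm (G x) \<le> A\<close> and the factor
  \<open>1 + real L\<close> is slack; for \<open>s < 1\<close> the gradient bound is the Lipschitz
  bound at scale \<open>2 ^ - L\<close>.\<close>

lemma sobolev_norm_upper:
  fixes \<Omega> :: "'a::euclidean_space set"
  assumes s: "0 < s" "s \<le> 1" and p: "1 \<le> p" and \<Omega>: "open \<Omega>" "bounded \<Omega>"
  shows "\<exists>K>0. \<forall>u G A L S v. (\<forall>x. (u has_derivative (\<lambda>h. G x \<bullet> h)) (at x)) \<longrightarrow>
     continuous_on UNIV G \<longrightarrow> 0 \<le> A \<longrightarrow> (\<forall>x. \<bar>u x\<bar> \<le> A) \<longrightarrow>
     (\<forall>x y. \<bar>u x - u y\<bar> \<le> A * norm (x - y) powr s) \<longrightarrow>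
     (\<forall>x. norm (G x) \<le> A * (2 ^ L) powr (1 - s)) \<longrightarrow>
     S \<in> sets borel \<longrightarrow> (\<forall>x\<in>\<Omega> - S. u x = 0 \<and> G x = 0) \<longrightarrow>
     0 \<le> v \<longrightarrow> emeasure lborel S = ennreal v \<longrightarrow>
     u \<in> sobolev_space s (ereal p) \<Omega> \<and>
     sobolev_norm s (ereal p) \<Omega> u \<le> ennreal ((K * A powr p * (1 + real L) * v) powr (1 / p))"
proof -
  have "\<exists>K\<ge>0. \<forall>u G A L S v. (\<forall>x. (u has_derivative (\<lambda>h. G x \<bullet> h)) (at x)) \<longrightarrow>
     continuous_on UNIV G \<longrightarrow> 0 \<le> A \<longrightarrow>
     (\<forall>x y. \<bar>u x - u y\<bar> \<le> A * norm (x - y) powr s) \<longrightarrow>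
     (\<forall>x. norm (G x) \<le> A * (2 ^ L) powr (1 - s)) \<longrightarrow>
     S \<in> sets borel \<longrightarrow> (\<forall>x\<in>\<Omega> - S. u x = 0 \<and> G x = 0) \<longrightarrow>
     0 \<le> v \<longrightarrow> emeasure lborel S = ennreal v \<longrightarrow>
     ennpowr (sobolev_seminorm s (ereal p) \<Omega> u) p \<le> ennreal (K * A powr p * (1 + real L) * v)"
  proof (cases "s = 1")
    case True
    show ?thesis
    proof (intro exI[of _ 1] conjI allI impI)
      fix u :: "'a \<Rightarrow> real" and G A L S v
      assume u: "\<forall>x. (u has_derivative (\<lambda>h. G x \<bullet> h)) (at x)" and G: "continuous_on UNIV G"
        and A: "0 \<le> A" and GA: "\<forall>x. norm (G x) \<le> A * (2 ^ L) powr (1 - s)"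
        and S: "S \<in> sets borel" and off: "\<forall>x\<in>\<Omega> - S. u x = 0 \<and> G x = 0"
        and v: "0 \<le> v" "emeasure lborel S = ennreal v"
      have "sobolev_seminorm s (ereal p) \<Omega> u \<le> Lp_norm (ereal p) \<Omega> G"
        using True weak_gradient_C1[OF \<Omega>(1), of u G] u G
        by (auto simp: sobolev_seminorm_def intro!: INF_lower)
      then have "ennpowr (sobolev_seminorm s (ereal p) \<Omega> u) p \<le> ennpowr (Lp_norm (ereal p) \<Omega> G) p"
        using p by (intro ennpowr_mono) auto
      also have "\<dots> \<le> ennreal (A powr p) * emeasure lborel S"
        unfolding ennpowr_Lp_norm[OF p] using GA True off p
        by (intro Lp_integral_le \<Omega> S) auto
      also have "\<dots> = ennreal (A powr p * v)" using v by (simp add: ennreal_mult)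
      also have "\<dots> \<le> ennreal (1 * A powr p * (1 + real L) * v)"
        using v by (intro ennreal_leI) (simp add: algebra_simps)
      finally show "ennpowr (sobolev_seminorm s (ereal p) \<Omega> u) p \<le> ennreal (1 * A powr p * (1 + real L) * v)" .
    qed auto
  next
    case False
    then have s1: "s < 1" using s by simp
    let ?c = "gagliardo_const DIM('a) s p"
    have c: "0 < ?c" using s s1 p by (intro gagliardo_const_pos) (auto simp: Suc_le_eq)
    obtain K where K: "0 \<le> K" "\<And>u A L S. continuous_on UNIV u \<Longrightarrow> 0 \<le> A \<Longrightarrow>
     (\<forall>x y. \<bar>u x - u y\<bar> \<le> A * norm (x - y) powr s) \<Longrightarrow>
     (\<forall>x y. \<bar>u x - u y\<bar> \<le> A * (2 ^ L) powr (1 - s) * norm (x - y)) \<Longrightarrow>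
     S \<in> sets borel \<Longrightarrow> (\<forall>x\<in>\<Omega> - S. u x = 0) \<Longrightarrow>
     (\<integral>\<^sup>+z. ennreal (\<bar>u (fst z) - u (snd z)\<bar> powr p /
                  norm (fst z - snd z) powr (real DIM('a) + s * p)) \<partial>lebesgue_on (\<Omega> \<times> \<Omega>))
     \<le> ennreal (K * A powr p * (1 + real L)) * emeasure lborel S"
      using gagliardo_integral_le[OF s(1) s1 p \<Omega>] by blast
    show ?thesis
    proof (intro exI[of _ "?c * K"] conjI allI impI)
      fix u :: "'a \<Rightarrow> real" and G A L S v
      assume u: "\<forall>x. (u has_derivative (\<lambda>h. G x \<bullet> h)) (at x)" and G: "continuous_on UNIV G"
        and A: "0 \<le> A" and H: "\<forall>x y. \<bar>u x - u y\<bar> \<le> A * norm (x - y) powr s"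
        and GA: "\<forall>x. norm (G x) \<le> A * (2 ^ L) powr (1 - s)"
        and S: "S \<in> sets borel" and off: "\<forall>x\<in>\<Omega> - S. u x = 0 \<and> G x = 0"
        and v: "0 \<le> v" "emeasure lborel S = ennreal v"
      have cont: "continuous_on UNIV u"
        using u by (meson continuous_at_imp_continuous_on has_derivative_continuous)
      have Lip: "\<forall>x y. \<bar>u x - u y\<bar> \<le> A * (2 ^ L) powr (1 - s) * norm (x - y)"
        using lipschitz_if_gradient_bounded[of u G] u GA by blast
      have off': "\<forall>x\<in>\<Omega> - S. u x = 0" using off by blast
      have "(\<integral>\<^sup>+z. ennreal (\<bar>u (fst z) - u (snd z)\<bar> powr p /
                  norm (fst z - snd z) powr (real DIM('a) + s * p)) \<partial>lebesgue_on (\<Omega> \<times> \<Omega>))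
        \<le> ennreal (K * A powr p * (1 + real L)) * emeasure lborel S"
        by (rule K(2)[OF cont A H Lip S off'])
      then have "ennpowr (sobolev_seminorm s (ereal p) \<Omega> u) p
        \<le> ennreal ?c * (ennreal (K * A powr p * (1 + real L)) * emeasure lborel S)"
        using s False ennpowr_gagliardo_seminorm[OF p, of s \<Omega> u]
        by (simp add: sobolev_seminorm_def mult_left_mono)
      also have "\<dots> = ennreal (?c * K * A powr p * (1 + real L) * v)"
        using v c K(1) by (simp add: ennreal_mult[symmetric] mult_ac)
      finally show "ennpowr (sobolev_seminorm s (ereal p) \<Omega> u) p \<le> ennreal (?c * K * A powr p * (1 + real L) * v)" .
    qed (use c K in auto)
  qed
  then obtain K where K: "0 \<le> K" "\<And>u G A L S v. (\<forall>x. (u has_derivative (\<lambda>h. G x \<bullet> h)) (at x)) \<Longrightarrow>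
     continuous_on UNIV G \<Longrightarrow> 0 \<le> A \<Longrightarrow>
     (\<forall>x y. \<bar>u x - u y\<bar> \<le> A * norm (x - y) powr s) \<Longrightarrow>
     (\<forall>x. norm (G x) \<le> A * (2 ^ L) powr (1 - s)) \<Longrightarrow>
     S \<in> sets borel \<Longrightarrow> (\<forall>x\<in>\<Omega> - S. u x = 0 \<and> G x = 0) \<Longrightarrow>
     0 \<le> v \<Longrightarrow> emeasure lborel S = ennreal v \<Longrightarrow>
     ennpowr (sobolev_seminorm s (ereal p) \<Omega> u) p \<le> ennreal (K * A powr p * (1 + real L) * v)"
    by blast
  show ?thesis
  \<comment> \<open>The additional 1 makes the constant positive and absorbs the p-th power of the
    \<open>L^p\<close> norm.\<close>
  proof (intro exI[of _ "K + 1"] conjI[of "0 < K + 1"] allI impI)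
    fix u :: "'a \<Rightarrow> real" and G A L S v
    assume u: "\<forall>x. (u has_derivative (\<lambda>h. G x \<bullet> h)) (at x)" and G: "continuous_on UNIV G"
      and A: "0 \<le> A" and uA: "\<forall>x. \<bar>u x\<bar> \<le> A" and H: "\<forall>x y. \<bar>u x - u y\<bar> \<le> A * norm (x - y) powr s"
      and GA: "\<forall>x. norm (G x) \<le> A * (2 ^ L) powr (1 - s)"
      and S: "S \<in> sets borel" and off: "\<forall>x\<in>\<Omega> - S. u x = 0 \<and> G x = 0"
      and v: "0 \<le> v" "emeasure lborel S = ennreal v"
    have cont: "continuous_on UNIV u"
      using u by (meson continuous_at_imp_continuous_on has_derivative_continuous)
    let ?a = "K * A powr p * (1 + real L) * v" and ?b = "A powr p * v"
    have b: "(\<integral>\<^sup>+x. ennreal (\<bar>u x\<bar> powr p) \<partial>lebesgue_on \<Omega>) \<le> ennreal ?b"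
      using Lp_integral_le[OF \<Omega>(1) S, of p u A] p uA off v by (simp add: ennreal_mult)
    have a: "ennpowr (sobolev_seminorm s (ereal p) \<Omega> u) p \<le> ennreal ?a"
      by (rule K(2)[OF u G A H GA S off v])
    have ab: "0 \<le> ?a" "0 \<le> ?b" using K v by auto
    note * = sobolev_norm_le[OF s(1) p ab continuous_borel_measurable_lebesgue_on[OF cont] a b]
    have "?a + ?b \<le> (K + 1) * A powr p * (1 + real L) * v"
      using v by (simp add: algebra_simps)
    then have "(?a + ?b) powr (1 / p) \<le> ((K + 1) * A powr p * (1 + real L) * v) powr (1 / p)"
      using ab p by (intro powr_mono2) auto
    then show "u \<in> sobolev_space s (ereal p) \<Omega> \<and>
     sobolev_norm s (ereal p) \<Omega> u \<le> ennreal (((K + 1) * A powr p * (1 + real L) * v) powr (1 / p))"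
      using * by (meson ennreal_leI order_trans)
  qed (use K in auto)
qed

lemma sobolev_norm_infinity_upper:
  fixes u :: "'a::euclidean_space \<Rightarrow> real"
  assumes s: "0 < s" and u: "continuous_on UNIV u" "\<And>x. \<bar>u x\<bar> \<le> A"
    "\<And>x y. \<bar>u x - u y\<bar> \<le> A * norm (x - y) powr s" and A: "0 \<le> A"
  shows "u \<in> sobolev_space s \<infinity> \<Omega>" "sobolev_norm s \<infinity> \<Omega> u \<le> ennreal (2 * A)"
proof -
  have 1: "Lp_norm \<infinity> \<Omega> u \<le> ennreal A"
    unfolding Lp_norm_def using u(2) by (auto intro!: esssup_I simp: ennreal_leI
      intro: measurable_compose[OF continuous_borel_measurable_lebesgue_on[OF u(1)]])
  have "hoelder_seminorm s \<Omega> u \<le> ennreal A"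
    unfolding hoelder_seminorm_def using u(3) A
    by (intro SUP_least) (auto intro!: ennreal_leI simp: divide_le_eq)
  then have 2: "sobolev_seminorm s \<infinity> \<Omega> u \<le> ennreal A"
    using s by (auto simp: sobolev_seminorm_def intro: INF_lower2)
  show "u \<in> sobolev_space s \<infinity> \<Omega>"
    using 1 2 continuous_borel_measurable_lebesgue_on[OF u(1)]
    by (auto simp: sobolev_space_def intro: le_less_trans)
  have "sobolev_norm s \<infinity> \<Omega> u \<le> ennreal A + ennreal A"
    using 1 2 s by (simp add: sobolev_norm_def add_mono)
  then show "sobolev_norm s \<infinity> \<Omega> u \<le> ennreal (2 * A)"
    using A by (simp add: ennreal_plus[symmetric] del: ennreal_plus)
qed

section \<open>Lower bounds for the norms\<close>

text \<open>The regions \<open>x \<in> ball z R\<close>,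
  \<open>y - x \<in> ball (c k) (\<rho> k)\<close> are disjoint for different \<open>k\<close>, and
  each has measure the product of two ball volumes. Peaks use one region, lacunary sums one region
  per scale.\<close>

lemma double_integral_ge:
  fixes Q :: "'a::euclidean_space \<times> 'a \<Rightarrow> ennreal"
  assumes \<Omega>: "open \<Omega>" and J: "finite J" and R: "0 \<le> R" and \<rho>: "\<And>k. k \<in> J \<Longrightarrow> 0 \<le> \<rho> k"
    and m: "\<And>k. k \<in> J \<Longrightarrow> 0 \<le> m k"
    and disj: "\<And>k l. k \<in> J \<Longrightarrow> l \<in> J \<Longrightarrow> k \<noteq> l \<Longrightarrow> ball (c k) (\<rho> k) \<inter> ball (c l) (\<rho> l) = {}"
    and sub: "\<And>k x y. k \<in> J \<Longrightarrow> x \<in> ball z R \<Longrightarrow> y - x \<in> ball (c k) (\<rho> k) \<Longrightarrow> x \<in> \<Omega> \<and> y \<in> \<Omega>"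
    and Q: "\<And>k x y. k \<in> J \<Longrightarrow> x \<in> ball z R \<Longrightarrow> y - x \<in> ball (c k) (\<rho> k) \<Longrightarrow> ennreal (m k) \<le> Q (x, y)"
  shows "ennreal ((unit_ball_vol (real DIM('a)))\<^sup>2 * R ^ DIM('a) * (\<Sum>k\<in>J. m k * \<rho> k ^ DIM('a)))
     \<le> (\<integral>\<^sup>+w. Q w \<partial>lebesgue_on (\<Omega> \<times> \<Omega>))"
proof -
  let ?w = "unit_ball_vol (real DIM('a))" and ?N = "DIM('a)"
  have w: "0 \<le> ?w" by simp
  let ?f = "\<lambda>k (w::'a \<times> 'a). ennreal (m k) * (indicator (ball (c k) (\<rho> k)) (snd w - fst w) * indicator (ball z R) (fst w))"
  have meas1: "(\<lambda>w. indicator (ball (c k) (\<rho> k)) (snd w - fst w) :: ennreal) \<in> borel_measurable (borel :: ('a \<times> 'a) measure)" for k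
    by (intro measurable_compose[OF _ borel_measurable_indicator[of _ borel]] borel_measurable_continuous_onI continuous_intros) auto
  have meas2: "(\<lambda>w. indicator (ball z R) (fst w) :: ennreal) \<in> borel_measurable (borel :: ('a \<times> 'a) measure)"
    by (intro measurable_compose[OF _ borel_measurable_indicator[of _ borel]] borel_measurable_continuous_onI continuous_intros) auto
  have int: "(\<integral>\<^sup>+w. ?f k w \<partial>lborel) = ennreal (?w\<^sup>2 * R ^ ?N * (m k * \<rho> k ^ ?N))" if k: "k \<in> J" for k
  proof -
    have e: "(\<integral>\<^sup>+y. indicator (ball (c k) (\<rho> k)) (y - x) \<partial>lborel) = ennreal (?w * \<rho> k ^ ?N)" for x :: 'a
      using borel_measurable_indicator[of "ball (c k) (\<rho> k)" borel] nn_integral_lborel_translate[of "indicator (ball (c k) (\<rho> k))" x] \<rho>[OF k]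
      by (simp add: emeasure_ball)
    have mm: "(\<lambda>y. indicator (ball (c k) (\<rho> k)) (y - x) :: ennreal) \<in> borel_measurable borel" for x :: 'a
      by (intro measurable_compose[OF _ borel_measurable_indicator[of _ borel]] borel_measurable_continuous_onI continuous_intros) auto
    have "(\<integral>\<^sup>+w. ?f k w \<partial>lborel)
        = (\<integral>\<^sup>+x. \<integral>\<^sup>+y. ennreal (m k) * (indicator (ball (c k) (\<rho> k)) (y - x) * indicator (ball z R) x) \<partial>lborel \<partial>lborel)"
      using meas1[of k] meas2 by (subst nn_integral_lborel_pair) simp_all
    also have "\<dots> = (\<integral>\<^sup>+x. ennreal (m k) * (ennreal (?w * \<rho> k ^ ?N) * indicator (ball z R) x) \<partial>lborel)"
      using mm by (simp add: nn_integral_cmult nn_integral_multc e)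
    also have "\<dots> = ennreal (m k) * (ennreal (?w * \<rho> k ^ ?N) * ennreal (?w * R ^ ?N))"
      unfolding mult.assoc[symmetric] using R
      by (subst nn_integral_cmult_indicator) (simp_all add: emeasure_ball)
    also have "\<dots> = ennreal (?w\<^sup>2 * R ^ ?N * (m k * \<rho> k ^ ?N))"
      using m[OF k] \<rho>[OF k] R w by (simp add: ennreal_mult[symmetric] power2_eq_square mult_ac)
    finally show ?thesis .
  qed
  have "ennreal (?w\<^sup>2 * R ^ ?N * (\<Sum>k\<in>J. m k * \<rho> k ^ ?N)) = (\<Sum>k\<in>J. ennreal (?w\<^sup>2 * R ^ ?N * (m k * \<rho> k ^ ?N)))"
    using m \<rho> R by (simp add: sum_distrib_left sum_ennreal)
  also have "\<dots> = (\<Sum>k\<in>J. \<integral>\<^sup>+w. ?f k w \<partial>lborel)"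
    using int by (intro sum.cong refl) simp
  also have "\<dots> = (\<integral>\<^sup>+w. (\<Sum>k\<in>J. ?f k w) \<partial>lborel)"
    using meas1 meas2 by (intro nn_integral_sum[symmetric]) simp
  also have "\<dots> \<le> (\<integral>\<^sup>+w. Q w * indicator (\<Omega> \<times> \<Omega>) w \<partial>lborel)"
  proof (rule nn_integral_mono)
    fix w :: "'a \<times> 'a"
    obtain x y where xy: "w = (x, y)" by fastforce
    show "(\<Sum>k\<in>J. ?f k w) \<le> Q w * indicator (\<Omega> \<times> \<Omega>) w"
    proof (cases "x \<in> ball z R \<and> (\<exists>k\<in>J. y - x \<in> ball (c k) (\<rho> k))")
      case True
      then obtain k where k: "k \<in> J" "y - x \<in> ball (c k) (\<rho> k)" and x: "x \<in> ball z R" by blast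
      have "y - x \<notin> ball (c l) (\<rho> l)" if "l \<in> J - {k}" for l
        using disj[of k l] k that by blast
      then have "(\<Sum>l\<in>J - {k}. ?f l w) = 0" by (intro sum.neutral) (auto simp: xy)
      then have "(\<Sum>k\<in>J. ?f k w) = ?f k w"
        using J k(1) by (simp add: sum.remove)
      also have "\<dots> = ennreal (m k)" using k x by (simp add: xy)
      also have "\<dots> \<le> Q w" using Q[OF k(1) x k(2)] by (simp add: xy)
      finally show ?thesis using sub[OF k(1) x k(2)] by (simp add: xy)
    next
      case False
      then have "(\<Sum>k\<in>J. ?f k w) = 0" by (intro sum.neutral) (auto simp: xy)
      then show ?thesis by simp
    qed
  qed
  also have "\<dots> = (\<integral>\<^sup>+w. Q w \<partial>lebesgue_on (\<Omega> \<times> \<Omega>))"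
    using \<Omega> by (intro nn_integral_lebesgue_on[symmetric]) (simp add: open_Times)
  finally show ?thesis .
qed

text \<open>Beyond the level \<open>t\<close> the second summand equals
  \<open>h * (h / t) powr (q - 1)\<close>, which is at least \<open>h\<close>.\<close>

lemma le_add_power:
  fixes h t q :: real
  assumes "0 < t" "0 \<le> h" "1 \<le> q"
  shows "h \<le> t + t powr (1 - q) * h powr q"
proof (cases "h \<le> t")
  case False
  then have "t powr (1 - q) * h powr q = h * (h / t) powr (q - 1)"
    using assms by (simp add: powr_divide powr_diff field_simps)
  moreover have "1 \<le> (h / t) powr (q - 1)"
    using False assms by (intro ge_one_powr_ge_zero) auto
  ultimately show ?thesis using assms mult_left_mono[of 1 "(h / t) powr (q - 1)" h] by simp
qed (use assms in \<open>simp add: add_increasing2\<close>)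

text \<open>
  The bound of \<open>le_add_power\<close> at the level \<open>\<kappa> / (2 v)\<close> replaces Hoelder's inequality
  on the set \<open>S\<close> of measure \<open>v\<close>.
\<close>

lemma weak_gradient_Lp_ge:
  fixes u :: "'a::euclidean_space \<Rightarrow> real"
  assumes \<Omega>: "open \<Omega>" and der: "\<And>x. (u has_derivative (\<lambda>h. G x \<bullet> h)) (at x)"
    and G: "continuous_on UNIV G" and \<psi>: "test_function \<Omega> \<psi>" and i: "i \<in> Basis"
    and \<psi>1: "\<And>x. \<bar>\<psi> x\<bar> \<le> 1" and S: "S \<in> sets borel" "\<And>x. x \<notin> S \<Longrightarrow> \<psi> x = 0"
    and v: "0 < v" "emeasure lborel S = ennreal v"
    and \<kappa>: "0 < \<kappa>" "\<kappa> \<le> \<bar>\<integral>x. (G x \<bullet> i) * \<psi> x \<partial>lborel\<bar>" and q: "1 \<le> q"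
    and g: "weak_gradient \<Omega> u g"
  shows "ennreal ((\<kappa> / (2 * v)) powr (q - 1) * (\<kappa> / 2)) \<le> (\<integral>\<^sup>+x. ennreal (norm (g x) powr q) \<partial>lebesgue_on \<Omega>)"
proof -
  let ?I = "\<integral>\<^sup>+x. ennreal (norm (g x) powr q) \<partial>lebesgue_on \<Omega>"
  define h where "h x = (g x \<bullet> i) * \<psi> x" for x
  define t where "t = \<kappa> / (2 * v)"
  have t: "0 < t" using \<kappa> v by (simp add: t_def)
  \<comment> \<open>Both \<open>g\<close> and the classical gradient \<open>G\<close> turn into the
    same integral of \<open>u\<close> against the derivative of \<open>\<psi>\<close>; so nothing
    pointwise about \<open>g\<close> is required.\<close>
  have "(LINT x|lebesgue_on \<Omega>. h x) = (LINT x|lebesgue_on \<Omega>. (G x \<bullet> i) * \<psi> x)"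
    using g \<psi> i integration_by_parts[OF \<Omega> der G \<psi> i] by (simp add: weak_gradient_def h_def)
  also have "\<dots> = (\<integral>x. indicator \<Omega> x * ((G x \<bullet> i) * \<psi> x) \<partial>lborel)"
    using \<Omega> test_function_facts(3)[OF \<psi>] G
    by (intro integral_lebesgue_on borel_measurable_continuous_onI continuous_intros) auto
  also have "(\<lambda>x. indicator \<Omega> x * ((G x \<bullet> i) * \<psi> x)) = (\<lambda>x. (G x \<bullet> i) * \<psi> x)"
    using test_function_facts(5)[OF \<psi>] by (intro ext) (auto simp: indicator_def)
  finally have h\<kappa>: "\<kappa> \<le> \<bar>LINT x|lebesgue_on \<Omega>. h x\<bar>" using \<kappa> by simp
  \<comment> \<open>A non-integrable function has integral 0 by convention, which the lower bound
    \<open>\<kappa> > 0\<close> excludes.\<close>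
  then have int: "integrable (lebesgue_on \<Omega>) h"
    using \<kappa>(1) not_integrable_integral_eq[of "lebesgue_on \<Omega>" h] by fastforce
  then have hm [measurable]: "h \<in> borel_measurable (lebesgue_on \<Omega>)" by simp
  have [measurable]: "(\<lambda>x. indicator S x :: ennreal) \<in> borel_measurable (lebesgue_on \<Omega>)"
    by (intro measurable_restrict_space1 measurable_completion) (use S in simp)
  have "ennreal \<kappa> \<le> ennreal (norm (LINT x|lebesgue_on \<Omega>. h x))"
    using h\<kappa> by (simp add: ennreal_leI)
  also have "\<dots> \<le> (\<integral>\<^sup>+x. ennreal (norm (h x)) \<partial>lebesgue_on \<Omega>)"
    by (rule integral_norm_bound_ennreal[OF int])
  also have "\<dots> \<le> (\<integral>\<^sup>+x. ennreal t * indicator S x + ennreal (t powr (1 - q)) * ennreal (norm (h x) powr q) \<partial>lebesgue_on \<Omega>)"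
  proof (rule nn_integral_mono)
    fix x
    show "ennreal (norm (h x)) \<le> ennreal t * indicator S x + ennreal (t powr (1 - q)) * ennreal (norm (h x) powr q)"
      using le_add_power[OF t _ q, of "norm (h x)"] t S(2)[of x]
      by (cases "x \<in> S") (auto simp: h_def ennreal_mult'[symmetric] simp flip: ennreal_plus intro!: ennreal_leI)
  qed
  also have "\<dots> = (\<integral>\<^sup>+x. ennreal t * indicator S x \<partial>lebesgue_on \<Omega>)
     + ennreal (t powr (1 - q)) * (\<integral>\<^sup>+x. ennreal (norm (h x) powr q) \<partial>lebesgue_on \<Omega>)"
    by (simp add: nn_integral_add nn_integral_cmult)
  also have "\<dots> \<le> ennreal (t * v) + ennreal (t powr (1 - q)) * ?I"
  proof (intro add_mono mult_left_mono nn_integral_mono ennreal_leI)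
    have "(\<integral>\<^sup>+x. ennreal t * indicator S x \<partial>lebesgue_on \<Omega>) = (\<integral>\<^sup>+x. ennreal t * indicator S x * indicator \<Omega> x \<partial>lborel)"
      using \<Omega> by (intro nn_integral_lebesgue_on) auto
    also have "\<dots> \<le> (\<integral>\<^sup>+x. ennreal t * indicator S x \<partial>lborel)"
      by (intro nn_integral_mono) (auto simp: indicator_def)
    also have "\<dots> = ennreal (t * v)" using S v t by (simp add: nn_integral_cmult_indicator ennreal_mult)
    finally show "(\<integral>\<^sup>+x. ennreal t * indicator S x \<partial>lebesgue_on \<Omega>) \<le> ennreal (t * v)" .
    fix x
    have "norm (h x) \<le> norm (g x) * 1"
      unfolding h_def norm_mult using Basis_le_norm[OF i, of "g x"] \<psi>1[of x]
      by (intro mult_mono) auto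
    then show "norm (h x) powr q \<le> norm (g x) powr q" using q by (intro powr_mono2) auto
  qed auto
  finally have *: "ennreal \<kappa> \<le> ennreal (t * v) + ennreal (t powr (1 - q)) * ?I" .
  show ?thesis
  proof (cases "?I = \<infinity>")
    case False
    then obtain r where r: "0 \<le> r" "?I = ennreal r" by (cases ?I) auto
    \<comment> \<open>The level was chosen so that the truncated part accounts for half of
      \<open>\<kappa>\<close>; the other half falls on the integral of the power.\<close>
    have tv: "t * v = \<kappa> / 2" using v by (simp add: t_def)
    have "ennreal \<kappa> \<le> ennreal (t * v + t powr (1 - q) * r)"
      using * r t v by (simp add: ennreal_mult)
    then have "\<kappa> \<le> t * v + t powr (1 - q) * r"
      using r t v by (subst (asm) ennreal_le_iff) auto
    then have "\<kappa> / 2 \<le> t powr (1 - q) * r" using tv by simp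
    then have "t powr (q - 1) * (\<kappa> / 2) \<le> t powr (q - 1) * (t powr (1 - q) * r)"
      by (intro mult_left_mono) auto
    also have "\<dots> = r" using t by (simp add: powr_add[symmetric] mult.assoc[symmetric])
    finally show ?thesis unfolding r(2) t_def by (rule ennreal_leI)
  qed simp
qed

section \<open>Seminorms defined as infima over representatives or weak gradients\<close>

lemma AE_lebesgue_on_openD:
  fixes U :: "'a::euclidean_space set"
  assumes "AE x in lebesgue_on \<Omega>. P x" "open \<Omega>" "open U" "U \<subseteq> \<Omega>" "U \<noteq> {}"
  shows "\<exists>x\<in>U. P x"
proof (rule ccontr)
  assume "\<not> (\<exists>x\<in>U. P x)"
  have "AE x in lebesgue. x \<in> \<Omega> \<longrightarrow> P x"
    using assms(1,2) by (subst (asm) AE_restrict_space_iff) auto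
  then have "AE x in lebesgue. x \<notin> U"
    using \<open>\<not> (\<exists>x\<in>U. P x)\<close> assms(4) by (elim AE_mp) (auto intro!: AE_I2)
  then have "U \<in> null_sets lebesgue" using assms(3) by (subst AE_iff_null_sets) auto
  then show False using assms(3,5) open_not_negligible by (auto simp: negligible_iff_null_sets)
qed

text \<open>A representative \<open>v\<close> may differ from \<open>u\<close> at the given points.
  But if its seminorm \<open>H\<close> were smaller, the quotient of \<open>u\<close> would exceed
  \<open>H\<close> on a product of open neighbourhoods, and each of these contains a point where
  \<open>v\<close> and \<open>u\<close> agree.\<close>

lemma sobolev_seminorm_infinity_ge:
  fixes u :: "'a::euclidean_space \<Rightarrow> real"
  assumes \<Omega>: "open \<Omega>" and u: "continuous_on UNIV u" and xy: "x0 \<in> \<Omega>" "y0 \<in> \<Omega>" "x0 \<noteq> y0" and s: "0 < s"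
  shows "ennreal (\<bar>u x0 - u y0\<bar> / norm (x0 - y0) powr s) \<le> sobolev_seminorm s \<infinity> \<Omega> u"
proof -
  let ?r = "\<lambda>u z. \<bar>u (fst z) - u (snd z)\<bar> / norm (fst z - snd z) powr s :: real"
  have "ennreal (?r u (x0, y0)) \<le> hoelder_seminorm s \<Omega> v" if v: "AE x in lebesgue_on \<Omega>. v x = u x" for v
  proof (rule ccontr)
    assume "\<not> ?thesis"
    then have H: "hoelder_seminorm s \<Omega> v < ennreal (?r u (x0, y0))" by simp
    then obtain H where H: "0 \<le> H" "hoelder_seminorm s \<Omega> v = ennreal H"
      by (cases "hoelder_seminorm s \<Omega> v") auto
    with \<open>hoelder_seminorm s \<Omega> v < _\<close> have lt: "H < ?r u (x0, y0)"
      by (simp add: ennreal_less_iff)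
    let ?D = "{z :: 'a \<times> 'a. fst z \<noteq> snd z}"
    have D: "open ?D" by (intro open_Collect_neq continuous_intros)
    have "continuous_on ?D (?r u)"
      by (intro continuous_intros continuous_on_compose2[OF u]) auto
    then have "open ((\<Omega> \<times> \<Omega>) \<inter> (?D \<inter> ?r u -` {H<..}))"
      using continuous_open_preimage[OF _ D, of "?r u" "{H<..}"] \<Omega>
      by (intro open_Int[OF open_Times[OF \<Omega> \<Omega>]]) auto
    moreover have "(x0, y0) \<in> (\<Omega> \<times> \<Omega>) \<inter> (?D \<inter> ?r u -` {H<..})" using xy lt by simp
    ultimately obtain U V where UV: "open U" "open V" "(x0, y0) \<in> U \<times> V"
        "U \<times> V \<subseteq> (\<Omega> \<times> \<Omega>) \<inter> (?D \<inter> ?r u -` {H<..})"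
      by (rule open_prod_elim)
    then have "U \<subseteq> \<Omega>" "V \<subseteq> \<Omega>" by auto
    then obtain x y where x: "x \<in> U" "v x = u x" and y: "y \<in> V" "v y = u y"
      using AE_lebesgue_on_openD[OF v \<Omega>] UV by (metis SigmaE2 empty_iff)
    have z: "(x, y) \<in> (\<Omega> \<times> \<Omega>) \<inter> (?D \<inter> ?r u -` {H<..})" using UV(4) x y by blast
    have "ennreal (?r v (x, y)) \<le> hoelder_seminorm s \<Omega> v"
      unfolding hoelder_seminorm_def using z by (intro SUP_upper2[of "(x, y)"]) auto
    then have "?r v (x, y) \<le> H" using H by (simp add: ennreal_le_iff)
    then show False using z x y by simp
  qed
  then show ?thesis using s by (auto simp: sobolev_seminorm_def intro!: INF_greatest)
qed

lemma gagliardo_norm_ge: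
  fixes u :: "'a::euclidean_space \<Rightarrow> real"
  assumes s: "0 < s" "s < 1" and q: "1 \<le> q" and B: "0 \<le> B"
    and le: "ennreal B \<le> (\<integral>\<^sup>+z. ennreal (\<bar>u (fst z) - u (snd z)\<bar> powr q /
                  norm (fst z - snd z) powr (real DIM('a) + s * q)) \<partial>lebesgue_on (\<Omega> \<times> \<Omega>))"
  shows "ennreal ((gagliardo_const DIM('a) s q * B) powr (1 / q)) \<le> sobolev_norm s (ereal q) \<Omega> u"
proof -
  let ?c = "gagliardo_const DIM('a) s q"
  have c: "0 < ?c" using s q by (intro gagliardo_const_pos) (auto simp: Suc_le_eq)
  have "ennreal (?c * B) = ennreal ?c * ennreal B" using c B by (simp add: ennreal_mult)
  also have "\<dots> \<le> ennpowr (gagliardo_seminorm s q \<Omega> u) q"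
    unfolding ennpowr_gagliardo_seminorm[OF q] by (intro mult_left_mono le) auto
  also have "gagliardo_seminorm s q \<Omega> u = sobolev_seminorm s (ereal q) \<Omega> u"
    using s by (simp add: sobolev_seminorm_def)
  finally have "ennreal ((?c * B) powr (1 / q)) \<le> sobolev_seminorm s (ereal q) \<Omega> u"
    using c B q by (intro le_ennpowr_inverse) auto
  also have "\<dots> \<le> sobolev_norm s (ereal q) \<Omega> u"
    using s q by (intro sobolev_seminorm_le_norm) (auto simp: one_ereal_def)
  finally show ?thesis .
qed

lemma weak_gradient_norm_ge:
  fixes u :: "'a::euclidean_space \<Rightarrow> real"
  assumes q: "1 \<le> q" and B: "0 \<le> B"
    and le: "\<And>g. weak_gradient \<Omega> u g \<Longrightarrow> ennreal B \<le> (\<integral>\<^sup>+x. ennreal (norm (g x) powr q) \<partial>lebesgue_on \<Omega>)"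
  shows "ennreal (B powr (1 / q)) \<le> sobolev_norm 1 (ereal q) \<Omega> u"
proof -
  have "ennreal (B powr (1 / q)) \<le> Lp_norm (ereal q) \<Omega> g" if "weak_gradient \<Omega> u g" for g
    using le[OF that] q B ennpowr_Lp_norm[OF q, of \<Omega> g] by (intro le_ennpowr_inverse) auto
  then have "ennreal (B powr (1 / q)) \<le> sobolev_seminorm 1 (ereal q) \<Omega> u"
    by (auto simp: sobolev_seminorm_def intro!: INF_greatest)
  also have "\<dots> \<le> sobolev_norm 1 (ereal q) \<Omega> u"
    using q by (intro sobolev_seminorm_le_norm) (auto simp: one_ereal_def)
  finally show ?thesis .
qed

section \<open>Concentrating functions\<close>

lemma DERIV_max_0_squared: "((\<lambda>t. (max 0 t)\<^sup>2) has_real_derivative 2 * max 0 t) (at (t::real))"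
proof (cases t "0::real" rule: linorder_cases)
  case less
  have "((\<lambda>_. 0::real) has_real_derivative 2 * max 0 t) (at t)" using less by simp
  then show ?thesis
    by (rule has_field_derivative_transform_within_open[where S="{..<0}"]) (use less in auto)
next
  case equal
  have "((\<lambda>h::real. (max 0 h)\<^sup>2 / h) \<longlongrightarrow> 0) (at 0)"
  proof (rule tendsto_0_le[where K=1 and f="\<lambda>h::real. h"])
    show "\<forall>\<^sub>F h in at 0. norm ((max 0 h)\<^sup>2 / h) \<le> norm (h::real) * 1"
      by (auto simp: eventually_at_filter max_def power2_eq_square)
  qed simp
  then show ?thesis using equal by (simp add: DERIV_def)
next
  case greater
  have "((\<lambda>t. t\<^sup>2) has_real_derivative 2 * max 0 t) (at t)"
    using greater by (auto intro!: derivative_eq_intros)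
  then show ?thesis
    by (rule has_field_derivative_transform_within_open[where S="{0<..}"]) (use greater in auto)
qed

text \<open>Squaring the positive part makes the profile continuously differentiable across the
  sphere of radius \<open>1 / l\<close>. The factor \<open>l powr - s\<close> keeps the Hoelder
  constant of order \<open>s\<close> bounded in \<open>l\<close>.\<close>

definition peak :: "real \<Rightarrow> real \<Rightarrow> 'a::euclidean_space \<Rightarrow> 'a \<Rightarrow> real" where
  "peak s l z x = l powr - s * (max 0 (1 - l\<^sup>2 * ((x - z) \<bullet> (x - z))))\<^sup>2"

definition peak_gradient :: "real \<Rightarrow> real \<Rightarrow> 'a::euclidean_space \<Rightarrow> 'a \<Rightarrow> 'a" where
  "peak_gradient s l z x = (- 4 * l powr - s * l\<^sup>2 * max 0 (1 - l\<^sup>2 * ((x - z) \<bullet> (x - z)))) *\<^sub>R (x - z)"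

lemma peak_has_derivative: "(peak s l z has_derivative (\<lambda>h. peak_gradient s l z x \<bullet> h)) (at x)"
proof -
  have "((\<lambda>x. 1 - l\<^sup>2 * ((x - z) \<bullet> (x - z))) has_derivative (\<lambda>h. - 2 * l\<^sup>2 * ((x - z) \<bullet> h))) (at x)"
    by (auto intro!: derivative_eq_intros simp: inner_commute field_simps)
  from has_derivative_mult_right[OF DERIV_compose_FDERIV[OF DERIV_max_0_squared this], of "l powr - s"]
  show ?thesis unfolding peak_def[abs_def] peak_gradient_def
    by (rule has_derivative_eq_rhs) (auto simp: algebra_simps)
qed

lemma continuous_on_peak_gradient: "continuous_on UNIV (peak_gradient s l z)"
  unfolding peak_gradient_def[abs_def]
  by (intro continuous_on_scaleR continuous_on_mult continuous_on_max continuous_on_diff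
      continuous_on_inner continuous_on_const continuous_on_id)

lemma peak_support:
  assumes "0 < l" "1 / l \<le> norm (x - z)"
  shows "peak s l z x = 0" "peak_gradient s l z x = 0"
proof -
  have "1 \<le> l * norm (x - z)" using assms by (simp add: field_simps)
  then have "1 \<le> (l * norm (x - z))\<^sup>2" by simp
  then have "1 - l\<^sup>2 * ((x - z) \<bullet> (x - z)) \<le> 0" by (simp add: power_mult_distrib power2_norm_eq_inner)
  then show "peak s l z x = 0" "peak_gradient s l z x = 0"
    by (auto simp: peak_def peak_gradient_def)
qed

lemma peak_bounds:
  assumes "0 < l"
  shows "0 \<le> peak s l z x" "peak s l z x \<le> l powr - s"
proof -
  have "max 0 (1 - l\<^sup>2 * ((x - z) \<bullet> (x - z))) \<le> 1" by simp
  then have "(max 0 (1 - l\<^sup>2 * ((x - z) \<bullet> (x - z))))\<^sup>2 \<le> 1\<^sup>2" by (intro power_mono) auto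
  then show "peak s l z x \<le> l powr - s" unfolding peak_def using mult_left_mono by fastforce
qed (simp add: peak_def)

lemma peak_gradient_bound:
  assumes "0 < l"
  shows "norm (peak_gradient s l z x) \<le> 4 * l powr (1 - s)"
proof (cases "1 / l \<le> norm (x - z)")
  case False
  have m: "max 0 (1 - l\<^sup>2 * ((x - z) \<bullet> (x - z))) \<le> 1" by simp
  have "norm (peak_gradient s l z x)
     = 4 * l powr - s * l\<^sup>2 * max 0 (1 - l\<^sup>2 * ((x - z) \<bullet> (x - z))) * norm (x - z)"
    by (simp add: peak_gradient_def abs_mult)
  also have "\<dots> \<le> 4 * l powr - s * l\<^sup>2 * 1 * (1 / l)"
    using False m by (intro mult_mono) auto
  also have "\<dots> = 4 * l powr (1 - s)"
    using assms by (simp add: powr_diff powr_minus field_simps power2_eq_square)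
  finally show ?thesis .
next
  case True
  show ?thesis using peak_support(2)[OF assms True, of s] by simp
qed

text \<open>If \<open>l * d \<ge> 1\<close>, the size bound suffices because
  \<open>l powr - s \<le> d powr s\<close>. Otherwise \<open>(l * d) powr (1 - s) \<le> 1\<close>
  turns the Lipschitz bound into the Hoelder bound.\<close>

lemma interpolation_le_powr:
  fixes d l s a b :: real
  assumes "0 \<le> s" "s \<le> 1" "0 < l" "0 \<le> d" "0 \<le> a" and "b \<le> a * l powr - s" "b \<le> a * l powr (1 - s) * d"
  shows "b \<le> a * d powr s"
proof (cases "1 \<le> l * d")
  case True
  then have "1 \<le> (l * d) powr s" using assms by (intro ge_one_powr_ge_zero) auto
  then have "l powr - s \<le> d powr s" using assms by (simp add: powr_mult powr_minus field_simps)
  then show ?thesis using assms by (meson mult_left_mono order_trans)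
next
  case False
  show ?thesis
  proof (cases "d = 0")
    case False
    then have d: "0 < d" using assms by simp
    have "(l * d) powr (1 - s) \<le> 1" using \<open>\<not> 1 \<le> l * d\<close> assms by (intro powr_le1) auto
    then have "(l * d) powr (1 - s) * d powr s \<le> 1 * d powr s" by (intro mult_right_mono) auto
    moreover have "(l * d) powr (1 - s) * d powr s = l powr (1 - s) * d"
      using assms d by (simp add: powr_mult mult.assoc powr_add[symmetric])
    ultimately have "a * (l powr (1 - s) * d) \<le> a * d powr s" using assms by (intro mult_left_mono) auto
    then show ?thesis using assms by (simp add: mult.assoc)
  qed (use assms in simp)
qed

lemma peak_hoelder:
  assumes "0 \<le> s" "s \<le> 1" "0 < l"
  shows "\<bar>peak s l z x - peak s l z y\<bar> \<le> 4 * norm (x - y) powr s"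
proof (rule interpolation_le_powr[where l=l])
  have "\<bar>peak s l z x - peak s l z y\<bar> \<le> l powr - s"
    using peak_bounds[OF assms(3), of s z x] peak_bounds[OF assms(3), of s z y] by linarith
  then show "\<bar>peak s l z x - peak s l z y\<bar> \<le> 4 * l powr - s"
    using powr_ge_zero[of l "- s"] by linarith
  show "\<bar>peak s l z x - peak s l z y\<bar> \<le> 4 * l powr (1 - s) * norm (x - y)"
    by (rule lipschitz_if_gradient_bounded[OF peak_has_derivative peak_gradient_bound[OF assms(3)]])
qed (use assms in auto)

text \<open>The decay \<open>(2 ^ L) powr - (N / p)\<close> is the p-th root of the measure of the
  support; height and slope are already balanced by the Hoelder normalization.\<close>

lemma peak_upper:
  fixes \<Omega> :: "'a::euclidean_space set"
  assumes s: "0 < s" "s \<le> 1" and p: "1 \<le> p" and \<Omega>: "open \<Omega>" "bounded \<Omega>"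
  shows "\<exists>K>0. \<forall>L z. peak s (2 ^ L) z \<in> sobolev_space s (ereal p) \<Omega> \<and>
     sobolev_norm s (ereal p) \<Omega> (peak s (2 ^ L) z) \<le>
       ennreal ((K * (1 + real L)) powr (1 / p) * (2 ^ L) powr - (real DIM('a) / p))"
proof -
  let ?w = "unit_ball_vol (real DIM('a))"
  obtain K where K: "0 < K" "\<And>u G A L S v. (\<forall>x. (u has_derivative (\<lambda>h. G x \<bullet> h)) (at x)) \<Longrightarrow>
     continuous_on UNIV G \<Longrightarrow> 0 \<le> A \<Longrightarrow> (\<forall>x. \<bar>u x\<bar> \<le> A) \<Longrightarrow>
     (\<forall>x y. \<bar>u x - u y\<bar> \<le> A * norm (x - y) powr s) \<Longrightarrow>
     (\<forall>x. norm (G x) \<le> A * (2 ^ L) powr (1 - s)) \<Longrightarrow>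
     S \<in> sets borel \<Longrightarrow> (\<forall>x\<in>\<Omega> - S. u x = 0 \<and> G x = 0) \<Longrightarrow>
     0 \<le> v \<Longrightarrow> emeasure lborel S = ennreal v \<Longrightarrow>
     u \<in> sobolev_space s (ereal p) \<Omega> \<and>
     sobolev_norm s (ereal p) \<Omega> u \<le> ennreal ((K * A powr p * (1 + real L) * v) powr (1 / p))"
    using sobolev_norm_upper[OF s p \<Omega>] by blast
  show ?thesis
  proof (intro exI[of _ "K * 4 powr p * ?w"] conjI[of "0 < K * 4 powr p * ?w"] allI)
    fix L :: nat and z :: 'a
    let ?l = "2 ^ L :: real"
    have l: "0 < ?l" "1 \<le> ?l" by auto
    let ?v = "?w * (1 / ?l) ^ DIM('a)"
    have *: "peak s ?l z \<in> sobolev_space s (ereal p) \<Omega> \<and>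
       sobolev_norm s (ereal p) \<Omega> (peak s ?l z) \<le> ennreal ((K * 4 powr p * (1 + real L) * ?v) powr (1 / p))"
    proof (rule K(2)[where G="peak_gradient s ?l z" and S="ball z (1 / ?l)"])
      show "\<forall>x. \<bar>peak s ?l z x\<bar> \<le> 4"
      proof
        fix x
        have "?l powr - s \<le> 1 powr - s" using l s by (intro powr_mono2') auto
        then show "\<bar>peak s ?l z x\<bar> \<le> 4" using peak_bounds[OF l(1), of s z x] by simp
      qed
      show "emeasure lborel (ball z (1 / ?l)) = ennreal ?v" by (rule emeasure_ball) simp
      show "\<forall>x\<in>\<Omega> - ball z (1 / ?l). peak s ?l z x = 0 \<and> peak_gradient s ?l z x = 0"
        using peak_support[OF l(1)] by (auto simp: dist_norm norm_minus_commute not_less)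
    qed (use s peak_has_derivative continuous_on_peak_gradient peak_hoelder[OF less_imp_le[OF s(1)] s(2) l(1)] peak_gradient_bound[OF l(1)] in auto)
    have "(1 / x) ^ n = x powr - real n" if "0 < x" for x :: real and n
      using that by (simp add: powr_minus_divide powr_realpow power_divide)
    from this[OF l(1)] have "(1 / ?l) ^ DIM('a) = ?l powr - real DIM('a)" .
    then have "(K * 4 powr p * (1 + real L) * ?v) powr (1 / p)
       = ((K * 4 powr p * ?w * (1 + real L)) * ?l powr - real DIM('a)) powr (1 / p)"
      by (simp only: mult_ac)
    also have "\<dots> = (K * 4 powr p * ?w * (1 + real L)) powr (1 / p) * ?l powr - (real DIM('a) / p)"
      using K(1) by (simp add: powr_mult powr_powr)
    finally show "peak s ?l z \<in> sobolev_space s (ereal p) \<Omega> \<and>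
     sobolev_norm s (ereal p) \<Omega> (peak s ?l z) \<le>
       ennreal ((K * 4 powr p * ?w * (1 + real L)) powr (1 / p) * ?l powr - (real DIM('a) / p))"
      using * by simp
  qed (use K in auto)
qed

lemma power_inverse_scale:
  fixes l :: real
  assumes "0 < l" "0 \<le> a"
  shows "(a / l) ^ n = a ^ n * l powr - real n"
  using assms by (simp add: powr_minus_divide powr_realpow power_divide)

text \<open>Points near the centre, where the peak has at least half its height, are paired with
  points at distance about \<open>2 / l\<close>, where it vanishes.\<close>

lemma peak_lower_gagliardo:
  fixes \<Omega> :: "'a::euclidean_space set"
  assumes \<Omega>: "open \<Omega>" and s: "0 < s" "s \<le> 1" and s': "0 < s'" "s' < 1" and q: "1 \<le> q"
  shows "\<exists>k>0. \<forall>l z. 0 < l \<longrightarrow> ball z (3 / l) \<subseteq> \<Omega> \<longrightarrow>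
     ennreal (k * l powr (s' - s - real DIM('a) / q)) \<le> sobolev_norm s' (ereal q) \<Omega> (peak s l z)"
proof -
  let ?N = "DIM('a)" and ?w = "unit_ball_vol (real DIM('a))"
  let ?E = "real ?N + s' * q"
  obtain e :: 'a where e: "e \<in> Basis" "norm e = 1" using nonempty_Basis norm_Basis by blast
  let ?c = "gagliardo_const ?N s' q"
  have c: "0 < ?c" using s' q by (intro gagliardo_const_pos) (auto simp: Suc_le_eq)
  define k0 where "k0 = ?w\<^sup>2 * (1 / 4) ^ ?N * ((1 / 2) powr q * (1 / 3) powr ?E * (1 / 4) ^ ?N)"
  have w: "0 < ?w" by simp
  have k0: "0 < k0" unfolding k0_def using w by (intro mult_pos_pos zero_less_power) auto
  have "ennreal ((?c * k0) powr (1 / q) * l powr (s' - s - real ?N / q)) \<le> sobolev_norm s' (ereal q) \<Omega> (peak s l z)"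
    if l: "0 < l" and sub: "ball z (3 / l) \<subseteq> \<Omega>" for l z
  proof -
    let ?u = "peak s l z"
    \<comment> \<open>Half the height in the numerator, and \<open>3 / l\<close> as a bound for the
      distance of the paired points.\<close>
    define m where "m = (l powr - s / 2) powr q / (3 / l) powr ?E"
    have m: "m = (1 / 2) powr q * (1 / 3) powr ?E * l powr (s' * q - s * q + real ?N)"
    proof -
      have "(l powr - s / 2) powr q = l powr (- (s * q)) * (1 / 2) powr q"
        using l by (simp add: powr_divide powr_powr)
      moreover have "1 / (3 / l) powr ?E = (1 / 3) powr ?E * l powr ?E"
        using l by (simp add: powr_divide)
      moreover have "m = (l powr - s / 2) powr q * (1 / (3 / l) powr ?E)" by (simp add: m_def)
      moreover have "l powr (s' * q - s * q + real ?N) = l powr (- (s * q)) * l powr ?E"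
        unfolding powr_add[symmetric] by (rule arg_cong[where f="(powr) l"]) simp
      ultimately show ?thesis by (simp only: mult_ac)
    qed
    have "ennreal (?w\<^sup>2 * (1 / (4 * l)) ^ ?N * (\<Sum>k\<in>{0::nat}. m * (1 / (4 * l)) ^ ?N))
       \<le> (\<integral>\<^sup>+w. ennreal (\<bar>?u (fst w) - ?u (snd w)\<bar> powr q / norm (fst w - snd w) powr ?E) \<partial>lebesgue_on (\<Omega> \<times> \<Omega>))"
    \<comment> \<open>With these radii \<open>norm (y - z)\<close> lies between
      \<open>3 / (2 * l)\<close> and \<open>5 / (2 * l)\<close>: outside the support, inside
      \<open>ball z (3 / l)\<close>.\<close>
    proof (rule double_integral_ge[where z=z and c="\<lambda>_. (2 / l) *\<^sub>R e" and \<rho>="\<lambda>_. 1 / (4 * l)"])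
      fix x y :: 'a
      assume x: "x \<in> ball z (1 / (4 * l))" and y: "y - x \<in> ball ((2 / l) *\<^sub>R e) (1 / (4 * l))"
      define d where "d = 1 / l"
      have d: "1 / (4 * l) = d / 4" "2 / l = 2 * d" "3 / l = 3 * d" "1 / l = d" "0 < d" "l * d = 1"
        using l by (simp_all add: d_def)
      have nx: "norm (x - z) < d / 4" using x unfolding d by (simp add: dist_norm norm_minus_commute)
      have nd: "norm (y - x - (2 * d) *\<^sub>R e) < d / 4" using y unfolding d by (simp add: dist_norm norm_minus_commute)
      have n2: "norm ((2 * d) *\<^sub>R e) = 2 * d" using e d(5) by simp
      have yx: "norm (y - x) < 9 / 4 * d"
        using norm_triangle_ineq[of "y - x - (2 * d) *\<^sub>R e" "(2 * d) *\<^sub>R e"] nd n2 by simp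
      have yz: "norm (y - z) < 10 / 4 * d"
        using norm_triangle_ineq[of "y - x" "x - z"] yx nx by simp
      have yz': "1 / l \<le> norm (y - z)"
      proof -
        have "norm ((2 * d) *\<^sub>R e) \<le> norm (y - z) + norm (x - z) + norm (y - x - (2 * d) *\<^sub>R e)"
          using norm_triangle_ineq4[of "(y - z) - (x - z)" "y - x - (2 * d) *\<^sub>R e"]
            norm_triangle_ineq4[of "y - z" "x - z"] by simp
        then show ?thesis using nd nx n2 d(5) unfolding d(4) by linarith
      qed
      have "norm (x - z) < 3 * d" "norm (y - z) < 3 * d" using nx yz d(5) by linarith+
      then have "x \<in> ball z (3 / l)" "y \<in> ball z (3 / l)"
        unfolding d by (simp_all add: dist_norm norm_minus_commute)
      then show "x \<in> \<Omega> \<and> y \<in> \<Omega>" using sub by blast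
      have uy: "?u y = 0" by (rule peak_support(1)[OF l yz'])
      have "l powr - s / 2 \<le> ?u x"
      proof -
        have "l * norm (x - z) \<le> l * (d / 4)" using nx l by (intro mult_left_mono) auto
        then have "l * norm (x - z) \<le> 1 / 4" using d(6) by simp
        then have "(l * norm (x - z))\<^sup>2 \<le> (1 / 4)\<^sup>2" using l by (intro power_mono) auto
        then have "l\<^sup>2 * ((x - z) \<bullet> (x - z)) \<le> 1 / 16"
          unfolding power_mult_distrib power2_norm_eq_inner by (simp add: power_divide)
        then have "15 / 16 \<le> max 0 (1 - l\<^sup>2 * ((x - z) \<bullet> (x - z)))" by simp
        moreover have "1 / 2 \<le> t\<^sup>2" if "15 / 16 \<le> t" for t :: real
          using power_mono[OF that, of 2] by (simp add: power2_eq_square)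
        ultimately have "1 / 2 \<le> (max 0 (1 - l\<^sup>2 * ((x - z) \<bullet> (x - z))))\<^sup>2" by blast
        then have "l powr - s * (1 / 2) \<le> ?u x" unfolding peak_def by (intro mult_left_mono) auto
        then show ?thesis by simp
      qed
      then have 1: "(l powr - s / 2) powr q \<le> \<bar>?u x - ?u y\<bar> powr q"
        using uy q by (intro powr_mono2) auto
      have xy: "x \<noteq> y" using yz' nx d(5) unfolding d(4) by auto
      have "norm (x - y) powr ?E \<le> (3 / l) powr ?E"
        unfolding d(3) using yx d(5) s' q by (intro powr_mono2) (auto simp: norm_minus_commute)
      then have "m \<le> \<bar>?u x - ?u y\<bar> powr q / norm (x - y) powr ?E"
        unfolding m_def using 1 xy by (intro frac_le) auto
      then show "ennreal m \<le> ennreal (\<bar>?u (fst (x, y)) - ?u (snd (x, y))\<bar> powr q / norm (fst (x, y) - snd (x, y)) powr ?E)"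
        by (simp add: ennreal_leI)
    qed (use \<Omega> l m in auto)
    moreover have "?w\<^sup>2 * (1 / (4 * l)) ^ ?N * (\<Sum>k\<in>{0::nat}. m * (1 / (4 * l)) ^ ?N) = k0 * l powr ((s' - s - real ?N / q) * q)"
    proof -
      have p: "(1 / (4 * l)) ^ ?N = (1 / 4) ^ ?N * l powr - real ?N"
        using power_inverse_scale[OF l, of "1 / 4" ?N] by simp
      \<comment> \<open>The two negative powers are the volumes of the balls for \<open>x\<close>
        and for \<open>y - x\<close>; the positive \<open>real ?N\<close> comes from the
        kernel.\<close>
      have "(s' - s - real ?N / q) * q = (s' * q - s * q + real ?N) + (- real ?N) + (- real ?N)"
        using q by (simp add: field_simps)
      then have "l powr ((s' - s - real ?N / q) * q) = l powr (s' * q - s * q + real ?N) * l powr - real ?N * l powr - real ?N"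
        by (simp only: powr_add)
      then show ?thesis unfolding p m k0_def by (simp only: sum.insert sum.empty finite.emptyI empty_iff not_False_eq_True add_0_right mult_ac)
    qed
    ultimately have "ennreal ((?c * (k0 * l powr ((s' - s - real ?N / q) * q))) powr (1 / q)) \<le> sobolev_norm s' (ereal q) \<Omega> ?u"
      using k0 by (intro gagliardo_norm_ge s' q) auto
    moreover have "(?c * (k0 * l powr ((s' - s - real ?N / q) * q))) powr (1 / q)
      = (?c * k0) powr (1 / q) * l powr (s' - s - real ?N / q)"
      using q c k0 l by (simp add: powr_mult powr_powr mult.assoc[symmetric])
    ultimately show ?thesis by simp
  qed
  then show ?thesis using c k0 by (intro exI[of _ "(?c * k0) powr (1 / q)"]) auto
qed

text \<open>At \<open>s = 1\<close> the slope is of order 1 for every \<open>l\<close>. On a small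
  ball between centre and rim the derivative in direction \<open>i\<close> has constant sign, so
  testing against a bump there detects it in every weak gradient.\<close>

lemma peak_lower_weak_gradient:
  fixes \<Omega> :: "'a::euclidean_space set"
  assumes \<Omega>: "open \<Omega>" and q: "1 \<le> q"
  shows "\<exists>k>0. \<forall>l z. 0 < l \<longrightarrow> ball z (3 / l) \<subseteq> \<Omega> \<longrightarrow>
     ennreal (k * l powr (- (real DIM('a) / q))) \<le> sobolev_norm 1 (ereal q) \<Omega> (peak 1 l z)"
proof -
  let ?N = "DIM('a)" and ?w = "unit_ball_vol (real DIM('a))"
  obtain i :: 'a where i: "i \<in> Basis" "norm i = 1" using nonempty_Basis norm_Basis by blast
  \<comment> \<open>The slope bound \<open>7 / 16\<close>, the bump bound \<open>exp (- 2)\<close>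
    on the half ball, and the volume ratio of the half ball.\<close>
  define k0 :: real where "k0 = 7 / 16 * exp (- 2) * (1 / 2) ^ ?N"
  have k0: "0 < k0" by (simp add: k0_def)
  define k1 where "k1 = (k0 / 2) powr (q - 1) * (k0 / 2) * (?w * (1 / 4) ^ ?N)"
  have k1: "0 < k1" unfolding k1_def using k0 unit_ball_vol_pos[of "real ?N"] by (intro mult_pos_pos) auto
  have "ennreal (k1 powr (1 / q) * l powr (- (real ?N / q))) \<le> sobolev_norm 1 (ereal q) \<Omega> (peak 1 l z)"
    if l: "0 < l" and sub: "ball z (3 / l) \<subseteq> \<Omega>" for l z
  proof -
    let ?G = "peak_gradient 1 l z"
    define d where "d = 1 / l"
    have d: "1 / (4 * l) = d / 4" "3 / l = 3 * d" "1 / (2 * l) = d / 2" "0 < d" "l * d = 1"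
      using l by (simp_all add: d_def)
    define r where "r = 1 / (4 * l)"
    have rd: "r = d / 4" unfolding r_def by (rule d)
    \<comment> \<open>Halfway to the rim. On the ball of radius \<open>1 / (4 * l)\<close> about
      \<open>z1\<close> the distance to \<open>z\<close> is at most \<open>3 / (4 * l)\<close>, so
      the cut-off is at least \<open>7 / 16\<close>, and the component of \<open>x - z\<close> along
      \<open>i\<close> is at least \<open>1 / (4 * l)\<close>.\<close>
    define z1 where "z1 = z + (d / 2) *\<^sub>R i"
    define v where "v = ?w * r ^ ?N"
    have r: "0 < r" using l by (simp add: r_def)
    have v: "0 < v" using r by (simp add: v_def)
    have z1z: "norm (z1 - z) = d / 2" using i d(4) by (simp add: z1_def)
    have dist: "norm (x - z) \<le> norm (x - z1) + d / 2" for x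
      using norm_triangle_ineq[of "x - z1" "z1 - z"] z1z by simp
    have cb: "cball z1 r \<subseteq> \<Omega>"
    proof
      fix x assume "x \<in> cball z1 r"
      then have "norm (x - z1) \<le> r" by (simp add: dist_norm norm_minus_commute)
      then have "norm (x - z) < 3 / l" using dist[of x] d(4) unfolding rd d(2) by linarith
      then show "x \<in> \<Omega>" using sub by (auto simp: dist_norm norm_minus_commute)
    qed
    have test: "test_function \<Omega> (bump z1 r)"
      using test_function_bump_mult[OF r cb, of "\<lambda>_. 1", OF Ck_const] by simp
    have Gi: "7 / 16 \<le> - (?G x \<bullet> i)" if x: "x \<in> ball z1 r" for x
    proof -
      have nx: "norm (x - z1) < r" using x by (simp add: dist_norm norm_minus_commute)
      have "l * norm (x - z) \<le> 3 / 4"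
      proof -
        have "norm (x - z) \<le> d * (3 / 4)" using dist[of x] nx unfolding rd by linarith
        then have "l * norm (x - z) \<le> l * (d * (3 / 4))" using l by (intro mult_left_mono) auto
        then show ?thesis unfolding mult.assoc[symmetric] d(5) by simp
      qed
      then have "(l * norm (x - z))\<^sup>2 \<le> (3 / 4)\<^sup>2" using l by (intro power_mono) auto
      then have "l\<^sup>2 * ((x - z) \<bullet> (x - z)) \<le> 9 / 16"
        unfolding power_mult_distrib power2_norm_eq_inner by (simp add: power_divide)
      then have m: "7 / 16 \<le> max 0 (1 - l\<^sup>2 * ((x - z) \<bullet> (x - z)))" by simp
      have "\<bar>(x - z1) \<bullet> i\<bar> \<le> r" using Basis_le_norm[OF i(1), of "x - z1"] nx by simp
      moreover have "(x - z) \<bullet> i = (x - z1) \<bullet> i + d / 2"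
        using i by (simp add: z1_def algebra_simps inner_simps)
      ultimately have xi: "1 / (4 * l) \<le> (x - z) \<bullet> i" unfolding rd d(1) by linarith
      have "7 / 16 = 4 * l powr - 1 * l\<^sup>2 * (7 / 16) * (1 / (4 * l))"
        using l by (simp add: powr_minus power2_eq_square)
      also have "\<dots> \<le> 4 * l powr - 1 * l\<^sup>2 * max 0 (1 - l\<^sup>2 * ((x - z) \<bullet> (x - z))) * ((x - z) \<bullet> i)"
        by (intro mult_mono m xi) (use l in auto)
      also have "\<dots> = - (?G x \<bullet> i)" by (simp add: peak_gradient_def)
      finally show ?thesis .
    qed
    have contG: "continuous_on UNIV (\<lambda>x. (?G x \<bullet> i) * bump z1 r x)"
      using continuous_on_peak_gradient[of 1 l z] test_function_facts(3)[OF test] by (intro continuous_intros)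
    have "k0 * v \<le> (\<integral>x. - ((?G x \<bullet> i) * bump z1 r x) \<partial>lborel)"
    proof -
      have fin: "emeasure lborel (ball z1 (r / 2)) < \<infinity>" using emeasure_bounded_finite bounded_ball by blast
      have "k0 * v = (7 / 16 * exp (- 2)) * (?w * (r / 2) ^ ?N)"
        by (simp add: k0_def v_def power_divide)
      also have "?w * (r / 2) ^ ?N = measure lborel (ball z1 (r / 2))"
        using r by (simp add: measure_def emeasure_ball)
      also have "(7 / 16 * exp (- 2)) * measure lborel (ball z1 (r / 2)) = (\<integral>x. (7 / 16 * exp (- 2)) * indicator (ball z1 (r / 2)) x \<partial>lborel)"
        using fin by simp
      also have "\<dots> \<le> (\<integral>x. - ((?G x \<bullet> i) * bump z1 r x) \<partial>lborel)"
      proof (rule integral_mono)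
        show "integrable lborel (\<lambda>x. 7 / 16 * exp (- 2) * indicator (ball z1 (r / 2)) x :: real)"
          using fin by (intro integrable_mult_right integrable_real_indicator) auto
        have "(?G x \<bullet> i) * bump z1 r x = 0" if "norm z1 + r < norm x" for x
        proof -
          have "norm x \<le> norm z1 + norm (x - z1)" using norm_triangle_ineq[of z1 "x - z1"] by simp
          then have "x \<notin> ball z1 r" using that by (auto simp: dist_norm norm_minus_commute)
          then show ?thesis using bump_eq_0[OF r, of x z1] by simp
        qed
        then show "integrable lborel (\<lambda>x. - ((?G x \<bullet> i) * bump z1 r x))"
          using contG by (intro integrable_minus integrable_compact_support[where R="norm z1 + r"])
        fix x
        show "7 / 16 * exp (- 2) * indicator (ball z1 (r / 2)) x \<le> - ((?G x \<bullet> i) * bump z1 r x)"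
        proof (cases "x \<in> ball z1 r")
          case True
          have "7 / 16 * (exp (- 2) * indicator (ball z1 (r / 2)) x) \<le> - (?G x \<bullet> i) * bump z1 r x"
            using Gi[OF True] bump_ge[OF r, of x z1] bump_bounds(1)[of z1 r x]
            by (intro mult_mono) (auto simp: indicator_def)
          then show ?thesis by simp
        next
          case False
          then have "x \<notin> ball z1 (r / 2)" using r by auto
          then show ?thesis using bump_eq_0[OF r False] by simp
        qed
      qed
      finally show ?thesis .
    qed
    then have \<kappa>: "k0 * v \<le> \<bar>\<integral>x. (?G x \<bullet> i) * bump z1 r x \<partial>lborel\<bar>"
      by simp
    have "ennreal (((k0 * v / (2 * v)) powr (q - 1) * (k0 * v / 2)) powr (1 / q)) \<le> sobolev_norm 1 (ereal q) \<Omega> (peak 1 l z)"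
    proof (rule weak_gradient_norm_ge[OF q])
      show "ennreal ((k0 * v / (2 * v)) powr (q - 1) * (k0 * v / 2)) \<le> (\<integral>\<^sup>+x. ennreal (norm (g x) powr q) \<partial>lebesgue_on \<Omega>)"
        if g: "weak_gradient \<Omega> (peak 1 l z) g" for g
      proof (rule weak_gradient_Lp_ge[OF \<Omega> peak_has_derivative continuous_on_peak_gradient test i(1) _ _ _ v _ _ \<kappa> q g])
        show "\<bar>bump z1 r x\<bar> \<le> 1" for x using bump_bounds[of z1 r x] by simp
        show "x \<notin> ball z1 r \<Longrightarrow> bump z1 r x = 0" for x by (rule bump_eq_0[OF r])
        show "emeasure lborel (ball z1 r) = ennreal v" unfolding v_def using r by (intro emeasure_ball) simp
      qed (use k0 v in auto)
    qed (use k0 v in simp)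
    moreover have "(k0 * v / (2 * v)) powr (q - 1) * (k0 * v / 2) = k1 * l powr - real ?N"
    proof -
      have vl: "v = ?w * (1 / 4) ^ ?N * l powr - real ?N"
        using power_inverse_scale[OF l, of "1 / 4" ?N] by (simp add: v_def r_def)
      \<comment> \<open>The truncation level does not depend on \<open>l\<close>; the whole
        dependence on \<open>l\<close> sits in the volume \<open>v\<close>.\<close>
      have "k0 * v / (2 * v) = k0 / 2" using v by simp
      then have "(k0 * v / (2 * v)) powr (q - 1) * (k0 * v / 2) = (k0 / 2) powr (q - 1) * (k0 / 2) * v"
        by simp
      then show ?thesis unfolding vl k1_def by (simp only: mult_ac)
    qed
    moreover have "(k1 * l powr - real ?N) powr (1 / q) = k1 powr (1 / q) * l powr (- (real ?N / q))"
      using k1 by (simp add: powr_mult powr_powr)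
    ultimately show ?thesis by simp
  qed
  then show ?thesis using k1 by (intro exI[of _ "k1 powr (1 / q)"]) auto
qed

text \<open>Compares the centre with a point of the rim, at distance \<open>1 / l\<close>.\<close>

lemma peak_lower_infinity:
  fixes \<Omega> :: "'a::euclidean_space set"
  assumes \<Omega>: "open \<Omega>" and s': "0 < s'" and l: "0 < l" and sub: "ball z (3 / l) \<subseteq> \<Omega>"
  shows "ennreal (l powr (s' - s)) \<le> sobolev_norm s' \<infinity> \<Omega> (peak s l z)"
proof -
  obtain e :: 'a where e: "e \<in> Basis" "norm e = 1" using nonempty_Basis norm_Basis by blast
  let ?y = "z + (1 / l) *\<^sub>R e"
  have n: "norm (z - ?y) = 1 / l" "norm (?y - z) = 1 / l" using e l by auto
  have zne: "z \<noteq> ?y" using n(1) l by auto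
  have "z \<in> ball z (3 / l)" "?y \<in> ball z (3 / l)"
    using n l by (auto simp: dist_norm divide_strict_right_mono)
  then have zy: "z \<in> \<Omega>" "?y \<in> \<Omega>" using sub by blast+
  have cont: "continuous_on UNIV (peak s l z)"
    using peak_has_derivative by (meson continuous_at_imp_continuous_on has_derivative_continuous)
  have "peak s l z ?y = 0" using n l by (intro peak_support) auto
  moreover have "peak s l z z = l powr - s" by (simp add: peak_def)
  ultimately have "\<bar>peak s l z z - peak s l z ?y\<bar> / norm (z - ?y) powr s' = l powr - s / (1 / l) powr s'"
    unfolding n by simp
  also have "\<dots> = l powr (s' - s)"
    using l by (simp add: powr_divide powr_diff powr_minus field_simps)
  finally have "ennreal (l powr (s' - s)) \<le> sobolev_seminorm s' \<infinity> \<Omega> (peak s l z)"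
    using sobolev_seminorm_infinity_ge[OF \<Omega> cont zy _ s'] zne unfolding n by simp
  also have "\<dots> \<le> sobolev_norm s' \<infinity> \<Omega> (peak s l z)"
    using s' by (intro sobolev_seminorm_le_norm) auto
  finally show ?thesis .
qed

section \<open>Lacunary series\<close>

lemma abs_sin_diff_le: "\<bar>sin x - sin y\<bar> \<le> \<bar>x - y\<bar>" for x y :: real
proof -
  have "\<bar>sin x - sin y\<bar> = 2 * \<bar>sin ((x - y) / 2)\<bar> * \<bar>cos ((x + y) / 2)\<bar>"
    by (simp add: sin_diff_sin abs_mult)
  also have "\<dots> \<le> 2 * \<bar>(x - y) / 2\<bar> * 1"
    by (intro mult_mono abs_sin_x_le_abs_x) auto
  finally show ?thesis by simp
qed

text \<open>The base is \<open>2 ^ b\<close> so that the top frequency after \<open>n\<close> steps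
  is \<open>2 ^ L\<close> with \<open>L = b * n\<close>. The numerical bounds make one scale
  dominate: at distance at most \<open>6 / M ^ k\<close> the lower frequencies change the sum by at
  most \<open>6 / 24\<close>, and the higher ones by at most \<open>2 * (9 / 8) * (1 / 9)\<close>,
  of \<open>\<mu> ^ k\<close>.\<close>

locale lacunary_series =
  fixes s :: real and b :: nat and e :: "'a::euclidean_space"
  assumes s: "0 < s" "s < 1" and e: "e \<in> Basis"
    and small: "(2 ^ b) powr - s \<le> (1 / 9 :: real)" and large: "25 \<le> (2 ^ b) powr (1 - s)"
begin

definition M :: real where "M = 2 ^ b"
definition \<mu> :: real where "\<mu> = M powr - s"
definition \<nu> :: real where "\<nu> = M powr (1 - s)"

text \<open>A partial sum of a Weierstrass function of the coordinate \<open>x \<bullet> e\<close>,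
  with a phase common to all terms.\<close>

definition W :: "nat \<Rightarrow> real \<Rightarrow> 'a \<Rightarrow> real" where
  "W n \<theta> x = (\<Sum>j\<le>n. \<mu> ^ j * sin (M ^ j * (x \<bullet> e) + \<theta>))"

definition W' :: "nat \<Rightarrow> real \<Rightarrow> 'a \<Rightarrow> real" where
  "W' n \<theta> x = (\<Sum>j\<le>n. \<nu> ^ j * cos (M ^ j * (x \<bullet> e) + \<theta>))"

lemma M_pos: "0 < M" and mu_pos: "0 < \<mu>" and mu_le: "\<mu> \<le> 1 / 9" and nu_ge: "25 \<le> \<nu>"
  using small large by (auto simp: M_def \<mu>_def \<nu>_def)

lemma nu_eq: "\<nu> = \<mu> * M"
  using M_pos by (simp add: \<mu>_def \<nu>_def powr_diff powr_minus field_simps)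

lemma nu_power: "\<nu> ^ k = \<mu> ^ k * M ^ k"
  by (simp add: nu_eq power_mult_distrib)

lemma M_ge: "9 \<le> M"
proof -
  have "25 \<le> \<mu> * M" using nu_ge nu_eq by simp
  also have "\<dots> \<le> 1 / 9 * M" using mu_le M_pos by (intro mult_right_mono) auto
  finally show ?thesis by simp
qed

lemma mu_power: "\<mu> ^ k = (M ^ k) powr - s" and nu_power_powr: "\<nu> ^ k = (M ^ k) powr (1 - s)"
  using M_pos by (simp_all add: \<mu>_def \<nu>_def powr_realpow[symmetric] powr_powr mult.commute)

section \<open>Size, derivative and Hoelder continuity of the lacunary sums\<close>

lemma sum_mu_le: "(\<Sum>j=k..n. \<mu> ^ j) \<le> 9 / 8 * \<mu> ^ k"
proof -
  \<comment> \<open>Subtracting the next power makes the induction close; \<open>9 / 8\<close> is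
    the geometric sum for ratio \<open>1 / 9\<close>.\<close>
  have "(\<Sum>j=k..<k + m. \<mu> ^ j) \<le> 9 / 8 * (\<mu> ^ k - \<mu> ^ (k + m))" for m
  proof (induction m)
    case (Suc m)
    have "9 * \<mu> * \<mu> ^ (k + m) \<le> 1 * \<mu> ^ (k + m)"
      using mu_le mu_pos by (intro mult_right_mono) auto
    then show ?case using Suc by simp
  qed simp
  also have "9 / 8 * (\<mu> ^ k - \<mu> ^ (k + m)) \<le> 9 / 8 * \<mu> ^ k" for m
    using mu_pos by (intro mult_left_mono) auto
  finally have "(\<Sum>j=k..<k + (Suc n - k). \<mu> ^ j) \<le> 9 / 8 * \<mu> ^ k" .
  moreover have "{k..<k + (Suc n - k)} = {k..n}" by auto
  ultimately show ?thesis by simp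
qed

text \<open>The derivatives grow by a factor of at least 25, so all lower terms together are at most
  \<open>1 / 24\<close> of the next one.\<close>

lemma sum_nu_le: "(\<Sum>j<k. \<nu> ^ j) \<le> \<nu> ^ k / 24"
proof (induction k)
  case (Suc k)
  have "25 * \<nu> ^ k \<le> \<nu> * \<nu> ^ k" using nu_ge by (intro mult_right_mono) auto
  then show ?case using Suc by simp
qed simp

lemma sum_nu_le': "(\<Sum>j\<le>k. \<nu> ^ j) \<le> 25 / 24 * \<nu> ^ k"
  using sum_nu_le[of k] by (simp add: lessThan_Suc_atMost[symmetric])

lemma W_has_derivative: "(W n \<theta> has_derivative (\<lambda>h. (W' n \<theta> x *\<^sub>R e) \<bullet> h)) (at x)"
proof -
  have "((\<lambda>x. \<mu> ^ j * sin (M ^ j * (x \<bullet> e) + \<theta>)) has_derivative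
      (\<lambda>h. \<nu> ^ j * cos (M ^ j * (x \<bullet> e) + \<theta>) * (e \<bullet> h))) (at x)" for j
    by (auto intro!: derivative_eq_intros simp: nu_power inner_commute)
  then have "(W n \<theta> has_derivative (\<lambda>h. \<Sum>j\<le>n. \<nu> ^ j * cos (M ^ j * (x \<bullet> e) + \<theta>) * (e \<bullet> h))) (at x)"
    unfolding W_def[abs_def] by (intro has_derivative_sum)
  then show ?thesis
    by (rule has_derivative_eq_rhs) (simp add: W'_def sum_distrib_right)
qed

lemma continuous_on_W': "continuous_on UNIV (W' n \<theta>)"
  unfolding W'_def[abs_def] by (intro continuous_intros)

lemma continuous_on_W: "continuous_on UNIV (W n \<theta>)"
  unfolding W_def[abs_def] by (intro continuous_intros)

lemma W_bound: "\<bar>W n \<theta> x\<bar> \<le> 4"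
proof -
  have "\<bar>W n \<theta> x\<bar> \<le> (\<Sum>j\<le>n. \<bar>\<mu> ^ j * sin (M ^ j * (x \<bullet> e) + \<theta>)\<bar>)"
    unfolding W_def by (rule sum_abs)
  also have "\<dots> \<le> (\<Sum>j=0..n. \<mu> ^ j)"
    unfolding atMost_atLeast0 using mu_pos by (intro sum_mono) (simp add: abs_mult mult_le_cancel_left1)
  also have "\<dots> \<le> 9 / 8" using sum_mu_le[of 0 n] by simp
  finally show ?thesis by simp
qed

lemma W'_bound: "\<bar>W' n \<theta> x\<bar> \<le> 4 * \<nu> ^ n"
proof -
  have "\<bar>W' n \<theta> x\<bar> \<le> (\<Sum>j\<le>n. \<bar>\<nu> ^ j * cos (M ^ j * (x \<bullet> e) + \<theta>)\<bar>)"
    unfolding W'_def by (rule sum_abs)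
  also have "\<dots> \<le> (\<Sum>j\<le>n. \<nu> ^ j)"
    using nu_ge by (intro sum_mono) (simp add: abs_mult mult_le_cancel_left1)
  also have "\<dots> \<le> 25 / 24 * \<nu> ^ n" by (rule sum_nu_le')
  also have "\<dots> \<le> 4 * \<nu> ^ n" using nu_ge by (intro mult_right_mono) auto
  finally show ?thesis .
qed

lemma term_diff_le:
  "\<bar>\<mu> ^ j * sin (M ^ j * (x \<bullet> e) + \<theta>) - \<mu> ^ j * sin (M ^ j * (y \<bullet> e) + \<theta>)\<bar> \<le> 2 * \<mu> ^ j"
  "\<bar>\<mu> ^ j * sin (M ^ j * (x \<bullet> e) + \<theta>) - \<mu> ^ j * sin (M ^ j * (y \<bullet> e) + \<theta>)\<bar> \<le> \<nu> ^ j * norm (x - y)"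
proof -
  let ?d = "sin (M ^ j * (x \<bullet> e) + \<theta>) - sin (M ^ j * (y \<bullet> e) + \<theta>)"
  have eq: "\<bar>\<mu> ^ j * sin (M ^ j * (x \<bullet> e) + \<theta>) - \<mu> ^ j * sin (M ^ j * (y \<bullet> e) + \<theta>)\<bar> = \<mu> ^ j * \<bar>?d\<bar>"
    using mu_pos by (simp add: right_diff_distrib[symmetric] abs_mult)
  have "\<bar>?d\<bar> \<le> 2"
    using sin_le_one[of "M ^ j * (x \<bullet> e) + \<theta>"] sin_ge_minus_one[of "M ^ j * (x \<bullet> e) + \<theta>"]
      sin_le_one[of "M ^ j * (y \<bullet> e) + \<theta>"] sin_ge_minus_one[of "M ^ j * (y \<bullet> e) + \<theta>"] by linarith
  then have "\<mu> ^ j * \<bar>?d\<bar> \<le> \<mu> ^ j * 2" using mu_pos by (intro mult_left_mono) auto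
  then show "\<bar>\<mu> ^ j * sin (M ^ j * (x \<bullet> e) + \<theta>) - \<mu> ^ j * sin (M ^ j * (y \<bullet> e) + \<theta>)\<bar> \<le> 2 * \<mu> ^ j"
    unfolding eq by simp
  have "\<bar>?d\<bar> \<le> \<bar>M ^ j * ((x - y) \<bullet> e)\<bar>"
    using abs_sin_diff_le[of "M ^ j * (x \<bullet> e) + \<theta>" "M ^ j * (y \<bullet> e) + \<theta>"]
    by (simp add: inner_diff_left right_diff_distrib)
  also have "\<dots> \<le> M ^ j * norm (x - y)"
    using M_pos Basis_le_norm[OF e, of "x - y"] by (simp add: abs_mult)
  finally have "\<mu> ^ j * \<bar>?d\<bar> \<le> \<mu> ^ j * (M ^ j * norm (x - y))" using mu_pos by (intro mult_left_mono) auto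
  then show "\<bar>\<mu> ^ j * sin (M ^ j * (x \<bullet> e) + \<theta>) - \<mu> ^ j * sin (M ^ j * (y \<bullet> e) + \<theta>)\<bar> \<le> \<nu> ^ j * norm (x - y)"
    unfolding eq nu_power by (simp only: mult.assoc)
qed

lemma W_diff_eq:
  "W n \<theta> x - W n \<theta> y = (\<Sum>j\<le>n. \<mu> ^ j * sin (M ^ j * (x \<bullet> e) + \<theta>) - \<mu> ^ j * sin (M ^ j * (y \<bullet> e) + \<theta>))"
  by (simp add: W_def sum_subtractf)

text \<open>Terms of frequency below \<open>1 / norm (x - y)\<close> are estimated by their derivative, the others by their size.\<close>

lemma W_hoelder: "\<bar>W n \<theta> x - W n \<theta> y\<bar> \<le> 4 * norm (x - y) powr s"
proof (cases "x = y")
  case False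
  define d where "d = norm (x - y)"
  have d: "0 < d" using False by (simp add: d_def)
  obtain k0 where "1 / d < M ^ k0" using M_ge real_arch_pow[of M] by auto
  then have "\<exists>k. 1 < M ^ k * d" using d by (auto simp: field_simps)
  then obtain k where k: "1 < M ^ k * d" "\<And>j. j < k \<Longrightarrow> M ^ j * d \<le> 1"
    using exists_least_iff[of "\<lambda>k. 1 < M ^ k * d"] by (meson not_less)
  let ?t = "\<lambda>j. \<bar>\<mu> ^ j * sin (M ^ j * (x \<bullet> e) + \<theta>) - \<mu> ^ j * sin (M ^ j * (y \<bullet> e) + \<theta>)\<bar>"
  have "\<bar>W n \<theta> x - W n \<theta> y\<bar> \<le> (\<Sum>j\<le>n. ?t j)"
    unfolding W_diff_eq by (rule sum_abs)
  also have "\<dots> = (\<Sum>j\<in>{..n} \<inter> {..<k}. ?t j) + (\<Sum>j\<in>{..n} - {..<k}. ?t j)"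
    by (rule sum.Int_Diff) simp
  also have "\<dots> \<le> (\<Sum>j<k. \<nu> ^ j * d) + (\<Sum>j=k..n. 2 * \<mu> ^ j)"
  proof (rule add_mono)
    have "(\<Sum>j\<in>{..n} \<inter> {..<k}. ?t j) \<le> (\<Sum>j\<in>{..n} \<inter> {..<k}. \<nu> ^ j * d)"
      unfolding d_def by (intro sum_mono term_diff_le)
    also have "\<dots> \<le> (\<Sum>j<k. \<nu> ^ j * d)" using d nu_ge by (intro sum_mono2) auto
    finally show "(\<Sum>j\<in>{..n} \<inter> {..<k}. ?t j) \<le> (\<Sum>j<k. \<nu> ^ j * d)" .
    have "{..n} - {..<k} = {k..n}" by auto
    then show "(\<Sum>j\<in>{..n} - {..<k}. ?t j) \<le> (\<Sum>j=k..n. 2 * \<mu> ^ j)"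
      using term_diff_le(1) by (auto intro: sum_mono)
  qed
  \<comment> \<open>Only the term just below \<open>k\<close> matters: \<open>\<nu> ^ i * d\<close>
    equals \<open>(M ^ i * d) powr (1 - s) * d powr s\<close> with \<open>M ^ i * d \<le> 1\<close>.
    Together with the tail this gives \<open>25 / 24 + 9 / 4\<close>, which is below 4.\<close>
  also have "(\<Sum>j<k. \<nu> ^ j * d) \<le> 25 / 24 * d powr s"
  proof (cases k)
    case (Suc i)
    have "(\<Sum>j<k. \<nu> ^ j * d) = (\<Sum>j\<le>i. \<nu> ^ j) * d"
      by (simp add: Suc sum_distrib_right lessThan_Suc_atMost)
    also have "\<dots> \<le> (25 / 24 * \<nu> ^ i) * d" using sum_nu_le' d by (intro mult_right_mono) auto
    also have "\<dots> = 25 / 24 * ((M ^ i * d) powr (1 - s) * d powr s)"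
      using d M_pos by (simp add: nu_power_powr powr_mult mult.assoc powr_add[symmetric])
    also have "\<dots> \<le> 25 / 24 * (1 * d powr s)"
      using k(2)[of i] Suc d M_pos s by (intro mult_left_mono mult_right_mono powr_le1) auto
    finally show ?thesis by simp
  qed simp
  also have "(\<Sum>j=k..n. 2 * \<mu> ^ j) \<le> 9 / 4 * d powr s"
  proof -
    have "1 \<le> (M ^ k * d) powr s" using k(1) s by (intro ge_one_powr_ge_zero) auto
    then have "\<mu> ^ k \<le> d powr s"
      using d M_pos unfolding mu_power by (simp add: powr_mult powr_minus field_simps)
    moreover have "(\<Sum>j=k..n. 2 * \<mu> ^ j) \<le> 2 * (9 / 8 * \<mu> ^ k)"
      using sum_mu_le[of k n] by (simp add: sum_distrib_left[symmetric])
    ultimately show ?thesis by simp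
  qed
  finally have "\<bar>W n \<theta> x - W n \<theta> y\<bar> \<le> 25 / 24 * d powr s + 9 / 4 * d powr s" by simp
  moreover have "0 \<le> d powr s" by simp
  ultimately show ?thesis unfolding d_def[symmetric] by linarith
qed simp

text \<open>
  At distance \<open>\<pi> / M ^ k\<close> in direction \<open>e\<close> the \<open>k\<close>-th term dominates, for one of the two phases
  because \<open>(sin b - sin a)\<^sup>2 + (cos b - cos a)\<^sup>2 = 2 - 2 cos (b - a)\<close>.
\<close>

lemma W_diff_ge:
  assumes "k \<le> n" and h: "norm (y - x - (pi / M ^ k) *\<^sub>R e) < 1 / M ^ k"
  shows "\<exists>\<theta>\<in>{0, pi / 2}. \<mu> ^ k / 2 \<le> \<bar>W n \<theta> y - W n \<theta> x\<bar>"
    and "norm (y - x) \<le> 6 / M ^ k"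
proof -
  have Mk: "0 < M ^ k" using M_pos by simp
  have ne: "norm ((pi / M ^ k) *\<^sub>R e) = pi / M ^ k" using e Mk by simp
  have "norm (y - x) \<le> norm (y - x - (pi / M ^ k) *\<^sub>R e) + norm ((pi / M ^ k) *\<^sub>R e)"
    using norm_triangle_ineq[of "y - x - (pi / M ^ k) *\<^sub>R e" "(pi / M ^ k) *\<^sub>R e"] by simp
  also have "\<dots> \<le> 1 / M ^ k + pi / M ^ k" using h ne by simp
  also have "\<dots> \<le> 6 / M ^ k"
    unfolding add_divide_distrib[symmetric] using pi_less_4 Mk by (intro divide_right_mono) auto
  finally show 6: "norm (y - x) \<le> 6 / M ^ k" .
  define \<alpha> where "\<alpha> = M ^ k * (x \<bullet> e)"
  define \<beta> where "\<beta> = M ^ k * (y \<bullet> e)"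
  have cos: "cos (\<beta> - \<alpha>) \<le> 0"
  proof -
    have "\<bar>(y - x - (pi / M ^ k) *\<^sub>R e) \<bullet> e\<bar> \<le> 1 / M ^ k"
      using Basis_le_norm[OF e, of "y - x - (pi / M ^ k) *\<^sub>R e"] h by linarith
    then have "M ^ k * \<bar>(y - x - (pi / M ^ k) *\<^sub>R e) \<bullet> e\<bar> \<le> M ^ k * (1 / M ^ k)"
      using Mk by (intro mult_left_mono) auto
    moreover have "M ^ k * \<bar>(y - x - (pi / M ^ k) *\<^sub>R e) \<bullet> e\<bar> = \<bar>\<beta> - \<alpha> - pi\<bar>"
    proof -
      have "\<beta> - \<alpha> - pi = M ^ k * ((y - x - (pi / M ^ k) *\<^sub>R e) \<bullet> e)"
        using e M_pos by (simp add: \<alpha>_def \<beta>_def inner_diff_left right_diff_distrib)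
      then show ?thesis using Mk by (simp add: abs_mult)
    qed
    ultimately have "\<bar>\<beta> - \<alpha> - pi\<bar> \<le> 1" using M_pos by simp
    \<comment> \<open>The deviation from \<open>pi\<close> is at most 1, hence below
      \<open>pi / 2\<close>.\<close>
    then have "0 \<le> cos (\<beta> - \<alpha> - pi)" using pi_gt3 by (intro cos_ge_zero) linarith+
    then show ?thesis by (simp add: cos_diff)
  qed
  have "(sin \<beta> - sin \<alpha>)\<^sup>2 + (cos \<beta> - cos \<alpha>)\<^sup>2 = 2 - 2 * cos (\<beta> - \<alpha>)"
    using sin_cos_squared_add[of \<alpha>] sin_cos_squared_add[of \<beta>]
    by (simp add: cos_diff power2_eq_square algebra_simps)
  \<comment> \<open>The two squares sum to at least 2.\<close>
  then have "1 \<le> (sin \<beta> - sin \<alpha>)\<^sup>2 \<or> 1 \<le> (cos \<beta> - cos \<alpha>)\<^sup>2" using cos by linarith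
  then have "1 \<le> \<bar>sin \<beta> - sin \<alpha>\<bar> \<or> 1 \<le> \<bar>cos \<beta> - cos \<alpha>\<bar>"
    using abs_le_square_iff[of 1] by auto
  moreover have "cos t = sin (t + pi / 2)" for t :: real by (simp add: sin_add)
  ultimately have "1 \<le> \<bar>sin (\<beta> + 0) - sin (\<alpha> + 0)\<bar> \<or> 1 \<le> \<bar>sin (\<beta> + pi / 2) - sin (\<alpha> + pi / 2)\<bar>" by simp
  then obtain \<theta> where \<theta>: "\<theta> \<in> {0, pi / 2}" "1 \<le> \<bar>sin (\<beta> + \<theta>) - sin (\<alpha> + \<theta>)\<bar>" by blast
  let ?t = "\<lambda>j. \<mu> ^ j * sin (M ^ j * (y \<bullet> e) + \<theta>) - \<mu> ^ j * sin (M ^ j * (x \<bullet> e) + \<theta>)"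
  have tk: "\<mu> ^ k \<le> \<bar>?t k\<bar>"
  proof -
    have "\<mu> ^ k * 1 \<le> \<mu> ^ k * \<bar>sin (\<beta> + \<theta>) - sin (\<alpha> + \<theta>)\<bar>"
      using \<theta>(2) mu_pos by (intro mult_left_mono) auto
    also have "\<dots> = \<bar>?t k\<bar>"
      using mu_pos by (simp add: \<alpha>_def \<beta>_def right_diff_distrib[symmetric] abs_mult)
    finally show ?thesis by simp
  qed
  have "\<bar>\<Sum>j\<in>{..n} - {k}. ?t j\<bar> \<le> (\<Sum>j\<in>{..<k} \<union> {Suc k..n}. \<bar>?t j\<bar>)"
  proof -
    have "{..n} - {k} = {..<k} \<union> {Suc k..n}" using assms(1) by auto
    then show ?thesis using sum_abs[of ?t] by simp
  qed
  also have "\<dots> = (\<Sum>j<k. \<bar>?t j\<bar>) + (\<Sum>j=Suc k..n. \<bar>?t j\<bar>)"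
    by (rule sum.union_disjoint) auto
  also have "\<dots> \<le> (\<Sum>j<k. \<nu> ^ j * (6 / M ^ k)) + (\<Sum>j=Suc k..n. 2 * \<mu> ^ j)"
  proof (intro add_mono sum_mono)
    fix j
    have "\<nu> ^ j * norm (y - x) \<le> \<nu> ^ j * (6 / M ^ k)" using 6 nu_ge by (intro mult_left_mono) auto
    then show "\<bar>?t j\<bar> \<le> \<nu> ^ j * (6 / M ^ k)" using term_diff_le(2)[of j y \<theta> x] by linarith
  qed (rule term_diff_le)
  also have "\<dots> \<le> \<mu> ^ k / 4 + \<mu> ^ k / 4"
  proof (rule add_mono)
    have "(\<Sum>j<k. \<nu> ^ j * (6 / M ^ k)) = (\<Sum>j<k. \<nu> ^ j) * (6 / M ^ k)" by (simp only: sum_distrib_right)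
    also have "\<dots> \<le> \<nu> ^ k / 24 * (6 / M ^ k)" using sum_nu_le Mk by (intro mult_right_mono) auto
    also have "\<dots> = \<mu> ^ k / 4" using M_pos by (simp add: nu_power)
    finally show "(\<Sum>j<k. \<nu> ^ j * (6 / M ^ k)) \<le> \<mu> ^ k / 4" .
    have "(\<Sum>j=Suc k..n. 2 * \<mu> ^ j) \<le> 2 * (9 / 8 * \<mu> ^ Suc k)"
      using sum_mu_le[of "Suc k" n] by (simp only: sum_distrib_left[symmetric])
    also have "\<dots> = 9 / 4 * \<mu> * \<mu> ^ k" by simp
    also have "\<dots> \<le> 9 / 4 * (1 / 9) * \<mu> ^ k" using mu_le mu_pos by (intro mult_right_mono) auto
    finally show "(\<Sum>j=Suc k..n. 2 * \<mu> ^ j) \<le> \<mu> ^ k / 4" by simp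
  qed
  finally have rest: "\<bar>\<Sum>j\<in>{..n} - {k}. ?t j\<bar> \<le> \<mu> ^ k / 2" by simp
  have "W n \<theta> y - W n \<theta> x = ?t k + (\<Sum>j\<in>{..n} - {k}. ?t j)"
    unfolding W_diff_eq using assms(1) by (intro sum.remove) auto
  then have "\<mu> ^ k / 2 \<le> \<bar>W n \<theta> y - W n \<theta> x\<bar>" using tk rest by linarith
  then show "\<exists>\<theta>\<in>{0, pi / 2}. \<mu> ^ k / 2 \<le> \<bar>W n \<theta> y - W n \<theta> x\<bar>" using \<theta>(1) by blast
qed

section \<open>Norms of the lacunary sums\<close>

lemma W_upper:
  assumes p: "1 \<le> p" and \<Omega>: "open \<Omega>" "bounded \<Omega>"
  shows "\<exists>K>0. \<forall>n \<theta>. W n \<theta> \<in> sobolev_space s (ereal p) \<Omega> \<and>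
     sobolev_norm s (ereal p) \<Omega> (W n \<theta>) \<le> ennreal ((K * (1 + real n)) powr (1 / p))"
proof -
  obtain K where K: "0 < K" "\<And>u G A L S v. (\<forall>x. (u has_derivative (\<lambda>h. G x \<bullet> h)) (at x)) \<Longrightarrow>
     continuous_on UNIV G \<Longrightarrow> 0 \<le> A \<Longrightarrow> (\<forall>x. \<bar>u x\<bar> \<le> A) \<Longrightarrow>
     (\<forall>x y. \<bar>u x - u y\<bar> \<le> A * norm (x - y) powr s) \<Longrightarrow>
     (\<forall>x. norm (G x) \<le> A * (2 ^ L) powr (1 - s)) \<Longrightarrow>
     S \<in> sets borel \<Longrightarrow> (\<forall>x\<in>\<Omega> - S. u x = 0 \<and> G x = 0) \<Longrightarrow>
     0 \<le> v \<Longrightarrow> emeasure lborel S = ennreal v \<Longrightarrow>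
     u \<in> sobolev_space s (ereal p) \<Omega> \<and>
     sobolev_norm s (ereal p) \<Omega> u \<le> ennreal ((K * A powr p * (1 + real L) * v) powr (1 / p))"
    using sobolev_norm_upper[OF s(1) less_imp_le[OF s(2)] p \<Omega>] by blast
  define v where "v = measure lborel \<Omega>"
  have v: "0 \<le> v" "emeasure lborel \<Omega> = ennreal v"
    using emeasure_bounded_finite[OF \<Omega>(2)] by (auto simp: v_def emeasure_eq_ennreal_measure)
  let ?K = "K * 4 powr p * (1 + real b) * (v + 1)"
  have "W n \<theta> \<in> sobolev_space s (ereal p) \<Omega> \<and>
     sobolev_norm s (ereal p) \<Omega> (W n \<theta>) \<le> ennreal ((?K * (1 + real n)) powr (1 / p))" for n \<theta>
  proof -
    have *: "W n \<theta> \<in> sobolev_space s (ereal p) \<Omega> \<and>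
     sobolev_norm s (ereal p) \<Omega> (W n \<theta>) \<le> ennreal ((K * 4 powr p * (1 + real (b * n)) * v) powr (1 / p))"
    \<comment> \<open>The cut-off scale is that of the highest frequency, \<open>L = b * n\<close>,
      and nothing is gained from the support, so \<open>S = \<Omega>\<close>.\<close>
    proof (rule K(2)[where G="\<lambda>x. W' n \<theta> x *\<^sub>R e" and S=\<Omega>])
      show "continuous_on UNIV (\<lambda>x. W' n \<theta> x *\<^sub>R e)"
        by (intro continuous_on_scaleR continuous_on_W' continuous_on_const)
      have "(2 ^ (b * n)) powr (1 - s) = \<nu> ^ n"
        unfolding nu_power_powr M_def power_mult ..
      then show "\<forall>x. norm (W' n \<theta> x *\<^sub>R e) \<le> 4 * (2 ^ (b * n)) powr (1 - s)"
        using W'_bound e by simp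
    qed (use W_has_derivative W_bound W_hoelder \<Omega> v in auto)
    have "(1 + real (b * n)) * v \<le> ((1 + real b) * (1 + real n)) * (v + 1)"
      using v by (intro mult_mono) (auto simp: algebra_simps)
    then have "(K * 4 powr p) * ((1 + real (b * n)) * v) \<le> (K * 4 powr p) * (((1 + real b) * (1 + real n)) * (v + 1))"
      using K(1) by (intro mult_left_mono) auto
    then have "K * 4 powr p * (1 + real (b * n)) * v \<le> ?K * (1 + real n)"
      by (simp only: mult_ac)
    then have "(K * 4 powr p * (1 + real (b * n)) * v) powr (1 / p) \<le> (?K * (1 + real n)) powr (1 / p)"
      using K v p by (intro powr_mono2) auto
    then show ?thesis using * by (meson ennreal_leI order_trans)
  qed
  then show ?thesis using K v by (intro exI[of _ ?K]) auto
qed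

lemma W_upper_infinity:
  "W n \<theta> \<in> sobolev_space s \<infinity> \<Omega>" "sobolev_norm s \<infinity> \<Omega> (W n \<theta>) \<le> ennreal 8"
  using sobolev_norm_infinity_upper[OF s(1) continuous_on_W W_bound W_hoelder] by auto

lemma W_lower_infinity:
  assumes \<Omega>: "open \<Omega>" and s': "0 < s'" and sub: "ball z R \<subseteq> \<Omega>" and n: "6 / M ^ n < R"
  shows "\<exists>\<theta>\<in>{0, pi / 2}. ennreal (1 / 2 / 6 powr s' * (M ^ n) powr (s' - s)) \<le> sobolev_norm s' \<infinity> \<Omega> (W n \<theta>)"
proof -
  let ?y = "z + (pi / M ^ n) *\<^sub>R e"
  have Mn: "0 < M ^ n" using M_pos by simp
  have ne: "norm (?y - z - (pi / M ^ n) *\<^sub>R e) < 1 / M ^ n" using Mn by simp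
  obtain \<theta> where \<theta>: "\<theta> \<in> {0, pi / 2}" "\<mu> ^ n / 2 \<le> \<bar>W n \<theta> ?y - W n \<theta> z\<bar>"
    using W_diff_ge(1)[OF order_refl ne] by blast
  have d: "norm (?y - z) \<le> 6 / M ^ n" by (rule W_diff_ge(2)[OF order_refl ne])
  have R: "0 < R" using n divide_pos_pos[of 6 "M ^ n"] Mn by linarith
  have in_\<Omega>: "z \<in> \<Omega>" "?y \<in> \<Omega>"
    using sub d n R by (auto simp: subset_iff dist_norm norm_minus_commute)
  have zy: "?y \<noteq> z" using M_pos e by auto
  have "1 / 2 / 6 powr s' * (M ^ n) powr (s' - s) = (\<mu> ^ n / 2) / (6 / M ^ n) powr s'"
    using Mn by (simp add: mu_power powr_divide powr_diff powr_minus field_simps)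
  also have "\<dots> \<le> \<bar>W n \<theta> ?y - W n \<theta> z\<bar> / norm (?y - z) powr s'"
    using \<theta>(2) d zy s' by (intro frac_le powr_mono2) auto
  finally have "ennreal (1 / 2 / 6 powr s' * (M ^ n) powr (s' - s)) \<le> sobolev_seminorm s' \<infinity> \<Omega> (W n \<theta>)"
    using sobolev_seminorm_infinity_ge[OF \<Omega> continuous_on_W in_\<Omega>(2,1) zy s'] by (meson ennreal_leI order_trans)
  also have "\<dots> \<le> sobolev_norm s' \<infinity> \<Omega> (W n \<theta>)"
    using s' by (intro sobolev_seminorm_le_norm) auto
  finally show ?thesis using \<theta>(1) by blast
qed

text \<open>The good phase depends on the pair of points, so the bound is proved for the sum of the
  two integrands; one of the two integrals is then at least half. \<open>J\<close> selects the
  scales that are kept, and \<open>k0\<close> makes the paired points stay inside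
  \<open>ball z (2 * R)\<close>.\<close>

lemma W_lower_gagliardo:
  assumes \<Omega>: "open \<Omega>" and R: "0 < R" "ball z (2 * R) \<subseteq> \<Omega>" "6 / M ^ k0 \<le> R"
    and s': "0 < s'" "s' < 1" and q: "1 \<le> q"
  shows "\<exists>c>0. \<forall>n J. J \<subseteq> {k0..n} \<longrightarrow> (\<exists>\<theta>\<in>{0, pi / 2}.
     ennreal ((c * (\<Sum>k\<in>J. (M ^ k) powr ((s' - s) * q))) powr (1 / q)) \<le> sobolev_norm s' (ereal q) \<Omega> (W n \<theta>))"
proof -
  let ?N = "DIM('a)" and ?w = "unit_ball_vol (real DIM('a))"
  let ?E = "real ?N + s' * q"
  let ?c = "gagliardo_const ?N s' q"
  have c: "0 < ?c" using s' q by (intro gagliardo_const_pos) (auto simp: Suc_le_eq)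
  define \<kappa> where "\<kappa> = (1 / 2) powr q * (1 / 6) powr ?E"
  \<comment> \<open>The division by 2 pays for the choice of the phase.\<close>
  define c1 where "c1 = ?w\<^sup>2 * R ^ ?N * \<kappa> / 2"
  have w: "0 < ?w" by simp
  have c1: "0 < c1" unfolding c1_def \<kappa>_def using w R by (intro divide_pos_pos mult_pos_pos zero_less_power) auto
  have "\<exists>\<theta>\<in>{0, pi / 2}. ennreal ((?c * c1 * (\<Sum>k\<in>J. (M ^ k) powr ((s' - s) * q))) powr (1 / q)) \<le> sobolev_norm s' (ereal q) \<Omega> (W n \<theta>)"
    if J: "J \<subseteq> {k0..n}" for n J
  proof -
    have finJ: "finite J" using J finite_subset by blast
    define m where "m k = (\<mu> ^ k / 2) powr q / (6 / M ^ k) powr ?E" for k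
    have m_eq: "m k * (1 / M ^ k) ^ ?N = \<kappa> * (M ^ k) powr ((s' - s) * q)" for k
    proof -
      have Mk: "0 < M ^ k" using M_pos by simp
      have "(\<mu> ^ k / 2) powr q = (M ^ k) powr (- s * q) * (1 / 2) powr q"
        using Mk by (simp add: mu_power powr_divide powr_powr)
      moreover have "1 / (6 / M ^ k) powr ?E = (1 / 6) powr ?E * (M ^ k) powr ?E"
        using Mk by (simp add: powr_divide)
      moreover have "(1 / M ^ k) ^ ?N = (M ^ k) powr - real ?N"
        using power_inverse_scale[OF Mk, of 1 ?N] by simp
      moreover have "m k = (\<mu> ^ k / 2) powr q * (1 / (6 / M ^ k) powr ?E)" by (simp add: m_def)
      moreover have "(M ^ k) powr ((s' - s) * q) = (M ^ k) powr (- s * q) * (M ^ k) powr ?E * (M ^ k) powr - real ?N"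
        unfolding powr_add[symmetric] by (rule arg_cong[where f="(powr) (M ^ k)"]) (simp add: algebra_simps)
      ultimately show ?thesis unfolding \<kappa>_def by (simp only: mult_ac)
    qed
    let ?Q = "\<lambda>\<theta> w. ennreal (\<bar>W n \<theta> (fst w) - W n \<theta> (snd w)\<bar> powr q / norm (fst w - snd w) powr ?E)"
    have Qm: "?Q \<theta> \<in> borel_measurable (lebesgue_on (\<Omega> \<times> \<Omega>))" for \<theta>
    proof (intro measurable_restrict_space1 measurable_completion)
      have [measurable]: "(\<lambda>w. W n \<theta> (fst w) - W n \<theta> (snd w)) \<in> borel_measurable (borel :: ('a \<times> 'a) measure)"
        by (intro borel_measurable_continuous_onI continuous_intros continuous_on_compose2[OF continuous_on_W]) auto
      have [measurable]: "(\<lambda>w. fst w - snd w) \<in> borel_measurable (borel :: ('a \<times> 'a) measure)"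
        by (intro borel_measurable_continuous_onI continuous_intros)
      have "?Q \<theta> \<in> borel_measurable borel" by measurable
      then show "?Q \<theta> \<in> borel_measurable lborel" by simp
    qed
    let ?S = "\<Sum>k\<in>J. (M ^ k) powr ((s' - s) * q)"
    have "ennreal (?w\<^sup>2 * R ^ ?N * (\<Sum>k\<in>J. m k * (1 / M ^ k) ^ ?N))
      \<le> (\<integral>\<^sup>+w. ?Q 0 w + ?Q (pi / 2) w \<partial>lebesgue_on (\<Omega> \<times> \<Omega>))"
    proof (rule double_integral_ge[where z=z and c="\<lambda>k. (pi / M ^ k) *\<^sub>R e" and \<rho>="\<lambda>k. 1 / M ^ k"])
      show "0 \<le> m k" for k by (simp add: m_def)
      fix k x y
      assume k: "k \<in> J" and x: "x \<in> ball z R" and y: "y - x \<in> ball ((pi / M ^ k) *\<^sub>R e) (1 / M ^ k)"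
      have Mk: "0 < M ^ k" using M_pos by simp
      have kn: "k0 \<le> k" "k \<le> n" using J k by auto
      have h: "norm (y - x - (pi / M ^ k) *\<^sub>R e) < 1 / M ^ k" using y by (simp add: dist_norm norm_minus_commute)
      obtain \<theta> where \<theta>: "\<theta> \<in> {0, pi / 2}" "\<mu> ^ k / 2 \<le> \<bar>W n \<theta> y - W n \<theta> x\<bar>"
        using W_diff_ge(1)[OF kn(2) h] by blast
      have d: "norm (y - x) \<le> 6 / M ^ k" by (rule W_diff_ge(2)[OF kn(2) h])
      have "6 / M ^ k \<le> 6 / M ^ k0"
        using M_ge kn M_pos by (intro divide_left_mono power_increasing) auto
      then have "norm (y - x) \<le> R" using d R by linarith
      then have "norm (y - z) < 2 * R" "norm (x - z) < 2 * R"
        using x norm_triangle_ineq[of "y - x" "x - z"] R(1) by (auto simp: dist_norm norm_minus_commute)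
      then have "x \<in> ball z (2 * R)" "y \<in> ball z (2 * R)" by (auto simp: dist_norm norm_minus_commute)
      then show "x \<in> \<Omega> \<and> y \<in> \<Omega>" using R(2) by blast
      have xy: "x \<noteq> y"
      proof
        assume "x = y"
        then have "\<mu> ^ k / 2 \<le> 0" using \<theta>(2) by simp
        then show False using zero_less_power[OF mu_pos, of k] by simp
      qed
      have "m k \<le> \<bar>W n \<theta> x - W n \<theta> y\<bar> powr q / norm (x - y) powr ?E"
        unfolding m_def using \<theta>(2) d xy s' q mu_pos
        by (intro frac_le powr_mono2) (auto simp: norm_minus_commute abs_minus_commute)
      then have "ennreal (m k) \<le> ?Q \<theta> (x, y)" by (simp add: ennreal_leI)
      also have "\<dots> \<le> ?Q 0 (x, y) + ?Q (pi / 2) (x, y)"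
      proof -
        have "\<theta> = 0 \<or> \<theta> = pi / 2" using \<theta>(1) by blast
        then show ?thesis by (elim disjE) (simp_all only: add_increasing add_increasing2 zero_le order_refl)
      qed
      finally show "ennreal (m k) \<le> ?Q 0 (x, y) + ?Q (pi / 2) (x, y)" .
    next
      \<comment> \<open>The centres are \<open>pi * (1 / M ^ k - 1 / M ^ l)\<close> apart. Since
        \<open>pi > 3\<close> and the radius shrinks at least ninefold per scale, this exceeds the
        sum of the radii.\<close>
      have disj: "ball ((pi / M ^ k) *\<^sub>R e) (1 / M ^ k) \<inter> ball ((pi / M ^ l) *\<^sub>R e) (1 / M ^ l) = {}" if "k < l" for k l
      proof (rule disjoint_ballI)
        have Mk: "0 < M ^ k" using M_pos by simp
        have "M ^ k * 9 \<le> M ^ k * M" using M_ge Mk by (intro mult_left_mono) auto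
        also have "\<dots> = M ^ Suc k" by simp
        also have "\<dots> \<le> M ^ l" using that M_ge by (intro power_increasing) auto
        finally have "1 / M ^ l \<le> 1 / (M ^ k * 9)" using Mk by (intro divide_left_mono) auto
        then have "1 / M ^ l \<le> 1 / M ^ k / 9" by simp
        moreover have "0 \<le> 1 / M ^ k" using Mk by simp
        moreover have "t1 + t2 \<le> 3 * (t1 - t2)" if "t2 \<le> t1 / 9" "0 \<le> t1" for t1 t2 :: real
          using that by simp
        ultimately have "1 / M ^ k + 1 / M ^ l \<le> 3 * (1 / M ^ k - 1 / M ^ l)" by blast
        also have "\<dots> \<le> pi * (1 / M ^ k - 1 / M ^ l)"
        proof (rule mult_right_mono)
          have "M ^ k \<le> M ^ l" using that M_ge by (intro power_increasing) auto
          then show "0 \<le> 1 / M ^ k - 1 / M ^ l" using Mk by (simp add: divide_left_mono)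
        qed (use pi_gt3 in simp)
        also have "\<dots> \<le> \<bar>pi / M ^ k - pi / M ^ l\<bar>" by (simp add: right_diff_distrib)
        also have "\<dots> = dist ((pi / M ^ k) *\<^sub>R e) ((pi / M ^ l) *\<^sub>R e)"
          using e by (simp add: dist_norm scaleR_diff_left[symmetric] del: scaleR_diff_left)
        finally show "1 / M ^ k + 1 / M ^ l \<le> dist ((pi / M ^ k) *\<^sub>R e) ((pi / M ^ l) *\<^sub>R e)" .
      qed
      fix k l :: nat assume "k \<noteq> l"
      then show "ball ((pi / M ^ k) *\<^sub>R e) (1 / M ^ k) \<inter> ball ((pi / M ^ l) *\<^sub>R e) (1 / M ^ l) = {}"
        using disj[of k l] disj[of l k] by (cases "k < l") auto
    qed (use \<Omega> finJ R M_pos in auto)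
    also have "?w\<^sup>2 * R ^ ?N * (\<Sum>k\<in>J. m k * (1 / M ^ k) ^ ?N) = 2 * (c1 * ?S)"
      unfolding m_eq sum_distrib_left[symmetric] c1_def by simp
    also have "(\<integral>\<^sup>+w. ?Q 0 w + ?Q (pi / 2) w \<partial>lebesgue_on (\<Omega> \<times> \<Omega>))
      = (\<integral>\<^sup>+w. ?Q 0 w \<partial>lebesgue_on (\<Omega> \<times> \<Omega>)) + (\<integral>\<^sup>+w. ?Q (pi / 2) w \<partial>lebesgue_on (\<Omega> \<times> \<Omega>))"
      by (rule nn_integral_add[OF Qm Qm])
    finally have sum: "ennreal (2 * (c1 * ?S)) \<le> (\<integral>\<^sup>+w. ?Q 0 w \<partial>lebesgue_on (\<Omega> \<times> \<Omega>)) + (\<integral>\<^sup>+w. ?Q (pi / 2) w \<partial>lebesgue_on (\<Omega> \<times> \<Omega>))" .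
    have S: "0 \<le> c1 * ?S" using c1 by (intro mult_nonneg_nonneg sum_nonneg) auto
    have "\<exists>\<theta>\<in>{0, pi / 2}. ennreal (c1 * ?S) \<le> (\<integral>\<^sup>+w. ?Q \<theta> w \<partial>lebesgue_on (\<Omega> \<times> \<Omega>))"
    proof (rule ccontr)
      assume "\<not> ?thesis"
      then have "(\<integral>\<^sup>+w. ?Q 0 w \<partial>lebesgue_on (\<Omega> \<times> \<Omega>)) + (\<integral>\<^sup>+w. ?Q (pi / 2) w \<partial>lebesgue_on (\<Omega> \<times> \<Omega>)) < ennreal (c1 * ?S) + ennreal (c1 * ?S)"
        by (intro add_strict_mono) (auto simp: not_le)
      also have "\<dots> = ennreal (2 * (c1 * ?S))" using S by (simp add: ennreal_plus[symmetric] del: ennreal_plus)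
      finally show False using sum by simp
    qed
    then obtain \<theta> where \<theta>: "\<theta> \<in> {0, pi / 2}" "ennreal (c1 * ?S) \<le> (\<integral>\<^sup>+w. ?Q \<theta> w \<partial>lebesgue_on (\<Omega> \<times> \<Omega>))" by blast
    have "ennreal ((?c * (c1 * ?S)) powr (1 / q)) \<le> sobolev_norm s' (ereal q) \<Omega> (W n \<theta>)"
      by (rule gagliardo_norm_ge[OF s' q S \<theta>(2)])
    then show ?thesis using \<theta>(1) by (auto simp only: mult.assoc)
  qed
  then show ?thesis using c c1 by (intro exI[of _ "?c * c1"]) auto
qed

text \<open>The test function resonates with the top frequency: its product with \<open>W'\<close>
  contains \<open>\<nu> ^ n\<close> times a squared cosine, while all lower terms together
  contribute at most \<open>\<nu> ^ n / 24\<close>. Summed over the two phases the squared cosines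
  give 1.\<close>

lemma W_lower_weak_gradient:
  assumes \<Omega>: "open \<Omega>" and r: "0 < r" "cball z r \<subseteq> \<Omega>" and q: "1 \<le> q"
  shows "\<exists>c>0. \<forall>n. \<exists>\<theta>\<in>{0, pi / 2}. ennreal (c * (M ^ n) powr (1 - s)) \<le> sobolev_norm 1 (ereal q) \<Omega> (W n \<theta>)"
proof -
  let ?w = "unit_ball_vol (real DIM('a))"
  define v where "v = ?w * r ^ DIM('a)"
  have v: "0 < v" using r by (simp add: v_def)
  define \<psi> where "\<psi> n \<theta> x = bump z r x * cos (M ^ n * (x \<bullet> e) + \<theta>)" for n \<theta> x
  \<comment> \<open>The cosine as a shifted sine, to which \<open>Ck_sin\<close> applies.\<close>
  have psi: "\<psi> n \<theta> = (\<lambda>x. bump z r x * (1 * sin (M ^ n * (x \<bullet> e) + (\<theta> + pi / 2))))" for n \<theta>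
    by (simp add: \<psi>_def sin_add cos_add fun_eq_iff)
  have test: "test_function \<Omega> (\<psi> n \<theta>)" for n \<theta>
    unfolding psi by (rule test_function_bump_mult[OF r Ck_sin])
  have cont_bump: "continuous_on UNIV (bump z r)" using Ck_bump[of 0 z r] by simp
  have off: "bump z r x = 0" if "norm z + r < norm x" for x
  proof -
    have "norm x \<le> norm z + norm (x - z)" using norm_triangle_ineq[of z "x - z"] by simp
    then have "x \<notin> ball z r" using that by (auto simp: dist_norm norm_minus_commute)
    then show ?thesis using bump_eq_0[OF r(1), of x z] by simp
  qed
  define \<beta> where "\<beta> = (\<integral>x. bump z r x \<partial>lborel)"
  have int_bump: "integrable lborel (bump z r)" using cont_bump off by (rule integrable_compact_support)
  have \<beta>: "0 < \<beta>"
  proof -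
    have fin: "emeasure lborel (ball z (r / 2)) < \<infinity>" using emeasure_bounded_finite bounded_ball by blast
    have "0 < exp (- 2) * measure lborel (ball z (r / 2))"
      using r by (simp add: measure_def emeasure_ball)
    also have "\<dots> = (\<integral>x. exp (- 2) * indicator (ball z (r / 2)) x \<partial>lborel)" using fin by simp
    also have "\<dots> \<le> \<beta>"
      unfolding \<beta>_def
    proof (rule integral_mono[OF _ int_bump])
      show "integrable lborel (\<lambda>x. exp (- 2) * indicator (ball z (r / 2)) x :: real)"
        using fin by (intro integrable_mult_right integrable_real_indicator) auto
      show "exp (- 2) * indicator (ball z (r / 2)) x \<le> bump z r x" for x
        using bump_ge[OF r(1), of x z] bump_bounds(1)[of z r x] by (auto simp: indicator_def)
    qed
    finally show ?thesis .
  qed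
  define c1 where "c1 = (\<beta> / (8 * v)) powr (q - 1) * (\<beta> / 8)"
  have c1: "0 < c1" using \<beta> v by (simp add: c1_def)
  have "\<exists>\<theta>\<in>{0, pi / 2}. ennreal (c1 powr (1 / q) * (M ^ n) powr (1 - s)) \<le> sobolev_norm 1 (ereal q) \<Omega> (W n \<theta>)" for n
  proof -
    let ?I = "\<lambda>\<theta>. \<integral>x. (W' n \<theta> x *\<^sub>R e \<bullet> e) * \<psi> n \<theta> x \<partial>lborel"
    have int: "integrable lborel (\<lambda>x. (W' n \<theta> x *\<^sub>R e \<bullet> e) * \<psi> n \<theta> x)" for \<theta>
    proof (rule integrable_compact_support[where R="norm z + r"])
      show "continuous_on UNIV (\<lambda>x. (W' n \<theta> x *\<^sub>R e \<bullet> e) * \<psi> n \<theta> x)"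
        unfolding \<psi>_def using cont_bump continuous_on_W' by (intro continuous_intros)
    qed (simp add: \<psi>_def off)
    have nun: "0 < \<nu> ^ n" using nu_ge by simp
    have pt: "\<nu> ^ n / 2 * bump z r x
      \<le> (W' n 0 x *\<^sub>R e \<bullet> e) * \<psi> n 0 x + (W' n (pi / 2) x *\<^sub>R e \<bullet> e) * \<psi> n (pi / 2) x" for x
    proof -
      let ?cos = "\<lambda>j \<theta>. cos (M ^ j * (x \<bullet> e) + \<theta>)"
      have lb: "\<nu> ^ n * (?cos n \<theta>)\<^sup>2 - \<nu> ^ n / 24 \<le> W' n \<theta> x * ?cos n \<theta>" for \<theta>
      proof -
        have "W' n \<theta> x = \<nu> ^ n * ?cos n \<theta> + (\<Sum>j<n. \<nu> ^ j * ?cos j \<theta>)"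
          by (simp add: W'_def lessThan_Suc_atMost[symmetric])
        then have "W' n \<theta> x * ?cos n \<theta> = \<nu> ^ n * (?cos n \<theta>)\<^sup>2 + (\<Sum>j<n. \<nu> ^ j * ?cos j \<theta>) * ?cos n \<theta>"
          by (simp add: power2_eq_square algebra_simps)
        moreover have "\<bar>(\<Sum>j<n. \<nu> ^ j * ?cos j \<theta>) * ?cos n \<theta>\<bar> \<le> \<nu> ^ n / 24 * 1"
          unfolding abs_mult
        proof (rule mult_mono)
          have "\<bar>\<Sum>j<n. \<nu> ^ j * ?cos j \<theta>\<bar> \<le> (\<Sum>j<n. \<bar>\<nu> ^ j * ?cos j \<theta>\<bar>)" by (rule sum_abs)
          also have "\<dots> \<le> (\<Sum>j<n. \<nu> ^ j)"
            using nu_ge by (intro sum_mono) (simp add: abs_mult mult_le_cancel_left1)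
          finally show "\<bar>\<Sum>j<n. \<nu> ^ j * ?cos j \<theta>\<bar> \<le> \<nu> ^ n / 24" using sum_nu_le[of n] by linarith
        qed (use nun in auto)
        ultimately show ?thesis by linarith
      qed
      have "(?cos n 0)\<^sup>2 + (?cos n (pi / 2))\<^sup>2 = 1" by (simp add: cos_add)
      then have "\<nu> ^ n * (?cos n 0)\<^sup>2 + \<nu> ^ n * (?cos n (pi / 2))\<^sup>2 = \<nu> ^ n"
        by (simp only: distrib_left[symmetric] mult_1_right)
      \<comment> \<open>What remains is \<open>1 - 2 / 24\<close> of
        \<open>\<nu> ^ n\<close>.\<close>
      then have "\<nu> ^ n / 2 \<le> W' n 0 x * ?cos n 0 + W' n (pi / 2) x * ?cos n (pi / 2)"
        using lb[of 0] lb[of "pi / 2"] nun by linarith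
      from mult_right_mono[OF this bump_bounds(1)[of z r x]] show ?thesis
        using e by (simp add: \<psi>_def algebra_simps)
    qed
    have "\<nu> ^ n / 2 * \<beta> = (\<integral>x. \<nu> ^ n / 2 * bump z r x \<partial>lborel)" by (simp add: \<beta>_def)
    also have "\<dots> \<le> (\<integral>x. (W' n 0 x *\<^sub>R e \<bullet> e) * \<psi> n 0 x + (W' n (pi / 2) x *\<^sub>R e \<bullet> e) * \<psi> n (pi / 2) x \<partial>lborel)"
      by (rule integral_mono[OF integrable_mult_right[OF int_bump] Bochner_Integration.integrable_add[OF int int] pt])
    also have "\<dots> = ?I 0 + ?I (pi / 2)" using int by (intro Bochner_Integration.integral_add)
    also have "\<nu> ^ n / 2 * \<beta> = 2 * (\<nu> ^ n * \<beta> / 4)" by simp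
    finally have "2 * (\<nu> ^ n * \<beta> / 4) \<le> ?I 0 + ?I (pi / 2)" .
    moreover have "\<kappa> \<le> t \<or> \<kappa> \<le> t'" if "2 * \<kappa> \<le> t + t'" for \<kappa> t t' :: real
      using that by linarith
    ultimately have "\<nu> ^ n * \<beta> / 4 \<le> ?I 0 \<or> \<nu> ^ n * \<beta> / 4 \<le> ?I (pi / 2)" by blast
    then obtain \<theta> where \<theta>: "\<theta> \<in> {0, pi / 2}" "\<nu> ^ n * \<beta> / 4 \<le> ?I \<theta>" by blast
    \<comment> \<open>Half of the bound \<open>\<nu> ^ n / 2 * \<beta>\<close> for the two phases
      together. The truncation level grows like \<open>\<nu> ^ n\<close>, so the q-th root finally
      yields \<open>\<nu> ^ n\<close> itself.\<close>
    define \<kappa> where "\<kappa> = \<nu> ^ n * \<beta> / 4"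
    have \<kappa>: "0 < \<kappa>" "\<kappa> \<le> \<bar>?I \<theta>\<bar>" using \<theta>(2) nun \<beta> by (auto simp: \<kappa>_def)
    have "ennreal (((\<kappa> / (2 * v)) powr (q - 1) * (\<kappa> / 2)) powr (1 / q)) \<le> sobolev_norm 1 (ereal q) \<Omega> (W n \<theta>)"
    proof (rule weak_gradient_norm_ge[OF q])
      show "ennreal ((\<kappa> / (2 * v)) powr (q - 1) * (\<kappa> / 2)) \<le> (\<integral>\<^sup>+x. ennreal (norm (g x) powr q) \<partial>lebesgue_on \<Omega>)"
        if g: "weak_gradient \<Omega> (W n \<theta>) g" for g
      proof (rule weak_gradient_Lp_ge[OF \<Omega> W_has_derivative _ test e _ _ _ v _ \<kappa> q g])
        show "continuous_on UNIV (\<lambda>x. W' n \<theta> x *\<^sub>R e)"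
          by (intro continuous_on_scaleR continuous_on_W' continuous_on_const)
        show "\<bar>\<psi> n \<theta> x\<bar> \<le> 1" for x
          using bump_bounds[of z r x] by (auto simp: \<psi>_def abs_mult intro!: mult_le_one)
        show "x \<notin> ball z r \<Longrightarrow> \<psi> n \<theta> x = 0" for x using bump_eq_0[OF r(1), of x z] by (simp add: \<psi>_def)
        show "emeasure lborel (ball z r) = ennreal v" unfolding v_def using r by (intro emeasure_ball) simp
      qed auto
    qed (use \<kappa> in simp)
    moreover have "((\<kappa> / (2 * v)) powr (q - 1) * (\<kappa> / 2)) powr (1 / q) = c1 powr (1 / q) * (M ^ n) powr (1 - s)"
    proof -
      have "(\<kappa> / (2 * v)) powr (q - 1) = (\<nu> ^ n) powr (q - 1) * (\<beta> / (8 * v)) powr (q - 1)"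
        using nun \<beta> v by (simp add: \<kappa>_def powr_mult[symmetric])
      moreover have "\<kappa> / 2 = \<nu> ^ n * (\<beta> / 8)" by (simp add: \<kappa>_def)
      moreover have "(\<nu> ^ n) powr q = (\<nu> ^ n) powr (q - 1) * \<nu> ^ n"
        using nun by (simp add: powr_diff)
      ultimately have "(\<kappa> / (2 * v)) powr (q - 1) * (\<kappa> / 2) = c1 * (\<nu> ^ n) powr q"
        unfolding c1_def by (simp only: mult_ac)
      then show ?thesis using c1 q nun by (simp add: powr_mult powr_powr nu_power_powr[symmetric])
    qed
    ultimately have "ennreal (c1 powr (1 / q) * (M ^ n) powr (1 - s)) \<le> sobolev_norm 1 (ereal q) \<Omega> (W n \<theta>)"
      by simp
    then show ?thesis using \<theta>(1) by blast
  qed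
  then show ?thesis using c1 by (intro exI[of _ "c1 powr (1 / q)"]) auto
qed

end

section \<open>Failure of the embedding\<close>

lemma exponential_beats_linear:
  fixes x k A B :: real
  assumes "1 < x" "0 < k"
  shows "\<exists>n\<ge>n0. A + B * real n < k * x ^ n"
proof -
  have "norm (1 / x) < 1" using assms by simp
  then have "(\<lambda>n. A * (1 / x) ^ n + B * (real n * (1 / x) ^ n)) \<longlonglongrightarrow> A * 0 + B * 0"
    by (intro tendsto_add tendsto_mult tendsto_const LIMSEQ_power_zero powser_times_n_limit_0)
  then have "\<forall>\<^sub>F n in sequentially. A * (1 / x) ^ n + B * (real n * (1 / x) ^ n) < k"
    using assms by (intro order_tendstoD(2)) auto
  then have "\<forall>\<^sub>F n in sequentially. n0 \<le> n \<and> A * (1 / x) ^ n + B * (real n * (1 / x) ^ n) < k"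
    using eventually_ge_at_top[of n0] by eventually_elim auto
  then obtain n where n: "n0 \<le> n" "A * (1 / x) ^ n + B * (real n * (1 / x) ^ n) < k"
    by (auto simp: eventually_sequentially)
  have "(A * (1 / x) ^ n + B * (real n * (1 / x) ^ n)) * x ^ n < k * x ^ n"
    using n(2) assms by (intro mult_strict_right_mono) auto
  moreover have "(A * (1 / x) ^ n + B * (real n * (1 / x) ^ n)) * x ^ n = A + B * real n"
    using assms by (simp add: power_divide field_simps)
  ultimately show ?thesis using n(1) by auto
qed

text \<open>Replaces the root of \<open>1 + L\<close> in the upper bounds by a linear expression, to
  which \<open>exponential_beats_linear\<close> applies.\<close>

lemma powr_le_add_1:
  fixes x t :: real
  assumes "0 \<le> x" "0 \<le> t" "t \<le> 1"
  shows "x powr t \<le> 1 + x"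
proof (cases "x \<le> 1")
  case True
  then have "x powr t \<le> 1" using assms by (intro powr_le1) auto
  then show ?thesis using assms by simp
next
  case False
  then have "x powr t \<le> x powr 1" using assms by (intro powr_mono) auto
  then show ?thesis using assms by simp
qed

lemma peak_lower:
  fixes \<Omega> :: "'a::euclidean_space set"
  assumes \<Omega>: "open \<Omega>" and z: "z \<in> \<Omega>" and s: "0 < s" "s \<le> 1" and s': "0 < s'" "s' \<le> s" and p': "1 \<le> p'"
  shows "\<exists>k>0. \<exists>L0. \<forall>L\<ge>L0.
    ennreal (k * (2 ^ L) powr (s' - s - (if p' = \<infinity> then 0 else real DIM('a) / real_of_ereal p')))
      \<le> sobolev_norm s' p' \<Omega> (peak s (2 ^ L) z)"
proof -
  obtain R where R: "0 < R" "ball z R \<subseteq> \<Omega>" using \<Omega> z open_contains_ball by blast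
  obtain L0 where L0: "3 / R < 2 ^ L0" using real_arch_pow[of 2 "3 / R"] by auto
  have sub: "ball z (3 / 2 ^ L) \<subseteq> \<Omega>" if "L0 \<le> L" for L
  proof -
    have "(2::real) ^ L0 \<le> 2 ^ L" using that by simp
    then have "3 / R < 2 ^ L" using L0 by linarith
    then have "3 / 2 ^ L \<le> R" using R by (simp add: field_simps)
    then show ?thesis using R(2) subset_ball by blast
  qed
  have "\<exists>k>0. \<forall>l. 0 < l \<longrightarrow> ball z (3 / l) \<subseteq> \<Omega> \<longrightarrow>
    ennreal (k * l powr (s' - s - (if p' = \<infinity> then 0 else real DIM('a) / real_of_ereal p')))
      \<le> sobolev_norm s' p' \<Omega> (peak s l z)"
  proof (cases p')
    case (real q)
    then have q: "1 \<le> q" using p' by (simp add: one_ereal_def)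
    show ?thesis
    proof (cases "s' = 1")
      case True
      then have "s = 1" using s s' by simp
      then show ?thesis using True real peak_lower_weak_gradient[OF \<Omega> q] by auto
    next
      case False
      then show ?thesis
        using real peak_lower_gagliardo[OF \<Omega> s s'(1) _ q] s s' by auto
    qed
  next
    case PInf
    then show ?thesis using peak_lower_infinity[OF \<Omega> s'(1)] by (intro exI[of _ 1]) auto
  qed (use p' in auto)
  then show ?thesis using sub by (metis zero_less_power zero_less_numeral)
qed

text \<open>The quotient of the two norms grows at least like \<open>(2 ^ L) powr \<beta>\<close>
  divided by a root of \<open>1 + L\<close>, where \<open>\<beta> > 0\<close> is the excess of
  \<open>s' - N / p'\<close> over \<open>s - N / p\<close>.\<close>

lemma not_embedded_if_concentration:
  fixes \<Omega> :: "'a::euclidean_space set"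
  assumes \<Omega>: "open \<Omega>" "bounded \<Omega>" "\<Omega> \<noteq> {}" and s: "0 < s" "s \<le> 1" and p: "1 \<le> p"
    and s': "0 < s'" "s' \<le> s" and p': "1 \<le> p'"
    and gt: "s - real DIM('a) / p < s' - (if p' = \<infinity> then 0 else real DIM('a) / real_of_ereal p')"
  shows "\<not> continuously_embedded s (ereal p) s' p' \<Omega>"
proof (rule not_continuously_embeddedI)
  fix C :: real
  let ?e = "if p' = \<infinity> then 0 else real DIM('a) / real_of_ereal p'"
  let ?N = "real DIM('a)"
  obtain z where z: "z \<in> \<Omega>" using \<Omega> by blast
  obtain k L0 where k: "0 < k" and lower: "\<And>L. L0 \<le> L \<Longrightarrow>
    ennreal (k * (2 ^ L) powr (s' - s - ?e)) \<le> sobolev_norm s' p' \<Omega> (peak s (2 ^ L) z)"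
    using peak_lower[OF \<Omega>(1) z s s' p'] by blast
  obtain K where K: "0 < K" and upper: "\<And>L. peak s (2 ^ L) z \<in> sobolev_space s (ereal p) \<Omega> \<and>
     sobolev_norm s (ereal p) \<Omega> (peak s (2 ^ L) z) \<le> ennreal ((K * (1 + real L)) powr (1 / p) * (2 ^ L) powr - (?N / p))"
    using peak_upper[OF s p \<Omega>(1,2)] by blast
  define \<beta> where "\<beta> = s' - s - ?e + ?N / p"
  have \<beta>: "0 < \<beta>" using gt by (simp add: \<beta>_def)
  define C' where "C' = max C 0"
  have "1 < (2::real) powr \<beta>" using \<beta> by simp
  then obtain L where L: "L0 \<le> L" "C' * (1 + K) + C' * K * real L < k * (2 powr \<beta>) ^ L"
    using exponential_beats_linear k by blast
  have pow: "(2 powr \<beta>) ^ L = ((2::real) ^ L) powr \<beta>"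
    by (simp add: powr_realpow[symmetric] powr_powr mult.commute)
  have "C * (K * (1 + real L)) powr (1 / p) \<le> C' * (1 + K * (1 + real L))"
    unfolding C'_def using powr_le_add_1[of "K * (1 + real L)" "1 / p"] K p by (intro mult_mono) auto
  also have "\<dots> < k * (2 ^ L) powr \<beta>" using L(2) unfolding pow by (simp add: algebra_simps)
  finally have "C * (K * (1 + real L)) powr (1 / p) * (2 ^ L) powr - (?N / p) < k * (2 ^ L) powr \<beta> * (2 ^ L) powr - (?N / p)"
    by (intro mult_strict_right_mono) auto
  also have "\<dots> = k * (2 ^ L) powr (s' - s - ?e)"
    unfolding mult.assoc powr_add[symmetric] by (simp add: \<beta>_def)
  finally have lt: "C * ((K * (1 + real L)) powr (1 / p) * (2 ^ L) powr - (?N / p)) < k * (2 ^ L) powr (s' - s - ?e)"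
    by (simp only: mult.assoc)
  show "\<exists>u a b. u \<in> sobolev_space s (ereal p) \<Omega> \<and> sobolev_norm s (ereal p) \<Omega> u \<le> ennreal a \<and>
     ennreal b \<le> sobolev_norm s' p' \<Omega> u \<and> 0 \<le> a \<and> C * a < b"
    using upper[of L] lower[OF L(1)] lt by (blast intro: mult_nonneg_nonneg powr_ge_zero)
qed

lemma lacunary_series_exists:
  assumes "0 < s" "s < 1" "e \<in> Basis"
  shows "\<exists>b. lacunary_series s b e"
proof -
  \<comment> \<open>The exponents 4 and 5 come from \<open>1 / 2 ^ 4 \<le> 1 / 9\<close> and
    \<open>25 \<le> 2 ^ 5\<close>.\<close>
  obtain b1 :: nat where b1: "4 / s \<le> real b1" using real_arch_simple by blast
  obtain b2 :: nat where b2: "5 / (1 - s) \<le> real b2" using real_arch_simple by blast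
  define b where "b = max b1 b2"
  have pow: "((2::real) ^ b) powr t = 2 powr (real b * t)" for t
    by (simp add: powr_realpow[symmetric] powr_powr)
  have "4 / s \<le> real b" "5 / (1 - s) \<le> real b" using b1 b2 by (auto simp: b_def)
  then have b: "4 \<le> real b * s" "5 \<le> real b * (1 - s)" using assms by (simp_all add: pos_divide_le_eq)
  have "2 powr (real b * - s) \<le> 2 powr - real 4" using b(1) by (intro powr_mono) auto
  also have "\<dots> = 1 / 2 ^ 4" by (simp only: powr_minus_divide powr_realpow zero_less_numeral)
  finally have "((2::real) ^ b) powr - s \<le> 1 / 9" unfolding pow by simp
  moreover have "2 powr real 5 \<le> 2 powr (real b * (1 - s))" using b(2) by (intro powr_mono) auto
  then have "(25::real) \<le> (2 ^ b) powr (1 - s)"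
    unfolding pow powr_realpow[OF zero_less_numeral] by simp
  ultimately show ?thesis using assms by (auto simp: lacunary_series_def)
qed

context lacunary_series
begin

lemma W_lower:
  assumes \<Omega>: "open \<Omega>" and z: "z \<in> \<Omega>" and s': "s < s'" "s' \<le> 1" and p': "1 \<le> p'"
  shows "\<exists>k>0. \<exists>n0. \<forall>n\<ge>n0. \<exists>\<theta>. ennreal (k * (M ^ n) powr (s' - s)) \<le> sobolev_norm s' p' \<Omega> (W n \<theta>)"
proof -
  have s'0: "0 < s'" using s s' by simp
  obtain R0 where R0: "0 < R0" "ball z R0 \<subseteq> \<Omega>" using \<Omega> z open_contains_ball by blast
  define R where "R = R0 / 4"
  have R: "0 < R" "ball z (2 * R) \<subseteq> \<Omega>" "cball z R \<subseteq> \<Omega>" "ball z R \<subseteq> \<Omega>"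
    using R0 by (auto simp: R_def subset_iff)
  obtain n0 where "6 / R < M ^ n0" using real_arch_pow[of M "6 / R"] M_ge by auto
  then have n0: "6 / M ^ n < R" if "n0 \<le> n" for n
  proof -
    have "M ^ n0 \<le> M ^ n" using that M_ge by (intro power_increasing) auto
    then have "6 / R < M ^ n" using \<open>6 / R < M ^ n0\<close> by linarith
    then show ?thesis using R(1) zero_less_power[OF M_pos, of n] by (simp add: field_simps)
  qed
  show ?thesis
  proof (cases p')
    case (real q)
    then have q: "1 \<le> q" using p' by (simp add: one_ereal_def)
    show ?thesis
    proof (cases "s' = 1")
      case True
      obtain c where "0 < c" "\<And>n. \<exists>\<theta>\<in>{0, pi / 2}. ennreal (c * (M ^ n) powr (1 - s)) \<le> sobolev_norm 1 (ereal q) \<Omega> (W n \<theta>)"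
        using W_lower_weak_gradient[OF \<Omega> R(1,3) q] by blast
      then show ?thesis unfolding True real by blast
    next
      case False
      then have s'1: "s' < 1" using s' by simp
      obtain c where c: "0 < c" "\<And>n J. J \<subseteq> {n0..n} \<Longrightarrow> \<exists>\<theta>\<in>{0, pi / 2}.
         ennreal ((c * (\<Sum>k\<in>J. (M ^ k) powr ((s' - s) * q))) powr (1 / q)) \<le> sobolev_norm s' (ereal q) \<Omega> (W n \<theta>)"
        using W_lower_gagliardo[OF \<Omega> R(1,2) less_imp_le[OF n0[OF order_refl]] s'0 s'1 q] by blast
      have "\<exists>\<theta>. ennreal (c powr (1 / q) * (M ^ n) powr (s' - s)) \<le> sobolev_norm s' (ereal q) \<Omega> (W n \<theta>)" if "n0 \<le> n" for n
      proof -
        \<comment> \<open>For \<open>s' > s\<close> the contributions grow geometrically, so the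
          last scale alone gives the right order.\<close>
        have "(c * (\<Sum>k\<in>{n}. (M ^ k) powr ((s' - s) * q))) powr (1 / q) = c powr (1 / q) * (M ^ n) powr (s' - s)"
          using c(1) q M_pos by (simp add: powr_mult powr_powr)
        then show ?thesis using c(2)[of "{n}" n] that by auto
      qed
      then show ?thesis unfolding real using c(1) by (intro exI[of _ "c powr (1 / q)"]) auto
    qed
  next
    case PInf
    have "\<exists>\<theta>\<in>{0, pi / 2}. ennreal (1 / 2 / 6 powr s' * (M ^ n) powr (s' - s)) \<le> sobolev_norm s' \<infinity> \<Omega> (W n \<theta>)"
      if "n0 \<le> n" for n
      by (rule W_lower_infinity[OF \<Omega> s'0 R(4) n0[OF that]])
    then show ?thesis unfolding PInf by (intro exI[of _ "1 / 2 / 6 powr s'"]) (auto intro!: exI[of _ n0])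
  qed (use p' in auto)
qed

text \<open>A crude form, valid for finite and infinite \<open>p\<close>; it suffices against a
  lower bound exponential in \<open>n\<close>.\<close>

lemma W_upper_linear:
  assumes p: "1 \<le> p" and \<Omega>: "open \<Omega>" "bounded \<Omega>"
  shows "\<exists>A\<ge>0. \<exists>B\<ge>0. \<forall>n \<theta>. W n \<theta> \<in> sobolev_space s p \<Omega> \<and>
     sobolev_norm s p \<Omega> (W n \<theta>) \<le> ennreal (A + B * real n)"
proof (cases p)
  case (real r)
  then have r: "1 \<le> r" using p by (simp add: one_ereal_def)
  obtain K where K: "0 < K" "\<And>n \<theta>. W n \<theta> \<in> sobolev_space s (ereal r) \<Omega> \<and>
     sobolev_norm s (ereal r) \<Omega> (W n \<theta>) \<le> ennreal ((K * (1 + real n)) powr (1 / r))"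
    using W_upper[OF r \<Omega>] by blast
  have "ennreal ((K * (1 + real n)) powr (1 / r)) \<le> ennreal ((1 + K) + K * real n)" for n
    using powr_le_add_1[of "K * (1 + real n)" "1 / r"] K(1) r by (intro ennreal_leI) (simp add: algebra_simps)
  then show ?thesis unfolding real using K by (intro exI[of _ "1 + K"] conjI exI[of _ K]) (auto intro: order_trans)
next
  case PInf
  then show ?thesis using W_upper_infinity by (intro exI[of _ 8] conjI exI[of _ 0]) auto
qed (use p in auto)

end

lemma not_embedded_if_more_regular:
  fixes \<Omega> :: "'a::euclidean_space set"
  assumes \<Omega>: "open \<Omega>" "bounded \<Omega>" "\<Omega> \<noteq> {}" and ss': "0 < s" "s < s'" "s' \<le> 1" and p: "1 \<le> p" "1 \<le> p'"
  shows "\<not> continuously_embedded s p s' p' \<Omega>"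
proof (rule not_continuously_embeddedI)
  fix C :: real
  obtain e :: 'a where e: "e \<in> Basis" using nonempty_Basis by blast
  obtain b where "lacunary_series s b e" using lacunary_series_exists[of s e] ss' e by auto
  then interpret lacunary_series s b e .
  obtain z where z: "z \<in> \<Omega>" using \<Omega> by blast
  obtain k n0 where k: "0 < k" and lower: "\<And>n. n0 \<le> n \<Longrightarrow> \<exists>\<theta>. ennreal (k * (M ^ n) powr (s' - s)) \<le> sobolev_norm s' p' \<Omega> (W n \<theta>)"
    using W_lower[OF \<Omega>(1) z ss'(2,3) p(2)] by blast
  obtain A B where AB: "0 \<le> A" "0 \<le> B" and upper: "\<And>n \<theta>. W n \<theta> \<in> sobolev_space s p \<Omega> \<and>
     sobolev_norm s p \<Omega> (W n \<theta>) \<le> ennreal (A + B * real n)"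
    using W_upper_linear[OF p(1) \<Omega>(1,2)] by blast
  have "1 < M powr (s' - s)" using M_ge ss' by simp
  then obtain n where n: "n0 \<le> n" "C * A + C * B * real n < k * (M powr (s' - s)) ^ n"
    using exponential_beats_linear k by blast
  have "(M powr (s' - s)) ^ n = (M ^ n) powr (s' - s)"
    using M_pos by (simp add: powr_realpow[symmetric] powr_powr mult.commute)
  then have lt: "C * (A + B * real n) < k * (M ^ n) powr (s' - s)"
    using n(2) by (simp add: algebra_simps)
  obtain \<theta> where "ennreal (k * (M ^ n) powr (s' - s)) \<le> sobolev_norm s' p' \<Omega> (W n \<theta>)" using lower[OF n(1)] by blast
  then show "\<exists>u a b. u \<in> sobolev_space s p \<Omega> \<and> sobolev_norm s p \<Omega> u \<le> ennreal a \<and>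
     ennreal b \<le> sobolev_norm s' p' \<Omega> u \<and> 0 \<le> a \<and> C * a < b"
    using upper[of n \<theta>] lt AB by (meson add_nonneg_nonneg mult_nonneg_nonneg of_nat_0_le_iff)
qed

text \<open>At equal order every scale contributes the same amount, so the integrals count scales:
  \<open>t\<close> scales give \<open>t powr (1 / q)\<close> from below against
  \<open>t powr (1 / p)\<close> from above.\<close>

lemma not_embedded_if_less_integrable:
  fixes \<Omega> :: "'a::euclidean_space set"
  assumes \<Omega>: "open \<Omega>" "bounded \<Omega>" "\<Omega> \<noteq> {}" and s: "0 < s" "s < 1" and q: "1 \<le> q" "q < p"
  shows "\<not> continuously_embedded s (ereal p) s (ereal q) \<Omega>"
proof (rule not_continuously_embeddedI)
  fix C :: real
  have p: "1 \<le> p" using q by simp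
  obtain e :: 'a where e: "e \<in> Basis" using nonempty_Basis by blast
  obtain b where "lacunary_series s b e" using lacunary_series_exists[of s e] s e by auto
  then interpret lacunary_series s b e .
  obtain z where z: "z \<in> \<Omega>" using \<Omega> by blast
  obtain R0 where R0: "0 < R0" "ball z R0 \<subseteq> \<Omega>" using \<Omega> z open_contains_ball by blast
  define R where "R = R0 / 2"
  have R: "0 < R" "ball z (2 * R) \<subseteq> \<Omega>" using R0 by (auto simp: R_def)
  obtain k0 where "6 / R < M ^ k0" using real_arch_pow[of M "6 / R"] M_ge by auto
  then have k0: "6 / M ^ k0 \<le> R" using R(1) zero_less_power[OF M_pos, of k0] by (simp add: field_simps)
  obtain c where c: "0 < c" and lower: "\<And>n J. J \<subseteq> {k0..n} \<Longrightarrow> \<exists>\<theta>\<in>{0, pi / 2}.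
     ennreal ((c * (\<Sum>k\<in>J. (M ^ k) powr ((s - s) * q))) powr (1 / q)) \<le> sobolev_norm s (ereal q) \<Omega> (W n \<theta>)"
    using W_lower_gagliardo[OF \<Omega>(1) R k0 s q(1)] by blast
  obtain K where K: "0 < K" and upper: "\<And>n \<theta>. W n \<theta> \<in> sobolev_space s (ereal p) \<Omega> \<and>
     sobolev_norm s (ereal p) \<Omega> (W n \<theta>) \<le> ennreal ((K * (1 + real n)) powr (1 / p))"
    using W_upper[OF p \<Omega>(1,2)] by blast
  define \<delta> where "\<delta> = 1 / q - 1 / p"
  have \<delta>: "0 < \<delta>" using q by (simp add: \<delta>_def field_simps)
  define K' where "K' = (K * (1 + real k0)) powr (1 / p)"
  define X where "X = max C 0 * K' / c powr (1 / q)"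
  have X: "0 \<le> X" by (simp add: X_def K'_def)
  \<comment> \<open>\<open>X\<close> collects all constants; \<open>m\<close> is taken so large that
    the gain \<open>t powr \<delta>\<close> exceeds it.\<close>
  obtain m :: nat where m: "(X + 1) powr (1 / \<delta>) \<le> real m" using real_arch_simple by blast
  define t where "t = 1 + real m"
  have t: "0 < t" by (simp add: t_def)
  have "X + 1 = ((X + 1) powr (1 / \<delta>)) powr \<delta>" using \<delta> X by (simp add: powr_powr)
  also have "\<dots> \<le> t powr \<delta>" using m \<delta> by (intro powr_mono2) (auto simp: t_def)
  finally have Xt: "X < t powr \<delta>" by simp
  let ?n = "k0 + m"
  \<comment> \<open>The exponent is 0, so each summand is 1 and the sum is the number of scales from
    \<open>k0\<close> to \<open>k0 + m\<close>.\<close>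
  have "(\<Sum>k\<in>{k0..?n}. (M ^ k) powr ((s - s) * q)) = t" using M_pos by (simp add: t_def)
  then obtain \<theta> where \<theta>: "ennreal ((c * t) powr (1 / q)) \<le> sobolev_norm s (ereal q) \<Omega> (W ?n \<theta>)"
    using lower[of "{k0..?n}" ?n] by auto
  have "K * (1 + real ?n) \<le> K * ((1 + real k0) * t)"
    using K by (intro mult_left_mono) (auto simp: t_def algebra_simps)
  then have "(K * (1 + real ?n)) powr (1 / p) \<le> (K * ((1 + real k0) * t)) powr (1 / p)"
    using K p by (intro powr_mono2) auto
  also have "\<dots> = K' * t powr (1 / p)" using K t by (simp add: K'_def powr_mult mult.assoc)
  finally have "C * (K * (1 + real ?n)) powr (1 / p) \<le> max C 0 * (K' * t powr (1 / p))"
    by (intro mult_mono) auto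
  also have "\<dots> = X * c powr (1 / q) * t powr (1 / p)" using c by (simp add: X_def)
  also have "\<dots> < t powr \<delta> * c powr (1 / q) * t powr (1 / p)"
    using Xt c t by (intro mult_strict_right_mono) auto
  also have "\<dots> = (c * t) powr (1 / q)"
  proof -
    have "t powr (1 / q) = t powr \<delta> * t powr (1 / p)" unfolding powr_add[symmetric] \<delta>_def by simp
    then show ?thesis using c t by (simp add: powr_mult)
  qed
  finally have "C * (K * (1 + real ?n)) powr (1 / p) < (c * t) powr (1 / q)" .
  then show "\<exists>u a b. u \<in> sobolev_space s (ereal p) \<Omega> \<and> sobolev_norm s (ereal p) \<Omega> u \<le> ennreal a \<and>
     ennreal b \<le> sobolev_norm s (ereal q) \<Omega> u \<and> 0 \<le> a \<and> C * a < b"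
    using upper[of ?n \<theta>] \<theta> by (meson powr_ge_zero)
qed

theorem proposition2p15:
  fixes \<Omega> :: "'a::euclidean_space set"
    and s s' :: real and p p' :: ereal and N :: nat
  assumes N: "N = DIM('a)"
    and s: "0 < s" "s \<le> 1"
    and p: "1 \<le> p"
    and sp: "ereal s * p > ereal (real N)"
    and Omega: "open \<Omega>" "bounded \<Omega>" "connected \<Omega>" "\<Omega> \<noteq> {}" "lipschitz_boundary \<Omega>"
    and s': "0 \<le> s'" "s' \<le> 1"
    and p': "1 \<le> p'"
    and nontrivial: "(s', p') \<noteq> (s, p)"
      "\<not> (s' = 1 \<and> s = 1 \<and> 1 \<le> p' \<and> p' \<le> p)"
    and not_range:
      "\<not> ((0 \<le> s' \<and> ereal s' \<le> ereal s - ereal (real N) / p \<and> 1 \<le> p' \<and> p' \<le> \<infinity>) \<or>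
          (ereal s - ereal (real N) / p < ereal s' \<and> s' < s \<and>
           1 \<le> p' \<and> p' \<le> ereal (real N) * p / (ereal (real N) - ereal (s - s') * p)))"
  shows "\<not> continuously_embedded s p s' p' \<Omega>"
proof (cases "s < s'")
  case True
  then show ?thesis using not_embedded_if_more_regular[OF Omega(1,2,4) s(1) True s'(2) p p'] by simp
next
  case False
  then have s's: "s' \<le> s" by simp
  have range1: "\<not> ereal s' \<le> ereal s - ereal (real N) / p" using not_range s' p' by auto
  \<comment> \<open>For \<open>p = \<infinity>\<close> the first alternative would read
    \<open>s' \<le> s\<close>, which holds in this branch; so \<open>p\<close> is finite.\<close>
  obtain r where r: "p = ereal r" "1 \<le> r"
  proof (cases p)
    case PInf
    then show ?thesis using range1 s's by simp
  qed (use p in \<open>auto simp: one_ereal_def\<close>)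
  have N1: "1 \<le> real N" using N by (simp add: Suc_le_eq)
  have \<sigma>: "s - real N / r < s'" using range1 r by simp
  have "real N < s * r" using sp r by simp
  then have "real N / r < s" using r by (simp add: pos_divide_less_eq)
  \<comment> \<open>This is where \<open>s * p > N\<close> enters: failing the first alternative
    forces a positive order \<open>s'\<close>.\<close>
  then have s'0: "0 < s'" using \<sigma> by simp
  show ?thesis
  proof (cases "s' = s \<and> p' < p")
    case True
    \<comment> \<open>\<open>s = s' = 1\<close> with \<open>p' < p\<close> is one of the trivial
      cases set aside.\<close>
    then have s1: "s < 1" using nontrivial(2) s p' by auto
    obtain q where q: "p' = ereal q" "1 \<le> q"
      using True p' r by (cases p') (auto simp: one_ereal_def)
    then show ?thesis
      using not_embedded_if_less_integrable[OF Omega(1,2,4) s(1) s1, of q r] True r by simp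
  next
    case no: False
    have "s - real DIM('a) / r < s' - (if p' = \<infinity> then 0 else real DIM('a) / real_of_ereal p')"
    proof (cases p')
      case (real q)
      then have q: "1 \<le> q" using p' by (simp add: one_ereal_def)
      have "real N / q < real N / r - (s - s')"
      proof (cases "s' = s")
        case True
        \<comment> \<open>\<open>p' < p\<close> belongs to the other branch and
          \<open>p' = p\<close> is trivial, so equal orders leave only
          \<open>p' > p\<close>.\<close>
        then have "r < q" using no nontrivial(1) real r by auto
        then show ?thesis using True N1 q r by (simp add: divide_strict_left_mono)
      next
        case False
        then have lt: "s' < s" using s's by simp
        define D where "D = real N - (s - s') * r"
        have "(s - real N / r) * r < s' * r" using \<sigma> r by (intro mult_strict_right_mono) auto
        \<comment> \<open>Positivity of the denominator in the critical exponent is the failure of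
          the first alternative, multiplied by \<open>r\<close>.\<close>
        then have D: "0 < D" using r by (simp add: D_def algebra_simps)
        have "\<not> p' \<le> ereal (real N) * p / (ereal (real N) - ereal (s - s') * p)"
          using not_range \<sigma> lt p' r by auto
        then have "real N * r / D < q" using r real D by (simp add: D_def)
        then have "real N * r < q * D" using D by (simp add: pos_divide_less_eq)
        \<comment> \<open>Exceeding the critical exponent \<open>N * r / D\<close> is, after taking
          reciprocals, the strict inequality between the exponents \<open>s - N / p\<close> and
          \<open>s' - N / p'\<close>.\<close>
        then have "real N * r / (q * r) < q * D / (q * r)" using q r by (intro divide_strict_right_mono) auto
        then have "real N / q < D / r" using q r by simp
        also have "D / r = real N / r - (s - s')" using r by (simp add: D_def diff_divide_distrib)
        finally show ?thesis .
      qed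
      then show ?thesis using real N by simp
    next
      case PInf
      \<comment> \<open>With \<open>N / p' = 0\<close> the required inequality is the failure of the
        first alternative.\<close>
      then show ?thesis using \<sigma> N by simp
    qed (use p' in auto)
    then show ?thesis
      using not_embedded_if_concentration[OF Omega(1,2,4) s r(2) s'0 s's p'] r by simp
  qed
qed

end
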